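(* Let $A=\Bbbk Q/I$ be a special multiserial and locally monomial algebra. Then $A$ is a UMP algebra if and only if for every $\omega$-relation $r$, the path $\omega(N(r))$ is cyclic and $r$ is the unique relation in $R_{N(r)}$ that is a subpath of some power of $\omega(N(r))$, i.e. $$R_{N(r)}\cap\{\text{subpaths of } \omega(N(r))^{(p)}:\ p\in\mathbb{Z}^+\}=\{r\}.$$
   Context: Basics. $\Bbbk$ is an algebraically closed field, $Q=(Q_0,Q_1,s,t)$ is a finite connected quiver, $I$ is an admissible ideal of the path algebra $\Bbbk Q$, and $A=\Bbbk Q/I$. Paths are composed from left to right: $uv$ is a path when $t(u)=s(v)$, and $uv=0$ in $\Bbbk Q$ otherwise. $\mathcal{P}(Q)$ is the set of all paths (including trivial ones). A non-trivial path $w$ is factored into arrows as $w=w^0w^1\cdots w^{l_w}$, so its length is $l_w+1$. A path $w$ is cyclic if $s(w)=t(w)$. $u\mid v$ means that $u$ is a subpath of $v$. UMP. For $\mathfrak m\in\mathcal P(Q)$, $\mathfrak m+I$ is a maximal path of $A$ if $\mathfrak m\notin I$ and $\alpha\mathfrak m\in I$, $\mathfrak m\alpha\in I$ for every arrow $\alpha\in Q_1$. $A$ is a UMP algebra if every arrow extends to a unique maximal path, i.e. for every arrow $a$ there is exactly one maximal path $\mathfrak m+I$ having a representative in $\mathcal P(Q)$ of which $a$ is a subpath (equivalently, two different maximal paths have no representatives with a common arrow). Paths $\omega_a$. $Q$ is a cyclic quiver if it consists of pairwise distinct vertices in a single oriented cycle with arrows $\alpha_0,\dots,\alpha_k$ ($k\ge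 0$), $t(\alpha_i)=s(\alpha_{i+1})$ with indices mod $k+1$ (a single loop if $k=0$). If $Q$ is cyclic, fix one path $\alpha_0\cdots\alpha_k$ running once through all the arrows and put $\omega_a:=\alpha_0\cdots\alpha_k$ for all $a\in Q_1$. If $Q$ is not cyclic, $\omega_a$ is the (unique) path of maximal length in the set of paths $\omega$ such that $a\mid\omega$ and, for every $0\le j<l_\omega$, exactly one arrow of $Q$ starts at $t(\omega^j)$ and exactly one arrow of $Q$ ends at $t(\omega^j)$. Write $l_a:=l_{\omega_a}$. Ramifications graph. $G_{Q,I}$ is the oriented graph with vertex set $\{\omega_a\mid a\in Q_1\}$ and an edge from $\omega_a$ to $\omega_b$ if and only if $\omega_a\ne\omega_b$, $t(\omega_a)=s(\omega_b)$ and $\omega_a^{l_a}\omega_b^0\notin I$ (last arrow of $\omega_a$ followed by first arrow of $\omega_b$). $\mathcal D_{Q,I}$ is the set of its weakly connected components. For $N\in\mathcal D_{Q,I}$, $Q_N$ is the subquiver of $Q$ whose arrows are the $\alpha\in Q_1$ with $\omega_\alpha$ a vertex of $N$ and whose vertices are the endpoints of these arrows; $I_N:=I\cap\Bbbk Q_N$ and $A_N:=\Bbbk Q_N/I_N$. $A$ is special multiserial if for every $\alpha\in Q_1$ there is at most one arrow $\beta$ with $\alpha\beta\notin I$ and at most one arrow $\gamma$ with $\gamma\alpha\notin I$. $A$ is locally monomial if $A_N$ is a monomial algebra ($I_N$ is generated by paths) for all $N\in\mathcal D_{Q,I}$. In that case $R_N$ denotes the minimal set of paths (zero relations) generating $I_N$.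 The path $\omega(N)$. For special multiserial $A$, each $N\in\mathcal D_{Q,I}$ is either a chain $\omega_0\to\omega_1\to\cdots\to\omega_n$ or an oriented cycle $\omega_0\to\cdots\to\omega_n\to\omega_0$ (the listed vertices being distinct, $n\ge 0$). Put $\omega(N):=\omega_0\cdots\omega_n$ (well defined up to rotation in the cycle case; fix a choice). $\omega(N)^{(p)}$ is the composition of $\omega(N)$ with itself $p$ times (for $p\geq 2$ it is a path only if $\omega(N)$ is cyclic). $\omega$-relations. A path $r\in I$ of length greater than two is an $\omega$-relation if $r$ is the only subpath of $r$ that lies in $I$. For such $r$ there is a unique component, denoted $N(r)$, with $r\in\mathcal P(Q_{N(r)})$. *)

theory Defs
  imports
    "HOL-Library.Poly_Mapping"
    "HOL-Computational_Algebra.Polynomial"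
    "HOL-Algebra.QuotRing"
    "HOL-Algebra.Ideal_Product"
    "Graph_Theory.Arc_Walk"
    "Graph_Theory.Digraph_Component"
begin

section \<open>Paths of a quiver\<close>

text \<open>
  A quiver is a \<^typ>\<open>('v, 'a) pre_digraph\<close> with vertex set \<^term>\<open>verts\<close>, arrow set
  \<^term>\<open>arcs\<close>, source map \<^term>\<open>tail\<close> and target map \<^term>\<open>head\<close>. A path is its source
  together with the list of its arrows, composed from left to right; the trivial path at
  \<open>v\<close> is \<open>(v, [])\<close>.
\<close>

type_synonym ('v, 'a) qpath = "'v \<times> 'a list"

abbreviation qsrc :: "('v, 'a) qpath \<Rightarrow> 'v" where
  "qsrc w \<equiv> fst w"

abbreviation arrows :: "('v, 'a) qpath \<Rightarrow> 'a list" where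
  "arrows w \<equiv> snd w"

definition qtgt :: "('v, 'a) pre_digraph \<Rightarrow> ('v, 'a) qpath \<Rightarrow> 'v" where
  "qtgt Q w = last (pre_digraph.awalk_verts Q (qsrc w) (arrows w))"

definition qpaths :: "('v, 'a) pre_digraph \<Rightarrow> ('v, 'a) qpath set" where
  "qpaths Q = {w. pre_digraph.awalk Q (qsrc w) (arrows w) (qtgt Q w)}"

definition arrow_path :: "('v, 'a) pre_digraph \<Rightarrow> 'a \<Rightarrow> ('v, 'a) qpath" where
  "arrow_path Q a = (tail Q a, [a])"

text \<open>Only meaningful if the target of the first path is the source of the second one.\<close>

definition qcomp :: "('v, 'a) qpath \<Rightarrow> ('v, 'a) qpath \<Rightarrow> ('v, 'a) qpath" where
  "qcomp u w = (qsrc u, arrows u @ arrows w)"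

definition cyclic_path :: "('v, 'a) pre_digraph \<Rightarrow> ('v, 'a) qpath \<Rightarrow> bool" where
  "cyclic_path Q w \<longleftrightarrow> qsrc w = qtgt Q w"

definition subpath :: "('v, 'a) pre_digraph \<Rightarrow> ('v, 'a) qpath \<Rightarrow> ('v, 'a) qpath \<Rightarrow> bool" where
  "subpath Q u w \<longleftrightarrow> u \<in> qpaths Q \<and>
     (\<exists>x\<in>qpaths Q. \<exists>y\<in>qpaths Q. qtgt Q x = qsrc u \<and> qtgt Q u = qsrc y \<and>
        w = qcomp x (qcomp u y))"

definition concat_paths :: "('v, 'a) qpath list \<Rightarrow> ('v, 'a) qpath" where
  "concat_paths ws = (qsrc (hd ws), concat (map arrows ws))"

text \<open>For \<open>p \<ge> 2\<close> this is a path only if \<open>w\<close> is cyclic.\<close>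

definition path_power :: "('v, 'a) qpath \<Rightarrow> nat \<Rightarrow> ('v, 'a) qpath" where
  "path_power w p = concat_paths (replicate p w)"


section \<open>The path algebra and admissible ideals\<close>

text \<open>
  Elements of the path algebra are finitely supported families of scalars indexed by paths;
  the product of two non-composable paths is zero.
\<close>

definition path_mult ::
  "('v, 'a) pre_digraph \<Rightarrow> (('v, 'a) qpath \<Rightarrow>\<^sub>0 'k::field) \<Rightarrow> (('v, 'a) qpath \<Rightarrow>\<^sub>0 'k)
     \<Rightarrow> (('v, 'a) qpath \<Rightarrow>\<^sub>0 'k)" where
  "path_mult Q x y =
     (\<Sum>u\<in>Poly_Mapping.keys x. \<Sum>w\<in>Poly_Mapping.keys y.
        if qtgt Q u = qsrc w
        then Poly_Mapping.single (qcomp u w) (Poly_Mapping.lookup x u * Poly_Mapping.lookup y w)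
        else 0)"

definition path_algebra ::
  "('v, 'a) pre_digraph \<Rightarrow> (('v, 'a) qpath \<Rightarrow>\<^sub>0 'k::field) ring" where
  "path_algebra Q =
     \<lparr>carrier = {x. Poly_Mapping.keys x \<subseteq> qpaths Q},
      mult = path_mult Q,
      one = (\<Sum>v\<in>verts Q. Poly_Mapping.single (v, []) 1),
      zero = 0,
      add = (+)\<rparr>"

abbreviation path_elem :: "('v, 'a) qpath \<Rightarrow> (('v, 'a) qpath \<Rightarrow>\<^sub>0 'k::field)" where
  "path_elem w \<equiv> Poly_Mapping.single w 1"

definition arrow_ideal ::
  "('v, 'a) pre_digraph \<Rightarrow> (('v, 'a) qpath \<Rightarrow>\<^sub>0 'k::field) set" where
  "arrow_ideal Q = genideal (path_algebra Q) ((\<lambda>a. path_elem (arrow_path Q a)) ` arcs Q)"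

primrec arrow_ideal_power ::
  "('v, 'a) pre_digraph \<Rightarrow> nat \<Rightarrow> (('v, 'a) qpath \<Rightarrow>\<^sub>0 'k::field) set" where
  "arrow_ideal_power Q 0 = carrier (path_algebra Q)"
| "arrow_ideal_power Q (Suc n) =
     ideal_prod (path_algebra Q) (arrow_ideal_power Q n) (arrow_ideal Q)"

definition admissible_ideal ::
  "('v, 'a) pre_digraph \<Rightarrow> (('v, 'a) qpath \<Rightarrow>\<^sub>0 'k::field) set \<Rightarrow> bool" where
  "admissible_ideal Q I \<longleftrightarrow> ideal I (path_algebra Q) \<and>
     (\<exists>m\<ge>2. arrow_ideal_power Q m \<subseteq> I \<and> I \<subseteq> arrow_ideal_power Q 2)"


section \<open>UMP algebras and special multiserial algebras\<close>

text \<open>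
  The elements of \<open>A = kQ/I\<close> are the cosets of \<open>I\<close>; so a maximal path of \<open>A\<close> is a coset, and
  two paths of \<open>Q\<close> which are congruent modulo \<open>I\<close> represent the same maximal path.
\<close>

definition maximal_paths ::
  "('v, 'a) pre_digraph \<Rightarrow> (('v, 'a) qpath \<Rightarrow>\<^sub>0 'k::field) set
     \<Rightarrow> (('v, 'a) qpath \<Rightarrow>\<^sub>0 'k) set set" where
  "maximal_paths Q I =
     {I +>\<^bsub>path_algebra Q\<^esub> path_elem m | m. m \<in> qpaths Q \<and> path_elem m \<notin> I \<and>
        (\<forall>a\<in>arcs Q. path_elem (arrow_path Q a) \<otimes>\<^bsub>path_algebra Q\<^esub> path_elem m \<in> I \<and>
                    path_elem m \<otimes>\<^bsub>path_algebra Q\<^esub> path_elem (arrow_path Q a) \<in> I)}"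

definition UMP_algebra ::
  "('v, 'a) pre_digraph \<Rightarrow> (('v, 'a) qpath \<Rightarrow>\<^sub>0 'k::field) set \<Rightarrow> bool" where
  "UMP_algebra Q I \<longleftrightarrow>
     (\<forall>a\<in>arcs Q. \<exists>!M. M \<in> maximal_paths Q I \<and>
        (\<exists>w\<in>qpaths Q. I +>\<^bsub>path_algebra Q\<^esub> path_elem w = M \<and> subpath Q (arrow_path Q a) w))"

definition special_multiserial ::
  "('v, 'a) pre_digraph \<Rightarrow> (('v, 'a) qpath \<Rightarrow>\<^sub>0 'k::field) set \<Rightarrow> bool" where
  "special_multiserial Q I \<longleftrightarrow>
     (\<forall>a\<in>arcs Q.
        (\<exists>\<^sub>\<le>\<^sub>1 b. b \<in> arcs Q \<and>
           path_elem (arrow_path Q a) \<otimes>\<^bsub>path_algebra Q\<^esub> path_elem (arrow_path Q b) \<notin> I) \<and>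
        (\<exists>\<^sub>\<le>\<^sub>1 c. c \<in> arcs Q \<and>
           path_elem (arrow_path Q c) \<otimes>\<^bsub>path_algebra Q\<^esub> path_elem (arrow_path Q a) \<notin> I))"


section \<open>The paths \<open>\<omega>\<^sub>a\<close> and the ramifications graph\<close>

definition oriented_cycle :: "('v, 'a) pre_digraph \<Rightarrow> 'a list \<Rightarrow> bool" where
  "oriented_cycle Q as \<longleftrightarrow> as \<noteq> [] \<and> distinct (map (tail Q) as) \<and>
     verts Q = tail Q ` set as \<and> arcs Q = set as \<and>
     (\<forall>i<length as. head Q (as ! i) = tail Q (as ! (Suc i mod length as)))"

definition cyclic_quiver :: "('v, 'a) pre_digraph \<Rightarrow> bool" where
  "cyclic_quiver Q \<longleftrightarrow> (\<exists>as. oriented_cycle Q as)"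

text \<open>
  The argument \<open>c\<close> below is the list of arrows of the path which is fixed once and for all if
  \<open>Q\<close> is a cyclic quiver; it is irrelevant otherwise.
\<close>

definition omega_path ::
  "('v, 'a) pre_digraph \<Rightarrow> 'a list \<Rightarrow> 'a \<Rightarrow> ('v, 'a) qpath" where
  "omega_path Q c a =
     (if cyclic_quiver Q then (tail Q (hd c), c)
      else THE w. is_arg_max (\<lambda>w. length (arrows w))
        (\<lambda>w. w \<in> qpaths Q \<and> subpath Q (arrow_path Q a) w \<and>
             (\<forall>j. Suc j < length (arrows w) \<longrightarrow>
                (\<exists>!b. b \<in> arcs Q \<and> tail Q b = head Q (arrows w ! j)) \<and>
                (\<exists>!b. b \<in> arcs Q \<and> head Q b = head Q (arrows w ! j)))) w)"

type_synonym ('v, 'a) ram_graph =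
  "(('v, 'a) qpath, ('v, 'a) qpath \<times> ('v, 'a) qpath) pre_digraph"

definition ramifications_graph ::
  "('v, 'a) pre_digraph \<Rightarrow> (('v, 'a) qpath \<Rightarrow>\<^sub>0 'k::field) set \<Rightarrow> 'a list
     \<Rightarrow> ('v, 'a) ram_graph" where
  "ramifications_graph Q I c =
     \<lparr>verts = omega_path Q c ` arcs Q,
      arcs = {(x, y). x \<in> omega_path Q c ` arcs Q \<and> y \<in> omega_path Q c ` arcs Q \<and>
                x \<noteq> y \<and> qtgt Q x = qsrc y \<and>
                path_elem (arrow_path Q (last (arrows x)))
                  \<otimes>\<^bsub>path_algebra Q\<^esub> path_elem (arrow_path Q (hd (arrows y))) \<notin> I},
      tail = fst, head = snd\<rparr>"

text \<open>
  \<^const>\<open>Digraph_Component.connected\<close> is connectedness of the underlying undirected graph.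
\<close>

definition components ::
  "('v, 'a) pre_digraph \<Rightarrow> (('v, 'a) qpath \<Rightarrow>\<^sub>0 'k::field) set \<Rightarrow> 'a list
     \<Rightarrow> ('v, 'a) ram_graph set" where
  "components Q I c =
     {N. pre_digraph.max_subgraph (ramifications_graph Q I c) Digraph_Component.connected N}"


section \<open>Local data of a component\<close>

definition subquiver ::
  "('v, 'a) pre_digraph \<Rightarrow> 'a list \<Rightarrow> ('v, 'a) ram_graph \<Rightarrow> ('v, 'a) pre_digraph" where
  "subquiver Q c N =
     (let S = {a \<in> arcs Q. omega_path Q c a \<in> verts N}
      in \<lparr>verts = tail Q ` S \<union> head Q ` S, arcs = S, tail = tail Q, head = head Q\<rparr>)"

definition local_ideal ::
  "('v, 'a) pre_digraph \<Rightarrow> (('v, 'a) qpath \<Rightarrow>\<^sub>0 'k::field) set \<Rightarrow> 'a list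
     \<Rightarrow> ('v, 'a) ram_graph \<Rightarrow> (('v, 'a) qpath \<Rightarrow>\<^sub>0 'k) set" where
  "local_ideal Q I c N = I \<inter> carrier (path_algebra (subquiver Q c N))"

definition generated_by_paths ::
  "('v, 'a) pre_digraph \<Rightarrow> (('v, 'a) qpath \<Rightarrow>\<^sub>0 'k::field) set \<Rightarrow> ('v, 'a) qpath set \<Rightarrow> bool" where
  "generated_by_paths Q J R \<longleftrightarrow>
     R \<subseteq> qpaths Q \<and> J = genideal (path_algebra Q) (path_elem ` R)"

definition locally_monomial ::
  "('v, 'a) pre_digraph \<Rightarrow> (('v, 'a) qpath \<Rightarrow>\<^sub>0 'k::field) set \<Rightarrow> 'a list \<Rightarrow> bool" where
  "locally_monomial Q I c \<longleftrightarrow>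
     (\<forall>N\<in>components Q I c. \<exists>R. generated_by_paths (subquiver Q c N) (local_ideal Q I c N) R)"

definition zero_relations ::
  "('v, 'a) pre_digraph \<Rightarrow> (('v, 'a) qpath \<Rightarrow>\<^sub>0 'k::field) set \<Rightarrow> 'a list
     \<Rightarrow> ('v, 'a) ram_graph \<Rightarrow> ('v, 'a) qpath set" where
  "zero_relations Q I c N =
     (THE R. generated_by_paths (subquiver Q c N) (local_ideal Q I c N) R \<and>
        (\<forall>R'\<subset>R. \<not> generated_by_paths (subquiver Q c N) (local_ideal Q I c N) R'))"

definition component_chain :: "('v, 'a) ram_graph \<Rightarrow> ('v, 'a) qpath list \<Rightarrow> bool" where
  "component_chain N ws \<longleftrightarrow> ws \<noteq> [] \<and> distinct ws \<and> verts N = set ws \<and>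
     arcs N = {(ws ! i, ws ! Suc i) | i. Suc i < length ws}"

definition component_cycle :: "('v, 'a) ram_graph \<Rightarrow> ('v, 'a) qpath list \<Rightarrow> bool" where
  "component_cycle N ws \<longleftrightarrow> ws \<noteq> [] \<and> distinct ws \<and> verts N = set ws \<and>
     arcs N = {(ws ! i, ws ! (Suc i mod length ws)) | i. i < length ws}"

text \<open>The possible values of \<open>\<omega>(N)\<close>: unique for a chain, unique up to rotation for a cycle.\<close>

definition component_paths :: "('v, 'a) ram_graph \<Rightarrow> ('v, 'a) qpath set" where
  "component_paths N = {concat_paths ws | ws. component_chain N ws \<or> component_cycle N ws}"

text \<open>
  \<open>om\<close> is a choice of the paths \<open>\<omega>(N)\<close>. That every \<^term>\<open>component_paths N\<close> is
  nonempty (for special multiserial \<open>A\<close>) is not part of this condition.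
\<close>

definition omega_choice ::
  "('v, 'a) pre_digraph \<Rightarrow> (('v, 'a) qpath \<Rightarrow>\<^sub>0 'k::field) set \<Rightarrow> 'a list
     \<Rightarrow> (('v, 'a) ram_graph \<Rightarrow> ('v, 'a) qpath) \<Rightarrow> bool" where
  "omega_choice Q I c om \<longleftrightarrow>
     (\<forall>N\<in>components Q I c. component_paths N \<noteq> {} \<longrightarrow> om N \<in> component_paths N)"

definition omega_relation ::
  "('v, 'a) pre_digraph \<Rightarrow> (('v, 'a) qpath \<Rightarrow>\<^sub>0 'k::field) set \<Rightarrow> ('v, 'a) qpath \<Rightarrow> bool" where
  "omega_relation Q I r \<longleftrightarrow> r \<in> qpaths Q \<and> path_elem r \<in> I \<and> length (arrows r) > 2 \<and>
     (\<forall>u. subpath Q u r \<and> path_elem u \<in> I \<longrightarrow> u = r)"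

definition relation_component ::
  "('v, 'a) pre_digraph \<Rightarrow> (('v, 'a) qpath \<Rightarrow>\<^sub>0 'k::field) set \<Rightarrow> 'a list
     \<Rightarrow> ('v, 'a) qpath \<Rightarrow> ('v, 'a) ram_graph" where
  "relation_component Q I c r = (THE N. N \<in> components Q I c \<and> r \<in> qpaths (subquiver Q c N))"


section \<open>The path algebra is a ring\<close>

lemma qtgt_simps:
  "qtgt Q w = (if arrows w = [] then qsrc w else head Q (last (arrows w)))"
  by (auto simp: qtgt_def pre_digraph.awalk_verts_conv)

lemma qsrc_qcomp [simp]: "qsrc (qcomp u w) = qsrc u"
  by (simp add: qcomp_def)

lemma qtgt_qcomp: "qtgt Q u = qsrc w \<Longrightarrow> qtgt Q (qcomp u w) = qtgt Q w"
  by (auto simp: qtgt_simps qcomp_def)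

lemma qcomp_assoc: "qcomp (qcomp u w) x = qcomp u (qcomp w x)"
  by (simp add: qcomp_def)

lemma cas_append:
  "pre_digraph.cas Q u p v \<Longrightarrow> pre_digraph.cas Q v q w \<Longrightarrow> pre_digraph.cas Q u (p @ q) w"
  by (induction p arbitrary: u) (auto simp: pre_digraph.cas.simps)

lemma qcomp_in_qpaths:
  assumes "u \<in> qpaths Q" "w \<in> qpaths Q" "qtgt Q u = qsrc w"
  shows "qcomp u w \<in> qpaths Q"
  using assms
  by (auto simp: qpaths_def pre_digraph.awalk_def qtgt_qcomp qcomp_def
      intro: cas_append[of Q "qsrc u" "arrows u" "qtgt Q u"]
      simp flip: qtgt_qcomp[of Q u w])

lemma trivial_in_qpaths: "v \<in> verts Q \<Longrightarrow> (v, []) \<in> qpaths Q"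
  by (auto simp: qpaths_def pre_digraph.awalk_def pre_digraph.cas.simps qtgt_simps)

lemma qpaths_verts:
  assumes "wf_digraph Q" "u \<in> qpaths Q"
  shows "qsrc u \<in> verts Q" "qtgt Q u \<in> verts Q"
proof -
  show "qsrc u \<in> verts Q"
    using assms by (auto simp: qpaths_def pre_digraph.awalk_def)
  then show "qtgt Q u \<in> verts Q"
    using assms last_in_set[of "arrows u"]
    by (auto simp: qpaths_def pre_digraph.awalk_def qtgt_simps intro!: wf_digraph.head_in_verts)
qed

context
  fixes Q :: "('v, 'a) pre_digraph"
begin

private definition base :: "('v, 'a) qpath \<Rightarrow> 'k::field \<Rightarrow> ('v, 'a) qpath \<Rightarrow> 'k \<Rightarrow> (('v, 'a) qpath \<Rightarrow>\<^sub>0 'k)"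
  where "base u a w b =
    (if qtgt Q u = qsrc w then Poly_Mapping.single (qcomp u w) (a * b) else 0)"

private lemma path_mult_superset:
  assumes "finite S" "Poly_Mapping.keys x \<subseteq> S" "finite T" "Poly_Mapping.keys y \<subseteq> T"
  shows "path_mult Q x y =
    (\<Sum>u\<in>S. \<Sum>w\<in>T. base u (Poly_Mapping.lookup x u) w (Poly_Mapping.lookup y w))"
proof -
  have "path_mult Q x y = (\<Sum>u\<in>Poly_Mapping.keys x. \<Sum>w\<in>T.
      base u (Poly_Mapping.lookup x u) w (Poly_Mapping.lookup y w))"
    unfolding path_mult_def
    by (rule sum.cong[OF refl], rule sum.mono_neutral_cong_left)
       (use assms in \<open>auto simp: base_def in_keys_iff\<close>)
  also have "\<dots> = (\<Sum>u\<in>S. \<Sum>w\<in>T.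
      base u (Poly_Mapping.lookup x u) w (Poly_Mapping.lookup y w))"
    by (rule sum.mono_neutral_left)
       (use assms in \<open>auto simp: base_def in_keys_iff intro!: sum.neutral\<close>)
  finally show ?thesis .
qed

lemma path_mult_add_left:
  "path_mult Q (x + y) z = path_mult Q x z + path_mult Q y z"
proof -
  let ?S = "Poly_Mapping.keys x \<union> Poly_Mapping.keys y" and ?T = "Poly_Mapping.keys z"
  have k: "Poly_Mapping.keys (x + y) \<subseteq> ?S" by (rule keys_add)
  show ?thesis
    using k by (subst (1 2 3) path_mult_superset[of ?S _ ?T])
      (auto simp: sum.distrib[symmetric] base_def lookup_add single_add[symmetric] algebra_simps
        intro!: sum.cong)
qed

lemma path_mult_add_right:
  "path_mult Q z (x + y) = path_mult Q z x + path_mult Q z y"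
proof -
  let ?S = "Poly_Mapping.keys x \<union> Poly_Mapping.keys y" and ?T = "Poly_Mapping.keys z"
  have k: "Poly_Mapping.keys (x + y) \<subseteq> ?S" by (rule keys_add)
  show ?thesis
    using k by (subst (1 2 3) path_mult_superset[of ?T _ ?S])
      (auto simp: sum.distrib[symmetric] base_def lookup_add single_add[symmetric] algebra_simps
        intro!: sum.cong)
qed

lemma path_mult_zero [simp]: "path_mult Q 0 x = 0" "path_mult Q x 0 = 0"
  by (auto simp: path_mult_def)

lemma path_mult_sum_left: "path_mult Q (sum f A) z = (\<Sum>i\<in>A. path_mult Q (f i) z)"
  by (induction A rule: infinite_finite_induct) (auto simp: path_mult_add_left)

lemma path_mult_sum_right: "path_mult Q z (sum f A) = (\<Sum>i\<in>A. path_mult Q z (f i))"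
  by (induction A rule: infinite_finite_induct) (auto simp: path_mult_add_right)

lemma path_mult_single:
  "path_mult Q (Poly_Mapping.single u a) (Poly_Mapping.single w b) =
    (if qtgt Q u = qsrc w then Poly_Mapping.single (qcomp u w) (a * b) else 0)"
  by (subst path_mult_superset[of "{u}" _ "{w}"]) (auto simp: base_def lookup_single)

lemma sum_singles:
  "(\<Sum>u\<in>Poly_Mapping.keys x. Poly_Mapping.single u (Poly_Mapping.lookup x u)) = x"
  by (rule poly_mapping_eqI)
     (auto simp: lookup_sum lookup_single when_def in_keys_iff sum.delta)

lemma path_mult_assoc:
  "path_mult Q (path_mult Q x y) z = path_mult Q x (path_mult Q y z)"
proof -
  have *: "path_mult Q (path_mult Q (Poly_Mapping.single u a) (Poly_Mapping.single w b))
             (Poly_Mapping.single t c) =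
           path_mult Q (Poly_Mapping.single u a)
             (path_mult Q (Poly_Mapping.single w b) (Poly_Mapping.single t c))"
    for u w t and a b c :: "'c::field"
    by (auto simp: path_mult_single qtgt_qcomp qcomp_assoc mult.assoc)
  show ?thesis
    by (subst (1 2) sum_singles[of x, symmetric], subst (1 2) sum_singles[of y, symmetric],
        subst (1 2) sum_singles[of z, symmetric])
       (simp add: path_mult_sum_left path_mult_sum_right *)
qed

lemma path_mult_closed:
  assumes "Poly_Mapping.keys x \<subseteq> qpaths Q" "Poly_Mapping.keys y \<subseteq> qpaths Q"
  shows "Poly_Mapping.keys (path_mult Q x y) \<subseteq> qpaths Q"
proof -
  have "Poly_Mapping.keys (path_mult Q x y) \<subseteq>
    (\<Union>u\<in>Poly_Mapping.keys x. \<Union>w\<in>Poly_Mapping.keys y. Poly_Mapping.keys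
       (if qtgt Q u = qsrc w
        then Poly_Mapping.single (qcomp u w) (Poly_Mapping.lookup x u * Poly_Mapping.lookup y w)
        else 0))"
    unfolding path_mult_def by (intro order_trans[OF keys_sum] UN_mono order_refl)
  also have "\<dots> \<subseteq> qpaths Q"
    using assms by (intro UN_least) (auto intro!: qcomp_in_qpaths simp del: split_paired_All)
  finally show ?thesis .
qed

lemma path_mult_one:
  assumes "fin_digraph Q" "Poly_Mapping.keys x \<subseteq> qpaths Q"
  shows "path_mult Q (\<Sum>v\<in>verts Q. Poly_Mapping.single (v, []) 1) x = x"
    and "path_mult Q x (\<Sum>v\<in>verts Q. Poly_Mapping.single (v, []) 1) = x"
proof -
  interpret fin_digraph Q by fact
  have l: "path_mult Q (\<Sum>v\<in>verts Q. Poly_Mapping.single (v, []) 1) (Poly_Mapping.single u b)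
      = Poly_Mapping.single u b" if "u \<in> qpaths Q" for u and b :: "'c::field"
    using qpaths_verts[OF wf_digraph that]
    by (simp add: path_mult_sum_left path_mult_single qtgt_simps[of Q "(_, [])"] qcomp_def
        sum.delta')
  have r: "path_mult Q (Poly_Mapping.single u b) (\<Sum>v\<in>verts Q. Poly_Mapping.single (v, []) 1)
      = Poly_Mapping.single u b" if "u \<in> qpaths Q" for u and b :: "'c::field"
    using qpaths_verts[OF wf_digraph that]
    by (simp add: path_mult_sum_right path_mult_single qcomp_def sum.delta)
  show "path_mult Q (\<Sum>v\<in>verts Q. Poly_Mapping.single (v, []) 1) x = x"
    by (subst (1 2) sum_singles[of x, symmetric], subst path_mult_sum_right)
       (use assms l in \<open>auto intro!: sum.cong\<close>)
  show "path_mult Q x (\<Sum>v\<in>verts Q. Poly_Mapping.single (v, []) 1) = x"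
    by (subst (1 2) sum_singles[of x, symmetric], subst path_mult_sum_left)
       (use assms r in \<open>auto intro!: sum.cong\<close>)
qed

end

theorem path_algebra_ring:
  assumes "fin_digraph Q"
  shows "ring (path_algebra Q)"
proof (rule ringI)
  show "abelian_group (path_algebra Q)"
  proof (rule abelian_groupI)
    fix x assume "x \<in> carrier (path_algebra Q)"
    then show "\<exists>y\<in>carrier (path_algebra Q). y \<oplus>\<^bsub>path_algebra Q\<^esub> x = \<zero>\<^bsub>path_algebra Q\<^esub>"
      by (intro bexI[of _ "- x"]) (auto simp: path_algebra_def)
  qed (use keys_add in \<open>fastforce simp: path_algebra_def add_ac\<close>)+
  show "Group.monoid (path_algebra Q)"
  proof
    show "\<one>\<^bsub>path_algebra Q\<^esub> \<in> carrier (path_algebra Q)"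
      using keys_sum[of "\<lambda>v. Poly_Mapping.single (v, []) 1" "verts Q"] trivial_in_qpaths[of _ Q]
      by (fastforce simp: path_algebra_def)
  qed (use assms in \<open>simp_all add: path_algebra_def path_mult_assoc path_mult_one
         path_mult_closed\<close>)
qed (auto simp: path_algebra_def path_mult_add_left path_mult_add_right)

end

theory Submission
  imports Defs
begin

text \<open>
  For a special multiserial algebra the relation \<open>s x y\<close> saying that \<open>xy\<close> is a nonzero path of length
  two is a partial injection on the arrows, and every nonzero path is a chain of \<open>s\<close>. So maximal paths
  and \<open>\<omega>\<close>-relations are words inside the orbits of \<open>s\<close>, and an \<open>\<omega>\<close>-relation is a minimal zero word
  \<open>r = x # mid @ [y]\<close> that is a chain of \<open>s\<close>. If maximal words are determined by each of their arrows, the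
  maximal words extending \<open>x # mid\<close> and \<open>mid @ [y]\<close> coincide; the common word then begins with \<open>mid @ [y]\<close>
  and ends with \<open>x # mid\<close>, so its arrows form a cyclic orbit, and \<open>r\<close> is the only minimal zero word in it.
  Conversely, in a cyclic orbit with a single minimal zero word \<open>r\<close>, every maximal word starts with
  \<open>tl r\<close> and ends with \<open>butlast r\<close>, which leaves only one such word.

  The arrows of \<open>\<omega>(N)\<close> are those of \<open>N\<close>, which are closed under \<open>s\<close> in both directions. If \<open>\<omega>(N)\<close> is
  cyclic and no relation of length two is a subpath of one of its powers, these arrows form a cyclic
  orbit of \<open>s\<close>; conversely a cyclic orbit of \<open>s\<close> contains each \<open>\<omega>\<^sub>a\<close> that it meets, since interior
  vertices of \<open>\<omega>\<^sub>a\<close> do not branch, and therefore exhausts the component. Local monomiality is what makes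
  different maximal words through a common arrow represent different maximal paths.
\<close>

section \<open>Words over a partial injection\<close>

text \<open>The combinatorics lives in an abstract locale because it is instantiated three times:
  for nonzero paths, for reversed words, and for the words that produce
  \<open>\<omega>\<^sub>a\<close>. Cyclic orbits are not parametrised by residues. Two facts replace
  this: a set closed under \<open>s\<close> in both directions absorbs every chain that meets it,
  and of two chains with the same first letter the shorter is a prefix of the longer. Two obstacles
  shape the rest. The path \<open>\<omega>\<^sub>a\<close> depends on the quiver alone, so two
  consecutive arrows of it may have product in \<open>I\<close>, and \<omega>(N) need not be a chain
  of \<open>s\<close>. Moreover \<omega>-relations have length above two, whereas the uniqueness
  clause ranges over all of \<open>R_N\<close>. That clause is what excludes zero pairs from the
  powers of \<omega>(N) in one direction; in the other they are excluded because \<omega>(N) turns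
  out to be a closed chain of \<open>s\<close>. The bound \<open>m\<close> on nonzero words is the
  exponent in the admissibility of \<open>I\<close>.\<close>

lemma successively_right_unique:
  assumes "right_unique s" "successively s p" "successively s q" "p \<noteq> []" "q \<noteq> []" "hd p = hd q"
    "length p \<le> length q"
  shows "q = p @ drop (length p) q"
  using assms(2-)
proof (induction p arbitrary: q)
  case (Cons x p)
  obtain q' where q: "q = x # q'" using Cons.prems by (cases q) auto
  show ?case
  proof (cases "p = []")
    case False
    then have "q' \<noteq> []" using Cons.prems q by auto
    with False have "hd p = hd q'" using Cons.prems(1,2) q assms(1)
      by (auto simp: successively_Cons right_unique_def)
    then have "q' = p @ drop (length p) q'"
      using Cons.prems q False \<open>q' \<noteq> []\<close> by (intro Cons.IH) (auto simp: successively_Cons)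
    then show ?thesis using q by simp
  qed (simp add: q)
qed simp

lemma successively_right_total:
  assumes "successively s p" "p \<noteq> []" "x \<in> set p" "x \<noteq> last p"
  shows "\<exists>y\<in>set p. s x y"
proof -
  obtain u v where p: "p = u @ x # v" using assms(3) by (auto dest: split_list)
  then have "v \<noteq> []" using assms(4) by auto
  then show ?thesis using assms(1)
    by (intro bexI[of _ "hd v"]) (auto simp: p successively_append_iff successively_Cons)
qed

lemma successively_left_total:
  assumes "successively s p" "p \<noteq> []" "x \<in> set p" "x \<noteq> hd p"
  shows "\<exists>y\<in>set p. s y x"
  using successively_right_total[of "\<lambda>x y. s y x" "rev p" x] assms
  by (auto simp: last_rev)

text \<open>Membership in \<open>C\<close> spreads from one letter to both sides of the word. This
  is how a chain is confined to an orbit, to a component, or to whatever set is closed under the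
  relation.\<close>

lemma successively_set_subset:
  assumes "successively s p" "x \<in> set p" "x \<in> C"
    and succ: "\<And>x y. x \<in> C \<Longrightarrow> s x y \<Longrightarrow> y \<in> C"
    and pred: "\<And>x y. y \<in> C \<Longrightarrow> s x y \<Longrightarrow> x \<in> C"
  shows "set p \<subseteq> C"
proof -
  obtain u v where p: "p = u @ x # v" using assms(2) by (auto dest: split_list)
  have v: "set v \<subseteq> C" if "successively s (x # v)" "x \<in> C" for x v
    using that by (induction v arbitrary: x) (auto dest: succ)
  have u: "set u \<subseteq> C" if "successively s (u @ [x])" "x \<in> C" for x u
    using that
    by (induction u arbitrary: x rule: rev_induct) (auto simp: successively_append_iff dest: pred)
  have "successively s (x # v)" "successively s (u @ [x])"
    using assms(1) by (auto simp: p successively_append_iff)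
  then show ?thesis using u v assms(3) by (simp add: p)
qed

text \<open>\<open>Z p\<close> reads: the word \<open>p\<close> is the word of a nonzero path.\<close>

locale zero_words =
  fixes Z :: "'a list \<Rightarrow> bool" and m :: nat
  assumes Z_factor: "Z (u @ v @ w) \<Longrightarrow> v \<noteq> [] \<Longrightarrow> Z v"
    and Z_bounded: "Z p \<Longrightarrow> length p < m"
    and Z_nonempty: "\<not> Z []"
    and Z_right_unique: "Z [x, y] \<Longrightarrow> Z [x, z] \<Longrightarrow> y = z"
    and Z_left_unique: "Z [y, x] \<Longrightarrow> Z [z, x] \<Longrightarrow> y = z"
begin

abbreviation s :: "'a \<Rightarrow> 'a \<Rightarrow> bool" where "s x y \<equiv> Z [x, y]"

definition max_word :: "'a list \<Rightarrow> bool" where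
  "max_word w \<longleftrightarrow> Z w \<and> (\<forall>a. \<not> Z (a # w) \<and> \<not> Z (w @ [a]))"

text \<open>
  The words of \<open>\<omega>\<close>-relations: as \<open>butlast r\<close> and \<open>tl r\<close> are nonzero and overlap in an arrow, \<open>r\<close> is
  the word of a path.
\<close>

definition orel :: "'a list \<Rightarrow> bool" where
  "orel r \<longleftrightarrow> length r > 2 \<and> \<not> Z r \<and> Z (butlast r) \<and> Z (tl r)"

lemma Z_factor': "Z p \<Longrightarrow> p = u @ v @ w \<Longrightarrow> v \<noteq> [] \<Longrightarrow> Z v"
  using Z_factor by blast

lemma Z_successively: "Z p \<Longrightarrow> successively s p"
proof (induction p)
  case (Cons x p)
  show ?case
  proof (cases p)
    case (Cons y q)
    have "Z p" "s x y" using Cons.prems Cons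
      by (auto intro: Z_factor'[of "x # y # q" "[x]" "y # q" "[]"] Z_factor'[of "x # y # q" "[]" "[x, y]" q])
    then show ?thesis using Cons.IH Cons by simp
  qed simp
qed simp

lemma right_unique_s: "right_unique s"
  using Z_right_unique by (auto simp: right_unique_def)

lemma right_unique_s_conv: "right_unique (\<lambda>x y. s y x)"
  using Z_left_unique by (auto simp: right_unique_def)

text \<open>Every one-letter extension uses up part of the room \<open>m - length p\<close> left by
  the bound on nonzero words, so extending on either side must stop.\<close>

lemma ex_max_word:
  assumes "Z p"
  obtains u v where "max_word (u @ p @ v)"
proof -
  have "\<exists>u v. max_word (u @ p @ v)"
    using assms
  proof (induction "m - length p" arbitrary: p rule: less_induct)
    case less
    show ?case
    proof (cases "max_word p")
      case True
      then show ?thesis by (intro exI[of _ "[]"]) simp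
    next
      case False
      then obtain a where "Z (a # p) \<or> Z (p @ [a])" using less.prems by (auto simp: max_word_def)
      then show ?thesis
      proof
        assume a: "Z (a # p)"
        then have "m - length (a # p) < m - length p" using Z_bounded[OF a] by simp
        from less.hyps[OF this a] obtain u v where "max_word (u @ (a # p) @ v)" by blast
        then show ?thesis by (intro exI[of _ "u @ [a]"] exI[of _ v]) simp
      next
        assume a: "Z (p @ [a])"
        then have "m - length (p @ [a]) < m - length p" using Z_bounded[OF a] by simp
        from less.hyps[OF this a] obtain u v where "max_word (u @ (p @ [a]) @ v)" by blast
        then show ?thesis by (intro exI[of _ "u"] exI[of _ "a # v"]) simp
      qed
    qed
  qed
  then show ?thesis using that by blast
qed

text \<open>All consecutive pairs but the first lie in \<open>tl r\<close>, and the first lies in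
  \<open>butlast r\<close> because \<open>r\<close> has at least three letters. For a relation of
  length two this fails: its only pair is zero.\<close>

lemma orel_successively: "orel r \<Longrightarrow> successively s r"
proof -
  assume r: "orel r"
  then obtain x y p where [simp]: "r = x # y # p"
    by (cases r; cases "tl r") (auto simp: orel_def)
  have "p \<noteq> []" using r by (auto simp: orel_def)
  then have "s x y" using r Z_factor'[of "butlast r" "[]" "[x, y]" "butlast p"]
    by (auto simp: orel_def)
  then show ?thesis using r Z_successively[of "y # p"] by (auto simp: orel_def)
qed

text \<open>Letters are dropped from the front until the shortest zero suffix of
  \<open>w @ [z]\<close> is left. It is minimal, and it has more than two letters because the final
  pair is nonzero.\<close>

lemma orel_suffix:
  assumes "Z w" "s (last w) z" "\<not> Z (w @ [z])"
  obtains u r where "w @ [z] = u @ r @ [z]" "orel (r @ [z])"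
proof -
  have "\<exists>u r. w @ [z] = u @ r @ [z] \<and> orel (r @ [z])" using assms
  proof (induction w)
    case (Cons x w)
    show ?case
    proof (cases "w = []")
      case False
      then have w: "Z w" using Cons.prems(1) by (auto intro: Z_factor'[of _ "[x]" w "[]"])
      show ?thesis
      proof (cases "Z (w @ [z])")
        case True
        then have "orel ((x # w) @ [z])" using Cons.prems False
          by (cases w) (auto simp: orel_def butlast_append)
        then show ?thesis by blast
      next
        case 2: False
        obtain u r where "w @ [z] = u @ r @ [z]" "orel (r @ [z])"
          using Cons.IH[OF w _ 2] Cons.prems False by auto
        then show ?thesis by (intro exI[of _ "x # u"] exI[of _ r]) simp
      qed
    qed (use Cons.prems in auto)
  qed (simp add: Z_nonempty)
  then show ?thesis using that by blast
qed

end

text \<open>The axioms are symmetric under reversal, with right and left uniqueness trading places.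
  Hence the statement about prefixes below comes from the one about suffixes.\<close>

lemma (in zero_words) zero_words_rev: "zero_words (\<lambda>p. Z (rev p)) m"
proof
  show "Z (rev v)" if "Z (rev (u @ v @ w))" "v \<noteq> []" for u v w
    using that Z_factor[of "rev w" "rev v" "rev u"] by simp
qed (use Z_bounded Z_nonempty Z_right_unique Z_left_unique in fastforce)+

context zero_words
begin

lemma orel_prefix:
  assumes "Z w" "s z (hd w)" "\<not> Z (z # w)"
  obtains u r where "z # w = z # r @ u" "orel (z # r)"
proof -
  interpret R: zero_words "\<lambda>p. Z (rev p)" m by (rule zero_words_rev)
  have orel: "R.orel p \<longleftrightarrow> orel (rev p)" for p
    using butlast_rev[of "rev p"] butlast_rev[of p] by (auto simp: R.orel_def orel_def)
  have "w \<noteq> []" using assms(1) Z_nonempty by auto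
  from R.orel_suffix[of "rev w" z] assms this
  obtain u r where "rev w @ [z] = u @ r @ [z]" "R.orel (r @ [z])"
    by (auto simp: last_rev)
  then have "z # w = z # rev r @ rev u" "orel (z # rev r)"
    using orel[of "r @ [z]"] by (auto simp: rev_swap)
  then show ?thesis using that by blast
qed

section \<open>Unique maximal words versus isolated minimal zero words\<close>

definition unique_max :: bool where
  "unique_max \<longleftrightarrow> (\<forall>a. Z [a] \<longrightarrow> (\<exists>!w. max_word w \<and> a \<in> set w))"

text \<open>\<open>C\<close> plays the role of the cyclic orbit through \<open>r\<close>. As
  \<open>s\<close> is a partial injection, the condition on \<open>C\<close> makes it a union of
  orbits without first or last letter; asking for some such \<open>C\<close> avoids naming the
  cycle.\<close>

definition isolated_orels :: bool where
  "isolated_orels \<longleftrightarrow> (\<forall>r. orel r \<longrightarrow>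
     (\<exists>C. (\<forall>x\<in>C. (\<exists>y\<in>C. s x y) \<and> (\<exists>y\<in>C. s y x)) \<and> set r \<subseteq> C \<and>
          (\<forall>r'. orel r' \<and> set r' \<subseteq> C \<longrightarrow> r' = r)))"

text \<open>By determinism the only letter that can follow \<open>x # mid\<close> is
  \<open>y\<close>, and it would make \<open>r\<close> nonzero. So a maximal word containing
  \<open>x # mid\<close> stops there, and dually one containing \<open>mid @ [y]\<close> starts
  there. Both words contain \<open>hd mid\<close>, hence they are the same.\<close>

lemma unique_max_orel_ends:
  assumes unique_max "orel r"
  obtains x mid y w where "r = x # mid @ [y]" "mid \<noteq> []" "max_word w"
    "\<exists>q. w = mid @ [y] @ q" "\<exists>p. w = p @ x # mid"
proof -
  obtain x mid y where r: "r = x # mid @ [y]" and mid: "mid \<noteq> []"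
    using assms(2) by (cases r; cases "tl r" rule: rev_cases) (auto simp: orel_def)
  have Z: "Z (x # mid)" "Z (mid @ [y])" "\<not> Z r" using assms(2) by (auto simp: orel_def r butlast_append)
  obtain p q where w: "max_word (p @ (x # mid) @ q)" using ex_max_word[OF Z(1)] .
  obtain p' q' where w': "max_word (p' @ (mid @ [y]) @ q')" using ex_max_word[OF Z(2)] .
  have sx: "s x (hd mid)" and sy: "s (last mid) y"
    using Z_successively[OF Z(1)] Z_successively[OF Z(2)] mid
    by (auto simp: successively_Cons successively_append_iff)
  have "Z [hd mid]"
    using Z(1) mid by (cases mid) (auto intro: Z_factor'[of "x # mid" "[x]" _ "tl mid"])
  moreover have "hd mid \<in> set (p @ (x # mid) @ q)" "hd mid \<in> set (p' @ (mid @ [y]) @ q')"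
    using mid by auto
  ultimately have eq: "p @ (x # mid) @ q = p' @ (mid @ [y]) @ q'"
    using assms(1) w w' unfolding unique_max_def by blast
  have "q = []"
  proof (cases q)
    case (Cons b q1)
    have "Z (p @ (x # mid) @ q)" using w by (simp add: max_word_def)
    then have Z': "Z (p @ (x # mid @ [b]) @ q1)" using Cons by simp
    have *: "Z (x # mid @ [b])" by (rule Z_factor[OF Z']) simp
    have "s (last mid) b" using Z_successively[OF *] mid
      by (auto simp: successively_Cons successively_append_iff)
    then have "b = y" using sy Z_right_unique by blast
    then show ?thesis using * Z(3) r by simp
  qed
  moreover have "p' = []"
  proof (cases p' rule: rev_cases)
    case (snoc p1 b)
    have "Z (p' @ (mid @ [y]) @ q')" using w' by (simp add: max_word_def)
    then have Z': "Z (p1 @ (b # mid @ [y]) @ q')" using snoc by simp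
    have *: "Z (b # mid @ [y])" by (rule Z_factor[OF Z']) simp
    have "s b (hd mid)" using Z_successively[OF *] mid
      by (auto simp: successively_Cons successively_append_iff)
    then have "b = x" using sx Z_left_unique by blast
    then show ?thesis using * Z(3) r by simp
  qed
  ultimately have w_eq: "mid @ [y] @ q' = p @ x # mid" and w'': "max_word (mid @ [y] @ q')"
    using eq w' by auto
  show ?thesis by (rule that[OF r mid w'']) (simp, subst w_eq, blast)
qed

lemma unique_max_imp_isolated_orels:
  assumes unique_max
  shows isolated_orels
  unfolding isolated_orels_def
proof (intro allI impI)
  fix r assume r: "orel r"
  obtain x mid y w p q where r_eq: "r = x # mid @ [y]" and mid: "mid \<noteq> []" and w: "max_word w"
    "w = mid @ [y] @ q" "w = p @ x # mid"
    using unique_max_orel_ends[OF assms r] by metis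
  have "successively s r" using orel_successively[OF r] .
  then have sx: "s x (hd mid)" and sy: "s (last mid) y" using mid
    by (auto simp: r_eq successively_Cons successively_append_iff)
  have hdw: "hd w = hd mid" "last w = last mid"
    using w(2) mid by (simp, subst w(3), simp)
  have Zw: "Z w" "successively s w" "w \<noteq> []" using w Z_successively by (auto simp: max_word_def)
  \<comment> \<open>This closes the word up to an orbit. Interior letters have their neighbours in
    \<open>w\<close>; the last letter of \<open>w\<close> is \<open>last mid\<close>, which is
    followed by \<open>y\<close> near the start of \<open>w\<close>, and the first is
    \<open>hd mid\<close>, which is preceded by \<open>x\<close> near the end.\<close>
  have *: "(\<exists>y\<in>set w. s x y) \<and> (\<exists>y\<in>set w. s y x)" if "x \<in> set w" for x
  proof
    show "\<exists>y\<in>set w. s x y"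
      using successively_right_total[OF Zw(2,3) that] sy hdw
      by (cases "x = last w") (auto simp: w(2))
    show "\<exists>y\<in>set w. s y x"
      using successively_left_total[OF Zw(2,3) that] sx hdw
      by (cases "x = hd w") (auto simp: w(3))
  qed
  \<comment> \<open>Both \<open>mid1\<close> and \<open>mid2\<close> start \<open>w\<close>, so
    \<open>x1\<close> and \<open>x2\<close> are predecessors of \<open>hd w\<close> and agree. If
    \<open>mid1\<close> is shorter, then \<open>r1\<close> is a prefix of \<open>x2 # mid2\<close>,
    which is nonzero.\<close>
  have len: False if r1: "x1 # mid1 @ [y1] = r1" "orel r1" and r2: "x2 # mid2 @ [y2] = r2" "orel r2"
    and "mid1 \<noteq> []" "w = mid1 @ [y1] @ q1" "mid2 \<noteq> []" "w = mid2 @ [y2] @ q2"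
    and less: "length mid1 < length mid2" for x1 mid1 y1 q1 r1 x2 mid2 y2 q2 r2
  proof -
    have "hd mid1 = hd w" using that(5,6) by simp
    moreover have "hd mid2 = hd w" using that(7,8) by simp
    moreover have "s x1 (hd mid1)" "s x2 (hd mid2)"
      using orel_successively[OF r1(2)] orel_successively[OF r2(2)] that(5,7)
      unfolding r1(1)[symmetric] r2(1)[symmetric] successively_Cons by auto
    ultimately have "s x1 (hd w)" "s x2 (hd w)" by simp_all
    then have [simp]: "x1 = x2" using Z_left_unique by blast
    have "(mid1 @ [y1]) @ q1 = mid2 @ [y2] @ q2" using that by simp
    then obtain t where t: "mid2 = mid1 @ [y1] @ t"
      using less by (auto simp: append_eq_append_conv2 Cons_eq_append_conv)
    have "Z (x2 # mid2)" using r2 by (auto simp: orel_def butlast_append)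
    then have "Z (x1 # mid1 @ [y1])" by (rule Z_factor'[of _ "[]" _ t]) (simp_all add: t)
    then show False using r1 by (auto simp: orel_def)
  qed
  \<comment> \<open>The maximal word belonging to \<open>r'\<close> shares the letter
    \<open>hd mid'\<close> with \<open>w\<close>, hence equals \<open>w\<close>. By
    \<open>len\<close> the middle parts have equal length, so both relations are read off from the
    same two ends of \<open>w\<close>.\<close>
  have "r' = r" if r': "orel r'" "set r' \<subseteq> set w" for r'
  proof -
    obtain x' mid' y' w' p' q' where r'_eq: "r' = x' # mid' @ [y']" and mid': "mid' \<noteq> []"
      and w': "max_word w'" "w' = mid' @ [y'] @ q'" "w' = p' @ x' # mid'"
      using unique_max_orel_ends[OF assms r'(1)] by metis
    have "Z w'" using w'(1) by (simp add: max_word_def)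
    then have "Z [hd mid']" by (rule Z_factor'[of _ "[]" _ "tl w'"]) (use w'(2) mid' in auto)
    moreover have "hd mid' \<in> set w" "hd mid' \<in> set w'"
      using r'(2) mid' w'(2) by (auto simp: r'_eq)
    ultimately have [simp]: "w' = w" using assms w(1) w'(1) unfolding unique_max_def by blast
    have "\<not> length mid < length mid'"
      using len[OF r_eq[symmetric] r r'_eq[symmetric] r'(1) mid w(2) mid' w'(2)[simplified \<open>w' = w\<close>]] by blast
    moreover have "\<not> length mid' < length mid"
      using len[OF r'_eq[symmetric] r'(1) r_eq[symmetric] r mid' w'(2)[simplified \<open>w' = w\<close>] mid w(2)] by blast
    ultimately have "length mid = length mid'" by simp
    then have "mid = mid'" "y = y'" "x = x'" using w(2,3) w'(2,3) by (auto simp: append_eq_append_conv)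
    then show ?thesis by (simp add: r_eq r'_eq)
  qed
  moreover have "set r \<subseteq> set w"
  proof -
    have "set (x # mid) \<subseteq> set w" by (subst w(3)) auto
    moreover have "set (mid @ [y]) \<subseteq> set w" by (subst w(2)) auto
    ultimately show ?thesis by (simp add: r_eq)
  qed
  ultimately show "\<exists>C. (\<forall>x\<in>C. (\<exists>y\<in>C. s x y) \<and> (\<exists>y\<in>C. s y x)) \<and> set r \<subseteq> C \<and>
          (\<forall>r'. orel r' \<and> set r' \<subseteq> C \<longrightarrow> r' = r)"
    using * by (intro exI[of _ "set w"]) blast
qed

text \<open>Uniqueness splits in two. If a minimal zero word shares a letter with one of the two
  words, both lie in its closed set \<open>C\<close> and are compared there. Otherwise a maximal
  word can only stop where \<open>s\<close> itself stops, so it is the whole orbit of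
  \<open>a\<close>.\<close>

lemma isolated_orels_imp_unique_max:
  assumes isolated_orels
  shows unique_max
  unfolding unique_max_def
proof (intro allI impI)
  fix a assume a: "Z [a]"
  have rotate: "w1 = w2"
    if w1: "max_word w1" "a \<in> set w1" and w2: "max_word w2" "a \<in> set w2"
      and r: "orel r" "b \<in> set r" "b \<in> set w1" for w1 w2 r b
  proof -
    obtain C where C: "\<And>x. x \<in> C \<Longrightarrow> \<exists>y\<in>C. s x y" "\<And>x. x \<in> C \<Longrightarrow> \<exists>y\<in>C. s y x"
      "set r \<subseteq> C" "\<And>r'. orel r' \<Longrightarrow> set r' \<subseteq> C \<Longrightarrow> r' = r"
      using assms r(1) unfolding isolated_orels_def by metis
    have succ: "y \<in> C" if "x \<in> C" "s x y" for x y using C(1)[OF that(1)] that(2) Z_right_unique by blast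
    have pred: "x \<in> C" if "y \<in> C" "s x y" for x y using C(2)[OF that(1)] that(2) Z_left_unique by blast
    have sub: "set p \<subseteq> C" if "successively s p" "x \<in> set p" "x \<in> C" for p x
      using successively_set_subset[OF that] succ pred by blast
    have Z12: "Z w1" "Z w2" using w1 w2 by (auto simp: max_word_def)
    have wO: "set w1 \<subseteq> C" using sub[OF Z_successively[OF Z12(1)] r(3)] r C by blast
    moreover have "set w2 \<subseteq> C" using sub[OF Z_successively[OF Z12(2)] w2(2)] w1(2) wO by blast
    \<comment> \<open>\<open>C\<close> supplies a successor \<open>z\<close> of
      \<open>last w\<close>, while \<open>w @ [z]\<close> is zero by maximality. The minimal zero
      word ending it has its letters in \<open>C\<close>, so it is \<open>r\<close>. The front is
      treated dually.\<close>
    moreover have ends: "\<exists>u. w = tl r @ u" "\<exists>u. w = u @ butlast r" if w: "max_word w" "set w \<subseteq> C" for w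
    proof -
      have Zw: "Z w" "\<And>z. \<not> Z (w @ [z])" "\<And>z. \<not> Z (z # w)" "w \<noteq> []"
        using w Z_nonempty by (auto simp: max_word_def)
      obtain z where z: "z \<in> C" "s (last w) z" using C(1)[of "last w"] w Zw by (metis last_in_set subsetD)
      obtain u r' where r': "w @ [z] = u @ r' @ [z]" "orel (r' @ [z])"
        using orel_suffix[OF Zw(1) z(2) Zw(2)] .
      have "set (r' @ [z]) \<subseteq> C" using r'(1) w(2) z by auto
      then have "r' @ [z] = r" using C(4) r' by blast
      then show "\<exists>u. w = u @ butlast r" using r'(1) by (auto simp: butlast_append)
      obtain z where z: "z \<in> C" "s z (hd w)" using C(2)[of "hd w"] w Zw by (metis hd_in_set subsetD)
      obtain u r' where r': "z # w = z # r' @ u" "orel (z # r')"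
        using orel_prefix[OF Zw(1) z(2) Zw(3)] .
      have "set (z # r') \<subseteq> C" using r'(1) w(2) z by auto
      then have "z # r' = r" using C(4) r' by blast
      then show "\<exists>u. w = tl r @ u" using r'(1) by auto
    qed
    \<comment> \<open>Both words start with \<open>tl r\<close>, so the shorter is a prefix of the
      longer. A proper prefix is impossible: \<open>w1\<close> ends with \<open>butlast r\<close>,
      and the next letter of \<open>w2\<close> would have to be \<open>last r\<close>, making
      \<open>r\<close> nonzero.\<close>
    have eq: "w1 = w2" if w: "max_word w1" "set w1 \<subseteq> C" "max_word w2" "set w2 \<subseteq> C"
      and le: "length w1 \<le> length w2" for w1 w2
    proof -
      obtain u1 u2 t where u: "w1 = tl r @ u1" "w2 = tl r @ u2" "w1 = t @ butlast r"
        using ends[OF w(1,2)] ends[OF w(3,4)] by blast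
      have r2: "tl r \<noteq> []" "butlast r \<noteq> []" "r \<noteq> []" using r(1) by (cases r; cases "tl r"; auto simp: orel_def)+
      have hd: "w1 \<noteq> []" "w2 \<noteq> []" "hd w1 = hd w2" using u(1,2) r2 by auto
      have s12: "successively s w1" "successively s w2" using w Z_successively by (auto simp: max_word_def)
      have w2_eq: "w2 = w1 @ drop (length w1) w2"
        by (rule successively_right_unique[OF right_unique_s s12 hd le])
      show ?thesis
      proof (cases "drop (length w1) w2")
        case (Cons b v)
        have w2: "w2 = t @ (butlast r @ [b]) @ v" using w2_eq Cons u(3) by simp
        have "Z (t @ (butlast r @ [b]) @ v)" using w(3) unfolding max_word_def w2[symmetric] by simp
        then have Zb: "Z (butlast r @ [b])" by (rule Z_factor) simp
        have "s (last (butlast r)) b" using Z_successively[OF Zb] r2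
          by (auto simp: successively_append_iff)
        moreover have "s (last (butlast r)) (last r)"
          using orel_successively[OF r(1)] append_butlast_last_id[OF r2(3)] r2(2)
            successively_append_iff[of s "butlast r" "[last r]"] by auto
        ultimately have "b = last r" using Z_right_unique by blast
        then have "Z r" using Zb r2(3) by simp
        then show ?thesis using r(1) by (simp add: orel_def)
      qed (use w2_eq in simp)
    qed
    show ?thesis
      using eq[OF w1(1) _ w2(1)] eq[OF w2(1) _ w1(1)] calculation(1,2) nat_le_linear by metis
  qed
  have uniq: "w1 = w2" if w1: "max_word w1" "a \<in> set w1" and w2: "max_word w2" "a \<in> set w2" for w1 w2
  proof -
    have Zs: "Z w1" "Z w2" using w1 w2 by (auto simp: max_word_def)
    show ?thesis
    proof (cases "\<exists>r b. orel r \<and> b \<in> set r \<and> (b \<in> set w1 \<or> b \<in> set w2)")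
      case True
      then show ?thesis using rotate[OF w1 w2] rotate[OF w2 w1] by blast
    next
      case False
      \<comment> \<open>A successor of the last letter would create a minimal zero word at the end
        of \<open>w\<close>, and all its letters but the last belong to \<open>w\<close>.\<close>
      have nosucc: "\<not> s (last w) z" if "max_word w" "\<forall>r b. orel r \<longrightarrow> b \<in> set r \<longrightarrow> b \<notin> set w" for w z
      proof
        assume s: "s (last w) z"
        have Zw: "Z w" "\<not> Z (w @ [z])" using that(1) by (auto simp: max_word_def)
        obtain u r where r: "w @ [z] = u @ r @ [z]" "orel (r @ [z])"
          using orel_suffix[OF _ s] Zw by blast
        then have "r \<noteq> []" by (auto simp: orel_def)
        then have "last r \<in> set (r @ [z])" "last r \<in> set w" using r(1) by auto
        then show False using that(2) r(2) by blast
      qed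
      have nopred: "\<not> s z (hd w)" if "max_word w" "\<forall>r b. orel r \<longrightarrow> b \<in> set r \<longrightarrow> b \<notin> set w" for w z
      proof
        assume s: "s z (hd w)"
        have Zw: "Z w" "\<not> Z (z # w)" using that(1) by (auto simp: max_word_def)
        obtain u r where r: "z # w = z # r @ u" "orel (z # r)"
          using orel_prefix[OF _ s] Zw by blast
        then have "r \<noteq> []" by (auto simp: orel_def)
        then have "hd r \<in> set (z # r)" "hd r \<in> set w" using r(1) by auto
        then show False using that(2) r(2) by blast
      qed
      obtain p1 q1 p2 q2 where w: "w1 = p1 @ a # q1" "w2 = p2 @ a # q2"
        using w1(2) w2(2) by (metis split_list)
      \<comment> \<open>The relation \<open>t\<close> is kept general: with \<open>s\<close> the
        claim compares the parts after \<open>a\<close>, with the converse of \<open>s\<close> the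
        reversed parts before \<open>a\<close>.\<close>
      have eqr: "q = q'" if "right_unique t" "successively t (a # q)" "successively t (a # q')"
        "\<And>z. \<not> t (last (a # q)) z" "\<And>z. \<not> t (last (a # q')) z" for q q' and t :: "'a \<Rightarrow> 'a \<Rightarrow> bool"
      proof -
        have *: "q1 = q2" if st: "successively t (a # q1)" "successively t (a # q2)" "length q1 \<le> length q2"
          "\<And>z. \<not> t (last (a # q1)) z" for q1 q2
        proof -
          have e: "a # q2 = (a # q1) @ drop (length (a # q1)) (a # q2)"
            by (rule successively_right_unique[OF \<open>right_unique t\<close>]) (use st in auto)
          have "successively t ((a # q1) @ drop (length (a # q1)) (a # q2))" using st(2) e by simp
          then have "drop (length (a # q1)) (a # q2) = []"
            using st(4) unfolding successively_append_iff by auto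
          then show ?thesis using e by simp
        qed
        show ?thesis using *[OF that(2,3) _ that(4)] *[OF that(3,2) _ that(5)] nat_le_linear by metis
      qed
      have sw: "successively s w1" "successively s w2" using Zs Z_successively by auto
      have "q1 = q2"
        using eqr[OF right_unique_s, of q1 q2] sw nosucc[OF w1(1)] nosucc[OF w2(1)] False
        by (auto simp: w successively_append_iff)
      moreover have "rev p1 = rev p2"
      proof (rule eqr[OF right_unique_s_conv])
        show "successively (\<lambda>x y. s y x) (a # rev p1)" "successively (\<lambda>x y. s y x) (a # rev p2)"
          using sw successively_rev[of "\<lambda>x y. s y x" "p1 @ [a]"]
            successively_rev[of "\<lambda>x y. s y x" "p2 @ [a]"]
          by (simp_all add: w successively_append_iff)
        show "\<not> s z (last (a # rev p1))" for z
          using nopred[OF w1(1), of z] False by (cases p1) (auto simp: w)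
        show "\<not> s z (last (a # rev p2))" for z
          using nopred[OF w2(1), of z] False by (cases p2) (auto simp: w)
      qed
      ultimately show ?thesis by (simp add: w)
    qed
  qed
  obtain u v where "max_word (u @ [a] @ v)" using ex_max_word[OF a] .
  then show "\<exists>!w. max_word w \<and> a \<in> set w" using uniq by (intro ex1I[of _ "u @ [a] @ v"]) auto
qed

theorem unique_max_iff: "unique_max \<longleftrightarrow> isolated_orels"
  using unique_max_imp_isolated_orels isolated_orels_imp_unique_max by blast

end

section \<open>Weakly connected components\<close>

text \<open>Induction along a walk in the symmetrised graph. Connectedness of the quiver and of
  components is exploited below by exhibiting such a closed set \<open>S\<close>.\<close>

lemma connected_arc_closed:
  assumes "Digraph_Component.connected G" "x \<in> S" "x \<in> verts G"
    and closed: "\<And>e. e \<in> arcs G \<Longrightarrow> tail G e \<in> S \<longleftrightarrow> head G e \<in> S"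
  shows "verts G \<subseteq> S"
proof
  fix y assume "y \<in> verts G"
  then have "(x, y) \<in> rtrancl_on (verts G) ((arcs_ends G)\<^sup>s)"
    using assms(1,3) by (simp add: connected_conv)
  then show "y \<in> S"
    by (induction rule: rtrancl_on_induct) (use assms(2) closed in \<open>auto simp: symcl_def arcs_ends_conv\<close>)
qed

text \<open>An explicit model for the components, which are defined only by maximality. The two
  lemmas on \<open>max_subgraph\<close> at the end of the context identify the notions.\<close>

definition weak_component :: "('a, 'b) pre_digraph \<Rightarrow> 'a \<Rightarrow> ('a, 'b) pre_digraph" where
  "weak_component G x = G \<restriction> {y. (x, y) \<in> rtrancl_on (verts G) ((arcs_ends G)\<^sup>s)}"

lemma tail_head_weak_component [simp]:
  "tail (weak_component G x) = tail G" "head (weak_component G x) = head G"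
  by (auto simp: weak_component_def)

context wf_digraph
begin

lemma weak_component_subset: "verts (weak_component G x) \<subseteq> verts G"
  by (auto simp: weak_component_def elim: rtrancl_on.cases)

lemma in_verts_weak_component: "x \<in> verts G \<Longrightarrow> x \<in> verts (weak_component G x)"
  by (simp add: weak_component_def)

lemma weak_component_closed:
  assumes "e \<in> arcs G"
  shows "tail G e \<in> verts (weak_component G x) \<longleftrightarrow> head G e \<in> verts (weak_component G x)"
proof -
  have *: "z \<in> verts (weak_component G x)"
    if "y \<in> verts (weak_component G x)" "(y, z) \<in> (arcs_ends G)\<^sup>s" "z \<in> verts G" for y z
    using that by (auto simp: weak_component_def intro: rtrancl_on_into_rtrancl_on)
  have "(tail G e, head G e) \<in> (arcs_ends G)\<^sup>s" "(head G e, tail G e) \<in> (arcs_ends G)\<^sup>s"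
    using assms by (auto simp: symcl_def arcs_ends_conv)
  then show ?thesis using * assms tail_in_verts head_in_verts by blast
qed

lemma arcs_weak_component:
  "arcs (weak_component G x) = {e \<in> arcs G. tail G e \<in> verts (weak_component G x)}"
  using weak_component_closed[of _ x] by (auto simp: weak_component_def)

lemma subgraph_weak_component: "subgraph (weak_component G x) G"
  using weak_component_subset[of x] unfolding weak_component_def
  by (intro induced_imp_subgraph induced_induce) simp

lemma connected_subgraph_weak_component:
  assumes "subgraph H G" "Digraph_Component.connected H" "x \<in> verts H"
    "x \<in> verts (weak_component G y)"
  shows "subgraph H (weak_component G y)"
proof -
  have [simp]: "tail H = tail G" "head H = head G"
    using assms(1) by (auto simp: subgraph_def compatible_def)
  have sub: "arcs H \<subseteq> arcs G" using assms(1) by (auto simp: subgraph_def)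
  interpret H: wf_digraph H using assms(1) by (auto simp: subgraph_def)
  have "verts H \<subseteq> verts (weak_component G y)"
    by (rule connected_arc_closed[OF assms(2,4,3)]) (use sub weak_component_closed in auto)
  moreover from this have "arcs H \<subseteq> arcs (weak_component G y)"
    using sub H.tail_in_verts by (auto simp: arcs_weak_component)
  ultimately show ?thesis using assms(1) subgraph_weak_component
    by (auto simp: subgraph_def compatible_def)
qed

text \<open>The component is defined by walks in \<open>G\<close>, but its own connectedness
  concerns walks inside it. Closure under arcs in both directions keeps a walk starting at
  \<open>x\<close> inside.\<close>

lemma connected_weak_component:
  assumes "x \<in> verts G"
  shows "Digraph_Component.connected (weak_component G x)"
proof -
  let ?N = "weak_component G x"
  interpret N: wf_digraph ?N using subgraph_weak_component by (auto simp: subgraph_def)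
  let ?R = "\<lambda>u. {v. (u, v) \<in> rtrancl_on (verts ?N) ((arcs_ends ?N)\<^sup>s)}"
  have closed: "tail ?N e \<in> ?R u \<longleftrightarrow> head ?N e \<in> ?R u" if "e \<in> arcs ?N" for e u
  proof -
    have "(tail ?N e, head ?N e) \<in> (arcs_ends ?N)\<^sup>s" "(head ?N e, tail ?N e) \<in> (arcs_ends ?N)\<^sup>s"
      using that by (auto simp: symcl_def arcs_ends_conv simp del: tail_head_weak_component)
    then show ?thesis using N.tail_in_verts[OF that] N.head_in_verts[OF that]
      by (auto intro: rtrancl_on_into_rtrancl_on)
  qed
  have x: "x \<in> verts ?N" by (rule in_verts_weak_component[OF assms])
  have all: "verts ?N \<subseteq> ?R x"
  proof
    fix v assume "v \<in> verts ?N"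
    then have "(x, v) \<in> rtrancl_on (verts G) ((arcs_ends G)\<^sup>s)" by (simp add: weak_component_def)
    then show "v \<in> ?R x"
    proof (induction rule: rtrancl_on_induct)
      case (step y z)
      have y: "y \<in> verts ?N" using step.IH by (auto elim: rtrancl_on.cases)
      obtain e where e: "e \<in> arcs G" "(y, z) = (tail G e, head G e) \<or> (y, z) = (head G e, tail G e)"
        using step.hyps(2) by (auto simp: symcl_def arcs_ends_conv)
      then have "e \<in> arcs ?N" using y weak_component_closed by (auto simp: arcs_weak_component)
      then show ?case using closed[of e x] e step.IH by auto
    qed (use x in simp)
  qed
  have "v \<in> ?R u" if "u \<in> verts ?N" "v \<in> verts ?N" for u v
  proof -
    \<comment> \<open>Symmetry of reachability without reversing walks: the complement of
      \<open>?R u\<close> is closed under arcs too, so if it contained \<open>x\<close> it would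
      contain everything reachable from \<open>x\<close>, including \<open>u\<close>.\<close>
    have "x \<in> ?R u"
    proof (rule ccontr)
      assume "x \<notin> ?R u"
      have "?R x \<subseteq> - ?R u"
      proof
        fix w assume "w \<in> ?R x"
        then have "(x, w) \<in> rtrancl_on (verts ?N) ((arcs_ends ?N)\<^sup>s)" by simp
        then show "w \<in> - ?R u"
        proof (induction rule: rtrancl_on_induct)
          case (step y z)
          obtain e where "e \<in> arcs ?N" "(y, z) = (tail ?N e, head ?N e) \<or> (y, z) = (head ?N e, tail ?N e)"
            using step.hyps(2) by (auto simp: symcl_def arcs_ends_conv)
          then show ?case using closed[of e u] step.IH by auto
        qed (use \<open>x \<notin> ?R u\<close> in simp)
      qed
      moreover have "u \<in> ?R u" using that by simp
      ultimately show False using all that by blast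
    qed
    then show ?thesis using all that by (auto intro: rtrancl_on_trans)
  qed
  then show ?thesis using x by (auto simp: connected_conv)
qed

lemma max_subgraph_weak_component:
  assumes "x \<in> verts G"
  shows "max_subgraph Digraph_Component.connected (weak_component G x)"
proof -
  have "H = weak_component G x"
    if "subgraph (weak_component G x) H" "subgraph H G" "Digraph_Component.connected H" for H
  proof -
    have "x \<in> verts H" using that(1) in_verts_weak_component[OF assms] by (auto simp: subgraph_def)
    then have "subgraph H (weak_component G x)"
      using connected_subgraph_weak_component[OF that(2,3)] in_verts_weak_component[OF assms] by blast
    with that(1) show ?thesis by (auto simp: subgraph_def compatible_def)
  qed
  then show ?thesis
    using subgraph_weak_component connected_weak_component[OF assms] by (auto simp: max_subgraph_def)
qed

lemma max_subgraph_eq_weak_component: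
  assumes "max_subgraph Digraph_Component.connected N" "x \<in> verts N"
  shows "N = weak_component G x"
proof -
  have N: "subgraph N G" "Digraph_Component.connected N" using assms by (auto simp: max_subgraph_def)
  then have x: "x \<in> verts G" using assms(2) by (auto simp: subgraph_def)
  show ?thesis
    using connected_subgraph_weak_component[OF N assms(2) in_verts_weak_component[OF x]]
      subgraph_weak_component connected_weak_component[OF x] assms(1)
    unfolding max_subgraph_def by metis
qed

end

text \<open>A longest repetition-free chain \<open>ws\<close> cannot be prolonged at its ends, and
  inside it the neighbours are forced. So it is closed under edges and exhausts \<open>N\<close> by
  connectedness. The two alternatives are whether its last vertex has an outgoing edge.\<close>

lemma chain_or_cycle:
  fixes N :: "('v, 'a) ram_graph"
  assumes "wf_digraph N" "Digraph_Component.connected N" "finite (verts N)"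
    and fs: "tail N = fst" "head N = snd"
    and right: "\<And>x y z. (x, y) \<in> arcs N \<Longrightarrow> (x, z) \<in> arcs N \<Longrightarrow> y = z"
    and left: "\<And>x y z. (y, x) \<in> arcs N \<Longrightarrow> (z, x) \<in> arcs N \<Longrightarrow> y = z"
  shows "\<exists>ws. component_chain N ws \<or> component_cycle N ws"
proof -
  interpret wf_digraph N by fact
  let ?E = "\<lambda>x y. (x, y) \<in> arcs N"
  let ?P = "\<lambda>ws. ws \<noteq> [] \<and> distinct ws \<and> set ws \<subseteq> verts N \<and> successively ?E ws"
  obtain x where "x \<in> verts N" using assms(2) by (auto simp: connected_conv)
  then have P: "?P [x]" by simp
  have "length ws \<le> card (verts N)" if "?P ws" for ws
    using card_mono[OF assms(3), of "set ws"] distinct_card[of ws] that by simp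
  then have "\<exists>ws. ?P ws \<and> (\<forall>ws'. ?P ws' \<longrightarrow> length ws' \<le> length ws)"
    by (intro ex_has_greatest_nat[of ?P "[x]" length "Suc (card (verts N))", OF P])
       (simp add: less_Suc_eq_le)
  then obtain ws where ws: "?P ws" and max: "\<And>ws'. ?P ws' \<Longrightarrow> length ws' \<le> length ws"
    by metis
  have V: "x \<in> verts N" "y \<in> verts N" if "?E x y" for x y
    using that tail_in_verts[of "(x, y)"] head_in_verts[of "(x, y)"] fs by auto
  have succ: "y \<in> set ws" if "x \<in> set ws" "?E x y" for x y
  proof (cases "x = last ws")
    case True
    show ?thesis
    proof (rule ccontr)
      assume "y \<notin> set ws"
      then have "?P (ws @ [y])" using ws that V[OF that(2)] True by (auto simp: successively_append_iff)
      from max[OF this] show False by simp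
    qed
  next
    case False
    then show ?thesis using successively_right_total[of ?E ws x] ws that right by blast
  qed
  have pred: "x \<in> set ws" if "y \<in> set ws" "?E x y" for x y
  proof (cases "y = hd ws")
    case True
    show ?thesis
    proof (rule ccontr)
      assume "x \<notin> set ws"
      then have "?P (x # ws)" using ws that V[OF that(2)] True by (auto simp: successively_Cons)
      from max[OF this] show False by simp
    qed
  next
    case False
    then show ?thesis using successively_left_total[of ?E ws y] ws that left by blast
  qed
  have hd: "hd ws \<in> set ws" "hd ws \<in> verts N" using ws by auto
  have "verts N \<subseteq> set ws"
  proof (rule connected_arc_closed[OF assms(2) hd])
    fix e assume "e \<in> arcs N"
    then show "tail N e \<in> set ws \<longleftrightarrow> head N e \<in> set ws"
      using succ[of "fst e" "snd e"] pred[of "snd e" "fst e"] by (auto simp: fs)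
  qed
  then have verts: "verts N = set ws" using ws by auto
  have nth: "?E (ws ! i) (ws ! Suc i)" if "Suc i < length ws" for i
    using ws that by (auto simp: successively_conv_nth)
  show ?thesis
  proof (cases "\<exists>z. ?E (last ws) z")
    case True
    then obtain z where z: "?E (last ws) z" by blast
    then have "z \<in> set ws" using succ[of "last ws" z] ws by simp
    then obtain u v where uv: "ws = u @ z # v" by (auto dest: split_list)
    \<comment> \<open>If the target \<open>z\<close> were not the first vertex, its predecessor in
      \<open>ws\<close> would equal \<open>last ws\<close> by left uniqueness, and that vertex would
      occur twice.\<close>
    have "u = []"
    proof (cases u rule: rev_cases)
      case (snoc u' p)
      then have "?E p z" using ws by (auto simp: uv successively_append_iff)
      then have "p = last ws" using z left by blast
      then show ?thesis using ws by (auto simp: uv snoc split: if_splits)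
    qed
    then have z0: "?E (ws ! (length ws - 1)) (ws ! 0)"
      using z ws uv last_conv_nth[of ws] by simp
    have nth': "?E (ws ! i) (ws ! (Suc i mod length ws))" if "i < length ws" for i
    proof (cases "Suc i < length ws")
      case False
      then have "Suc i = length ws" using that by simp
      moreover from this have "i = length ws - 1" by simp
      ultimately show ?thesis using z0 by simp
    qed (use nth in simp)
    have "arcs N = {(ws ! i, ws ! (Suc i mod length ws)) |i. i < length ws}"
    proof (intro equalityI subsetI)
      fix e assume e: "e \<in> arcs N"
      obtain x y where [simp]: "e = (x, y)" by (cases e)
      have "x \<in> set ws" using V[of x y] e verts by auto
      then obtain i where i: "i < length ws" "x = ws ! i" by (auto simp: in_set_conv_nth)
      then have "y = ws ! (Suc i mod length ws)" using nth'[OF i(1)] e right by auto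
      then show "e \<in> {(ws ! i, ws ! (Suc i mod length ws)) |i. i < length ws}" using i by auto
    qed (use nth' in auto)
    then show ?thesis using ws verts by (auto simp: component_cycle_def)
  next
    case False
    have "arcs N = {(ws ! i, ws ! Suc i) |i. Suc i < length ws}"
    proof (intro equalityI subsetI)
      fix e assume e: "e \<in> arcs N"
      obtain x y where [simp]: "e = (x, y)" by (cases e)
      have "x \<in> set ws" using V[of x y] e verts by auto
      then obtain i where i: "i < length ws" "x = ws ! i" by (auto simp: in_set_conv_nth)
      have "Suc i < length ws"
      proof (rule ccontr)
        assume "\<not> Suc i < length ws"
        then have "i = length ws - 1" using i by simp
        then have "x = last ws" using i ws by (simp add: last_conv_nth)
        then show False using False e \<open>e = (x, y)\<close> by blast
      qed
      then have "y = ws ! Suc i" using nth[of i] e i right by auto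
      then show "e \<in> {(ws ! i, ws ! Suc i) |i. Suc i < length ws}" using i \<open>Suc i < length ws\<close> by auto
    qed (use nth in auto)
    then show ?thesis using ws verts by (auto simp: component_chain_def)
  qed
qed

section \<open>Paths as words\<close>

text \<open>The source of a nontrivial path is determined by its first arrow, so such paths can be
  handled as lists. For the empty list the source is an unspecified value, and trivial paths are
  therefore treated apart.\<close>

definition word :: "('v, 'a) pre_digraph \<Rightarrow> 'a list \<Rightarrow> ('v, 'a) qpath" where
  "word Q p = (tail Q (hd p), p)"

definition path_word :: "('v, 'a) pre_digraph \<Rightarrow> 'a list \<Rightarrow> bool" where
  "path_word Q p \<longleftrightarrow> p \<noteq> [] \<and> set p \<subseteq> arcs Q \<and> successively (\<lambda>x y. head Q x = tail Q y) p"

lemma arrows_word [simp]: "arrows (word Q p) = p"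
  by (simp add: word_def)

lemma qsrc_word [simp]: "qsrc (word Q p) = tail Q (hd p)"
  by (simp add: word_def)

lemma word_inject [simp]: "word Q p = word Q q \<longleftrightarrow> p = q"
  by (auto simp: word_def)

lemma arrow_path_eq_word: "arrow_path Q a = word Q [a]"
  by (simp add: arrow_path_def word_def)

lemma qtgt_word: "p \<noteq> [] \<Longrightarrow> qtgt Q (word Q p) = head Q (last p)"
  by (simp add: qtgt_simps)

lemma qcomp_word: "p \<noteq> [] \<Longrightarrow> qcomp (word Q p) (word Q q) = word Q (p @ q)"
  by (simp add: qcomp_def word_def)

lemma path_word_factor: "path_word Q (u @ v @ w) \<Longrightarrow> v \<noteq> [] \<Longrightarrow> path_word Q v"
  by (auto simp: path_word_def successively_append_iff)

lemma path_word_append_iff: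
  "p \<noteq> [] \<Longrightarrow> q \<noteq> [] \<Longrightarrow>
     path_word Q (p @ q) \<longleftrightarrow> path_word Q p \<and> path_word Q q \<and> head Q (last p) = tail Q (hd q)"
  by (auto simp: path_word_def successively_append_iff)

lemma path_word_singleton [simp]: "path_word Q [a] \<longleftrightarrow> a \<in> arcs Q"
  by (simp add: path_word_def)

lemma cas_iff:
  "pre_digraph.cas Q u p v \<longleftrightarrow>
     (if p = [] then u = v
      else u = tail Q (hd p) \<and> successively (\<lambda>x y. head Q x = tail Q y) p \<and> v = head Q (last p))"
  by (induction p arbitrary: u) (auto simp: pre_digraph.cas.simps successively_Cons)

lemma qpaths_cases:
  assumes "w \<in> qpaths Q"
  obtains (trivial) v where "v \<in> verts Q" "w = (v, [])" | (word) p where "path_word Q p" "w = word Q p"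
  using assms
  by (cases "arrows w = []"; cases w)
     (auto simp: qpaths_def pre_digraph.awalk_def cas_iff path_word_def word_def)

lemma length_qcomp: "length (arrows (qcomp u w)) = length (arrows u) + length (arrows w)"
  by (simp add: qcomp_def)

lemma qcomp_trivial_left [simp]: "qcomp (qsrc w, []) w = w"
  by (simp add: qcomp_def)

lemma qcomp_trivial_right [simp]: "qcomp w (v, []) = w"
  by (simp add: qcomp_def)

lemma qtgt_trivial [simp]: "qtgt Q (v, []) = v"
  by (simp add: qtgt_simps)

context wf_digraph
begin

lemma path_word_verts:
  assumes "path_word G p"
  shows "tail G (hd p) \<in> verts G" "head G (last p) \<in> verts G"
proof -
  have "hd p \<in> arcs G" "last p \<in> arcs G" using assms by (auto simp: path_word_def)
  then show "tail G (hd p) \<in> verts G" "head G (last p) \<in> verts G" by auto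
qed

lemma subpathI:
  assumes "u \<in> qpaths G" "x \<in> qpaths G" "y \<in> qpaths G" "qtgt G x = qsrc u" "qtgt G u = qsrc y"
    "w = qcomp x (qcomp u y)"
  shows "subpath G u w"
  using assms unfolding subpath_def by blast

lemma word_in_qpaths_iff: "p \<noteq> [] \<Longrightarrow> word G p \<in> qpaths G \<longleftrightarrow> path_word G p"
  using path_word_verts[of p]
  by (auto simp: qpaths_def pre_digraph.awalk_def cas_iff path_word_def word_def qtgt_simps)

lemma word_in_qpaths: "path_word G p \<Longrightarrow> word G p \<in> qpaths G"
  using word_in_qpaths_iff by (auto simp: path_word_def)

lemma subpath_refl: "w \<in> qpaths G \<Longrightarrow> subpath G w w"
  using qpaths_verts[OF wf_digraph_axioms, of w]
  by (intro subpathI[of w "(qsrc w, [])" "(qtgt G w, [])"] trivial_in_qpaths) simp_all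

lemma subpath_trans:
  assumes "subpath G u v" "subpath G v w"
  shows "subpath G u w"
proof -
  obtain x y where xy: "x \<in> qpaths G" "y \<in> qpaths G" "qtgt G x = qsrc u" "qtgt G u = qsrc y"
    "v = qcomp x (qcomp u y)" using assms(1) by (auto simp: subpath_def)
  obtain x' y' where xy': "x' \<in> qpaths G" "y' \<in> qpaths G" "qtgt G x' = qsrc v" "qtgt G v = qsrc y'"
    "w = qcomp x' (qcomp v y')" using assms(2) by (auto simp: subpath_def)
  have u: "u \<in> qpaths G" using assms(1) by (auto simp: subpath_def)
  have tgt: "qtgt G v = qtgt G y" using xy by (simp add: qtgt_qcomp)
  have "qcomp x' x \<in> qpaths G" "qcomp y y' \<in> qpaths G"
    using xy xy' tgt by (auto intro!: qcomp_in_qpaths)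
  moreover have "qtgt G (qcomp x' x) = qsrc u" using xy xy' by (simp add: qtgt_qcomp)
  moreover have "w = qcomp (qcomp x' x) (qcomp u (qcomp y y'))"
    using xy xy' by (simp add: qcomp_assoc)
  ultimately show ?thesis using u xy(4) xy'(3-4)
    by (intro subpathI[of u "qcomp x' x" "qcomp y y'"]) simp_all
qed

lemma subpath_length:
  assumes "subpath G u w"
  shows "length (arrows u) \<le> length (arrows w)" "length (arrows u) = length (arrows w) \<Longrightarrow> u = w"
proof -
  obtain x y where xy: "qtgt G x = qsrc u" "qtgt G u = qsrc y" "w = qcomp x (qcomp u y)"
    using assms by (auto simp: subpath_def)
  then show "length (arrows u) \<le> length (arrows w)" by (simp add: length_qcomp)
  assume "length (arrows u) = length (arrows w)"
  then have "arrows x = []" "arrows y = []" using xy by (auto simp: length_qcomp)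
  then show "u = w" using xy by (cases u; cases x) (auto simp: qcomp_def qtgt_simps)
qed

lemma subpath_word_iff:
  assumes "path_word G q" "p \<noteq> []"
  shows "subpath G (word G p) (word G q) \<longleftrightarrow> (\<exists>x y. q = x @ p @ y)"
proof
  assume "subpath G (word G p) (word G q)"
  then show "\<exists>x y. q = x @ p @ y" by (auto simp: subpath_def word_def qcomp_def)
next
  assume "\<exists>x y. q = x @ p @ y"
  then obtain x y where q: "q = x @ p @ y" by blast
  have p: "path_word G p" using path_word_factor[of G x p y] assms q by simp
  then have p_verts: "tail G (hd p) \<in> verts G" "head G (last p) \<in> verts G"
    using path_word_verts by auto
  \<comment> \<open>An empty flank has to be the trivial path at the matching end of
    \<open>p\<close>; \<open>word G []\<close> would have the wrong source.\<close>
  define x' where "x' = (if x = [] then (tail G (hd p), []) else word G x)"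
  define y' where "y' = (if y = [] then (head G (last p), []) else word G y)"
  have xy: "path_word G x" if "x \<noteq> []" using path_word_factor[of G "[]" x "p @ y"] assms q that by simp
  have yx: "path_word G y" if "y \<noteq> []" using path_word_factor[of G "x @ p" y "[]"] assms q that by simp
  have "x' \<in> qpaths G" "y' \<in> qpaths G"
    using xy yx p_verts by (auto simp: x'_def y'_def trivial_in_qpaths intro: word_in_qpaths)
  moreover have "qtgt G x' = tail G (hd p)" "head G (last p) = qsrc y'"
    using assms unfolding q by (auto simp: x'_def y'_def path_word_def
        successively_append_iff word_def qtgt_simps)
  moreover have "word G q = qcomp x' (qcomp (word G p) y')"
    using assms(2) q by (auto simp: x'_def y'_def word_def qcomp_def)
  ultimately show "subpath G (word G p) (word G q)"
    using word_in_qpaths[OF p] qtgt_word[OF assms(2), of G]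
    by (intro subpathI[of _ x' y']) simp_all
qed

lemma subpath_wordD:
  assumes "subpath G u w" "arrows u \<noteq> []"
  obtains p where "u = word G p" "path_word G p"
  using assms by (auto simp: subpath_def elim: qpaths_cases)

end

section \<open>Ideals of the path algebra\<close>

lemma path_algebra_simps [simp]:
  "carrier (path_algebra Q) = {x. Poly_Mapping.keys x \<subseteq> qpaths Q}"
  "mult (path_algebra Q) = path_mult Q"
  "add (path_algebra Q) = (+)"
  "zero (path_algebra Q) = 0"
  by (auto simp: path_algebra_def)

lemma keys_path_mult:
  "Poly_Mapping.keys (path_mult Q x y) \<subseteq>
     {qcomp u w | u w. u \<in> Poly_Mapping.keys x \<and> w \<in> Poly_Mapping.keys y \<and> qtgt Q u = qsrc w}"
proof -
  have "Poly_Mapping.keys (path_mult Q x y) \<subseteq>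
    (\<Union>u\<in>Poly_Mapping.keys x. \<Union>w\<in>Poly_Mapping.keys y. Poly_Mapping.keys
       (if qtgt Q u = qsrc w
        then Poly_Mapping.single (qcomp u w) (Poly_Mapping.lookup x u * Poly_Mapping.lookup y w)
        else 0))"
    unfolding path_mult_def by (intro order_trans[OF keys_sum] UN_mono order_refl)
  moreover have "z = qcomp u w \<and> qtgt Q u = qsrc w"
    if "z \<in> Poly_Mapping.keys (if qtgt Q u = qsrc w then Poly_Mapping.single (qcomp u w) b else 0)"
    for z u w and b :: 'c
    using that by (auto split: if_splits)
  ultimately show ?thesis by blast
qed

text \<open>For a monomial ideal this is its least generating set of paths, and so it will turn out
  to be \<open>R_N\<close>.\<close>

definition minimal_paths ::
  "('v, 'a) pre_digraph \<Rightarrow> (('v, 'a) qpath \<Rightarrow>\<^sub>0 'k::field) set \<Rightarrow> ('v, 'a) qpath set" where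
  "minimal_paths Q J = {w \<in> qpaths Q. path_elem w \<in> J \<and>
     (\<forall>u. subpath Q u w \<and> path_elem u \<in> J \<longrightarrow> u = w)}"

context fin_digraph
begin

lemma ring_path_algebra: "ring (path_algebra G)"
  by (rule path_algebra_ring) (rule fin_digraph_axioms)

lemma path_algebra_inv:
  fixes x :: "_ \<Rightarrow>\<^sub>0 'k::field"
  assumes "x \<in> carrier (path_algebra G)"
  shows "inv\<^bsub>add_monoid (path_algebra G)\<^esub> x = - x"
proof -
  interpret ring "path_algebra G :: (_ \<Rightarrow>\<^sub>0 'k) ring" by (rule ring_path_algebra)
  show ?thesis by (rule group.inv_equality[OF a_group]) (use assms in auto)
qed

text \<open>Upper bounds for generated ideals are obtained as spans of sets of paths; for such spans
  the ideal axioms reduce to closure of the set under composition on both sides.\<close>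

lemma ideal_keys:
  assumes U: "U \<subseteq> qpaths G"
    and right: "\<And>u x. u \<in> U \<Longrightarrow> x \<in> qpaths G \<Longrightarrow> qtgt G u = qsrc x \<Longrightarrow> qcomp u x \<in> U"
    and left: "\<And>u x. u \<in> U \<Longrightarrow> x \<in> qpaths G \<Longrightarrow> qtgt G x = qsrc u \<Longrightarrow> qcomp x u \<in> U"
  shows "ideal {x :: _ \<Rightarrow>\<^sub>0 'k::field. Poly_Mapping.keys x \<subseteq> U} (path_algebra G)"
proof (rule idealI[OF ring_path_algebra])
  interpret ring "path_algebra G :: (_ \<Rightarrow>\<^sub>0 'k) ring" by (rule ring_path_algebra)
  show "subgroup {x :: _ \<Rightarrow>\<^sub>0 'k. Poly_Mapping.keys x \<subseteq> U} (add_monoid (path_algebra G))"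
  proof
    fix x :: "_ \<Rightarrow>\<^sub>0 'k" assume x: "x \<in> {x. Poly_Mapping.keys x \<subseteq> U}"
    then have "inv\<^bsub>add_monoid (path_algebra G)\<^esub> x = - x" using U by (intro path_algebra_inv) auto
    then show "inv\<^bsub>add_monoid (path_algebra G)\<^esub> x \<in> {x. Poly_Mapping.keys x \<subseteq> U}"
      using x by auto
  next
    fix x y :: "_ \<Rightarrow>\<^sub>0 'k"
    assume "x \<in> {x. Poly_Mapping.keys x \<subseteq> U}" "y \<in> {x. Poly_Mapping.keys x \<subseteq> U}"
    then show "x \<otimes>\<^bsub>add_monoid (path_algebra G)\<^esub> y \<in> {x. Poly_Mapping.keys x \<subseteq> U}"
      using keys_add[of x y] by (simp, blast)
  qed (use U in auto)
next
  fix a x :: "_ \<Rightarrow>\<^sub>0 'k"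
  assume a: "a \<in> {x. Poly_Mapping.keys x \<subseteq> U}" and x: "x \<in> carrier (path_algebra G)"
  show "x \<otimes>\<^bsub>path_algebra G\<^esub> a \<in> {x. Poly_Mapping.keys x \<subseteq> U}"
  proof safe
    fix z assume "z \<in> Poly_Mapping.keys (x \<otimes>\<^bsub>path_algebra G\<^esub> a)"
    then obtain u w where "z = qcomp u w" "u \<in> Poly_Mapping.keys x" "w \<in> Poly_Mapping.keys a"
      "qtgt G u = qsrc w" using keys_path_mult[of G x a] by auto
    then show "z \<in> U" using left[of w u] a x by auto
  qed
  show "a \<otimes>\<^bsub>path_algebra G\<^esub> x \<in> {x. Poly_Mapping.keys x \<subseteq> U}"
  proof safe
    fix z assume "z \<in> Poly_Mapping.keys (a \<otimes>\<^bsub>path_algebra G\<^esub> x)"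
    then obtain u w where "z = qcomp u w" "u \<in> Poly_Mapping.keys a" "w \<in> Poly_Mapping.keys x"
      "qtgt G u = qsrc w" using keys_path_mult[of G a x] by auto
    then show "z \<in> U" using right[of u w] a x by auto
  qed
qed

end

locale path_ideal = fin_digraph G for G :: "('v, 'a) pre_digraph" +
  fixes J :: "(('v, 'a) qpath \<Rightarrow>\<^sub>0 'k::field) set"
  assumes ideal_J: "ideal J (path_algebra G)"
begin

interpretation ideal J "path_algebra G" by (rule ideal_J)

lemma zero_in: "0 \<in> J"
  using additive_subgroup.zero_closed[OF ideal.axioms(1)[OF ideal_J]] by simp

lemma keys_in: "x \<in> J \<Longrightarrow> Poly_Mapping.keys x \<subseteq> qpaths G"
  using a_subset by auto

lemma add_in: "x \<in> J \<Longrightarrow> y \<in> J \<Longrightarrow> x + y \<in> J"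
  using additive_subgroup.a_closed[OF ideal.axioms(1)[OF ideal_J], of x y] by simp

lemma uminus_in: "x \<in> J \<Longrightarrow> - x \<in> J"
  using path_algebra_inv[of x] keys_in[of x]
    subgroup.m_inv_closed[OF additive_subgroup.a_subgroup[OF ideal.axioms(1)[OF ideal_J]], of x]
  by simp

lemma diff_in: "x \<in> J \<Longrightarrow> y \<in> J \<Longrightarrow> x - y \<in> J"
  using add_in[of x "- y"] uminus_in[of y] by simp

lemma mult_left_in: "x \<in> J \<Longrightarrow> Poly_Mapping.keys y \<subseteq> qpaths G \<Longrightarrow> path_mult G y x \<in> J"
  using I_l_closed[of x y] by simp

lemma mult_right_in: "x \<in> J \<Longrightarrow> Poly_Mapping.keys y \<subseteq> qpaths G \<Longrightarrow> path_mult G x y \<in> J"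
  using I_r_closed[of x y] by simp

lemma sum_in: "(\<And>i. i \<in> A \<Longrightarrow> f i \<in> J) \<Longrightarrow> sum f A \<in> J"
  by (induction A rule: infinite_finite_induct) (auto simp: zero_in add_in)

lemma single_in:
  assumes "path_elem w \<in> J"
  shows "Poly_Mapping.single w b \<in> J"
proof -
  have "w \<in> qpaths G" using keys_in[OF assms] by simp
  then have "(qsrc w, []) \<in> qpaths G"
    using qpaths_verts[OF wf_digraph_axioms, of w] by (simp add: trivial_in_qpaths)
  \<comment> \<open>Ring ideals carry no scalar action by definition; multiplying by
    \<open>b\<close> is left multiplication by \<open>b\<close> times the trivial path at the
    source.\<close>
  then have "path_mult G (Poly_Mapping.single (qsrc w, []) b) (path_elem w) \<in> J"
    by (intro mult_left_in[OF assms]) simp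
  then show ?thesis by (simp add: path_mult_single)
qed

lemma in_if_keys:
  assumes "\<And>w. w \<in> Poly_Mapping.keys x \<Longrightarrow> path_elem w \<in> J"
  shows "x \<in> J"
proof -
  have "(\<Sum>w\<in>Poly_Mapping.keys x. Poly_Mapping.single w (Poly_Mapping.lookup x w)) \<in> J"
    by (rule sum_in, rule single_in, rule assms)
  then show ?thesis by (simp only: sum_singles)
qed

lemma subpath_in:
  assumes "subpath G u w" "path_elem u \<in> J"
  shows "path_elem w \<in> J"
proof -
  obtain x y where xy: "x \<in> qpaths G" "y \<in> qpaths G" "qtgt G x = qsrc u" "qtgt G u = qsrc y"
    "w = qcomp x (qcomp u y)" using assms by (auto simp: subpath_def)
  have "path_mult G (path_elem x) (path_mult G (path_elem u) (path_elem y)) \<in> J"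
    using xy assms by (intro mult_left_in mult_right_in) auto
  then show ?thesis using xy by (simp add: path_mult_single)
qed

lemma ex_minimal_subpath:
  assumes "path_elem w \<in> J"
  shows "\<exists>u\<in>minimal_paths G J. subpath G u w"
  using assms
proof (induction "length (arrows w)" arbitrary: w rule: less_induct)
  case less
  have w: "w \<in> qpaths G" using keys_in[OF less.prems] by simp
  show ?case
  proof (cases "w \<in> minimal_paths G J")
    case True
    then show ?thesis using subpath_refl[OF w] by blast
  next
    case False
    then obtain u where u: "subpath G u w" "path_elem u \<in> J" "u \<noteq> w"
      using w less.prems by (auto simp: minimal_paths_def)
    then have "length (arrows u) < length (arrows w)" using subpath_length[OF u(1)] by linarith
    from less.hyps[OF this u(2)] show ?thesis using subpath_trans u(1) by blast
  qed
qed

end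

section \<open>Monomial ideals and their minimal generators\<close>

context fin_digraph
begin

lemma path_ideal_genideal:
  assumes "R \<subseteq> qpaths G"
  shows "path_ideal G (genideal (path_algebra G) (path_elem ` R) :: (_ \<Rightarrow>\<^sub>0 'k::field) set)"
proof -
  interpret ring "path_algebra G :: (_ \<Rightarrow>\<^sub>0 'k) ring" by (rule ring_path_algebra)
  have "path_elem ` R \<subseteq> carrier (path_algebra G :: (_ \<Rightarrow>\<^sub>0 'k) ring)" using assms by auto
  from genideal_ideal[OF this] show ?thesis
    by (simp add: path_ideal_def path_ideal_axioms_def fin_digraph_axioms)
qed

text \<open>The span of all paths with a subpath in \<open>R\<close> is itself an ideal containing
  \<open>R\<close>, which bounds the generated ideal from above. Conversely every such path is a
  multiple of an element of \<open>R\<close>.\<close>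

lemma mem_genideal_paths:
  fixes x :: "_ \<Rightarrow>\<^sub>0 'k::field"
  assumes R: "R \<subseteq> qpaths G"
  shows "x \<in> genideal (path_algebra G) (path_elem ` R) \<longleftrightarrow>
    (\<forall>w\<in>Poly_Mapping.keys x. w \<in> qpaths G \<and> (\<exists>u\<in>R. subpath G u w))"
proof -
  let ?Idl = "genideal (path_algebra G) (path_elem ` R :: (_ \<Rightarrow>\<^sub>0 'k) set)"
  interpret ring "path_algebra G :: (_ \<Rightarrow>\<^sub>0 'k) ring" by (rule ring_path_algebra)
  interpret J: path_ideal G ?Idl by (rule path_ideal_genideal[OF R])
  have carr: "path_elem ` R \<subseteq> carrier (path_algebra G :: (_ \<Rightarrow>\<^sub>0 'k) ring)" using R by auto
  let ?U = "{w \<in> qpaths G. \<exists>u\<in>R. subpath G u w}"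
  have sub: "subpath G u (qcomp w z)" "subpath G u (qcomp z' w)"
    if "subpath G u w" "w \<in> qpaths G" "z \<in> qpaths G" "qtgt G w = qsrc z"
      "z' \<in> qpaths G" "qtgt G z' = qsrc w" for u w z z'
  proof -
    have v: "qsrc w \<in> verts G" "qtgt G w \<in> verts G"
      using qpaths_verts[OF wf_digraph_axioms that(2)] by auto
    have "subpath G w (qcomp w z)"
      using that v by (intro subpathI[of w "(qsrc w, [])" z]) (simp_all add: trivial_in_qpaths qcomp_def)
    moreover have "subpath G w (qcomp z' w)"
      using that v by (intro subpathI[of w z' "(qtgt G w, [])"]) (simp_all add: trivial_in_qpaths)
    ultimately show "subpath G u (qcomp w z)" "subpath G u (qcomp z' w)"
      using that(1) subpath_trans by blast+
  qed
  have "ideal {x :: _ \<Rightarrow>\<^sub>0 'k. Poly_Mapping.keys x \<subseteq> ?U} (path_algebra G)"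
  proof (rule ideal_keys)
    fix u x assume u: "u \<in> ?U" and x: "x \<in> qpaths G"
    have t: "(qsrc u, []) \<in> qpaths G" "(qtgt G u, []) \<in> qpaths G"
      using u qpaths_verts[OF wf_digraph_axioms, of u] by (simp_all add: trivial_in_qpaths)
    show "qcomp u x \<in> ?U" if "qtgt G u = qsrc x"
      using u x t sub(1)[of _ u x "(qsrc u, [])"] that qcomp_in_qpaths by fastforce
    show "qcomp x u \<in> ?U" if "qtgt G x = qsrc u"
      using u x t sub(2)[of _ u "(qtgt G u, [])" x] that qcomp_in_qpaths by fastforce
  qed simp
  moreover have "path_elem ` R \<subseteq> {x :: _ \<Rightarrow>\<^sub>0 'k. Poly_Mapping.keys x \<subseteq> ?U}"
  proof
    fix z :: "_ \<Rightarrow>\<^sub>0 'k" assume "z \<in> path_elem ` R"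
    then obtain u where u: "z = path_elem u" "u \<in> R" by blast
    then have "u \<in> ?U" using R subpath_refl by blast
    then show "z \<in> {x. Poly_Mapping.keys x \<subseteq> ?U}" using u by simp
  qed
  ultimately have "?Idl \<subseteq> {x. Poly_Mapping.keys x \<subseteq> ?U}" by (rule genideal_minimal)
  moreover have "x \<in> ?Idl" if x: "Poly_Mapping.keys x \<subseteq> ?U"
  proof (rule J.in_if_keys)
    fix w assume "w \<in> Poly_Mapping.keys x"
    then have "w \<in> ?U" using x by blast
    then obtain u where u: "u \<in> R" "subpath G u w" by blast
    then have "path_elem u \<in> ?Idl" using genideal_self[OF carr] by blast
    then show "path_elem w \<in> ?Idl" by (rule J.subpath_in[OF u(2)])
  qed
  ultimately show ?thesis by blast
qed

lemma path_elem_in_generated_iff: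
  fixes J :: "(_ \<Rightarrow>\<^sub>0 'k::field) set"
  assumes "generated_by_paths G J R"
  shows "path_elem w \<in> J \<longleftrightarrow> w \<in> qpaths G \<and> (\<exists>u\<in>R. subpath G u w)"
proof -
  have "R \<subseteq> qpaths G" "J = genideal (path_algebra G) (path_elem ` R)"
    using assms by (simp_all add: generated_by_paths_def)
  then show ?thesis using mem_genideal_paths[of R "path_elem w :: _ \<Rightarrow>\<^sub>0 'k"] by simp
qed

text \<open>The decisive property of monomial ideals: a difference of two distinct paths can lie in
  \<open>J\<close> only if both paths do. It is what separates cosets later.\<close>

lemma generated_by_paths_keys:
  assumes "generated_by_paths G J R" "x \<in> J" "w \<in> Poly_Mapping.keys x"
  shows "path_elem w \<in> J"
proof -
  have "R \<subseteq> qpaths G" "J = genideal (path_algebra G) (path_elem ` R)"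
    using assms(1) by (simp_all add: generated_by_paths_def)
  then show ?thesis
    using assms(2,3) mem_genideal_paths[of R x] path_elem_in_generated_iff[OF assms(1)] by simp
qed

lemma generated_by_minimal_paths:
  fixes J :: "(_ \<Rightarrow>\<^sub>0 'k::field) set"
  assumes R: "generated_by_paths G J R"
  shows "generated_by_paths G J (minimal_paths G J)"
proof -
  have J: "J = genideal (path_algebra G) (path_elem ` R)" and R': "R \<subseteq> qpaths G"
    using R by (auto simp: generated_by_paths_def)
  interpret path_ideal G J using path_ideal_genideal[OF R'] J by simp
  have min: "minimal_paths G J \<subseteq> qpaths G" by (auto simp: minimal_paths_def)
  have "x \<in> J \<longleftrightarrow> x \<in> genideal (path_algebra G) (path_elem ` minimal_paths G J)" for x
    unfolding mem_genideal_paths[OF min]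
  proof
    assume x: "x \<in> J"
    show "\<forall>w\<in>Poly_Mapping.keys x. w \<in> qpaths G \<and> (\<exists>u\<in>minimal_paths G J. subpath G u w)"
      using keys_in[OF x] ex_minimal_subpath generated_by_paths_keys[OF R x] by blast
  next
    assume "\<forall>w\<in>Poly_Mapping.keys x. w \<in> qpaths G \<and> (\<exists>u\<in>minimal_paths G J. subpath G u w)"
    moreover have "path_elem w \<in> J" if "u \<in> minimal_paths G J" "subpath G u w" for u w
      using that subpath_in by (simp add: minimal_paths_def)
    ultimately show "x \<in> J" by (blast intro!: in_if_keys[of x])
  qed
  then show ?thesis using min by (auto simp: generated_by_paths_def)
qed

lemma minimal_paths_subset_generators:
  assumes "generated_by_paths G J R"
  shows "minimal_paths G J \<subseteq> R"
proof
  fix w assume w: "w \<in> minimal_paths G J"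
  then obtain u where u: "u \<in> R" "subpath G u w"
    using path_elem_in_generated_iff[OF assms] by (auto simp: minimal_paths_def)
  moreover have "u \<in> qpaths G" using u(2) by (auto simp: subpath_def)
  ultimately have "path_elem u \<in> J" using path_elem_in_generated_iff[OF assms] subpath_refl by blast
  then have "u = w" using w u unfolding minimal_paths_def by blast
  then show "w \<in> R" using u by simp
qed

text \<open>This evaluates the definite description in \<open>zero_relations\<close>. A path that is
  minimal in \<open>J\<close> has a subpath in any generating set and must equal it, so the minimal
  paths lie in every generating set; as they generate \<open>J\<close>, they are the least
  one.\<close>

lemma the_minimal_generators:
  assumes "generated_by_paths G J R"
  shows "(THE R. generated_by_paths G J R \<and> (\<forall>R'\<subset>R. \<not> generated_by_paths G J R'))
    = minimal_paths G J"
proof (rule the_equality)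
  show "generated_by_paths G J (minimal_paths G J) \<and>
      (\<forall>R'\<subset>minimal_paths G J. \<not> generated_by_paths G J R')"
    using generated_by_minimal_paths[OF assms] minimal_paths_subset_generators[of J] by blast
  show "R' = minimal_paths G J"
    if "generated_by_paths G J R' \<and> (\<forall>R''\<subset>R'. \<not> generated_by_paths G J R'')" for R'
    using that generated_by_minimal_paths[OF assms] minimal_paths_subset_generators[of J R'] by blast
qed

section \<open>Length bounds from admissibility\<close>

lemma arrow_ideal_subset:
  "arrow_ideal G \<subseteq> {x :: _ \<Rightarrow>\<^sub>0 'k::field. Poly_Mapping.keys x \<subseteq> {w \<in> qpaths G. 1 \<le> length (arrows w)}}"
  unfolding arrow_ideal_def
proof (rule ring.genideal_minimal[OF ring_path_algebra])
  show "ideal {x :: _ \<Rightarrow>\<^sub>0 'k. Poly_Mapping.keys x \<subseteq> {w \<in> qpaths G. 1 \<le> length (arrows w)}}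
      (path_algebra G)"
    by (rule ideal_keys) (simp_all add: qcomp_in_qpaths length_qcomp)
  show "(\<lambda>a. path_elem (arrow_path G a)) ` arcs G
      \<subseteq> {x :: _ \<Rightarrow>\<^sub>0 'k. Poly_Mapping.keys x \<subseteq> {w \<in> qpaths G. 1 \<le> length (arrows w)}}"
    using word_in_qpaths by (auto simp: arrow_path_eq_word)
qed

lemma arrow_ideal_power_subset:
  "arrow_ideal_power G n \<subseteq>
     {x :: _ \<Rightarrow>\<^sub>0 'k::field. Poly_Mapping.keys x \<subseteq> {w \<in> qpaths G. n \<le> length (arrows w)}}"
proof (induction n)
  case (Suc n)
  show ?case
  proof
    fix x :: "_ \<Rightarrow>\<^sub>0 'k" assume "x \<in> arrow_ideal_power G (Suc n)"
    then have "x \<in> ideal_prod (path_algebra G) (arrow_ideal_power G n) (arrow_ideal G)" by simp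
    then show "x \<in> {x. Poly_Mapping.keys x \<subseteq> {w \<in> qpaths G. Suc n \<le> length (arrows w)}}"
    proof induction
      case (prod i j)
      have i: "Poly_Mapping.keys i \<subseteq> {w \<in> qpaths G. n \<le> length (arrows w)}" using prod Suc by blast
      have j: "Poly_Mapping.keys j \<subseteq> {w \<in> qpaths G. 1 \<le> length (arrows w)}"
        using prod arrow_ideal_subset by blast
      show ?case
      proof safe
        fix a b assume "(a, b) \<in> Poly_Mapping.keys (i \<otimes>\<^bsub>path_algebra G\<^esub> j)"
        then obtain u w where uw: "(a, b) = qcomp u w" "u \<in> Poly_Mapping.keys i"
          "w \<in> Poly_Mapping.keys j" "qtgt G u = qsrc w"
          using keys_path_mult[of G i j] by auto
        then have "u \<in> qpaths G" "w \<in> qpaths G" "n \<le> length (arrows u)" "1 \<le> length (arrows w)"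
          using i j by auto
        then show "(a, b) \<in> qpaths G" "Suc n \<le> length (arrows (a, b))"
          unfolding uw(1) using uw(4) by (auto simp: length_qcomp intro: qcomp_in_qpaths)
      qed
    next
      case (sum s1 s2)
      then show ?case using keys_add[of s1 s2] by auto
    qed
  qed
qed auto

lemma path_elem_in_arrow_ideal_power:
  assumes "path_word G p"
  shows "(path_elem (word G p) :: _ \<Rightarrow>\<^sub>0 'k::field) \<in> arrow_ideal_power G (length p)"
  using assms
proof (induction p rule: rev_induct)
  case (snoc a p)
  interpret ring "path_algebra G :: (_ \<Rightarrow>\<^sub>0 'k) ring" by (rule ring_path_algebra)
  have arr: "(\<lambda>a. path_elem (arrow_path G a)) ` arcs G
      \<subseteq> carrier (path_algebra G :: (_ \<Rightarrow>\<^sub>0 'k) ring)"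
    by (auto simp: arrow_path_eq_word intro!: word_in_qpaths)
  have "a \<in> arcs G" using snoc.prems by (simp add: path_word_def)
  then have a: "path_elem (word G [a]) \<in> (arrow_ideal G :: (_ \<Rightarrow>\<^sub>0 'k) set)"
    using genideal_self[OF arr] by (auto simp: arrow_ideal_def arrow_path_eq_word)
  show ?case
  proof (cases "p = []")
    case True
    \<comment> \<open>The zeroth power is the whole algebra, so the first power is a product as
      well, and the arrow is written as a trivial path times itself.\<close>
    have "(path_elem (tail G a, []) :: _ \<Rightarrow>\<^sub>0 'k) \<otimes>\<^bsub>path_algebra G\<^esub> path_elem (word G [a])
        \<in> ideal_prod (path_algebra G) (carrier (path_algebra G)) (arrow_ideal G)"
      using a \<open>a \<in> arcs G\<close>
      by (intro ideal_prod.prod) (auto intro!: trivial_in_qpaths tail_in_verts)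
    then show ?thesis by (simp add: True path_mult_single word_def qcomp_def)
  next
    case False
    then have p: "path_word G p" "head G (last p) = tail G a"
      using snoc.prems by (auto simp: path_word_append_iff)
    have "(path_elem (word G p) :: _ \<Rightarrow>\<^sub>0 'k) \<otimes>\<^bsub>path_algebra G\<^esub> path_elem (word G [a])
        \<in> arrow_ideal_power G (Suc (length p))"
      using ideal_prod.prod[OF snoc.IH[OF p(1)] a, of "path_algebra G"] by simp
    then show ?thesis using p False by (simp add: path_mult_single qtgt_word qcomp_word)
  qed
qed (simp add: path_word_def)

text \<open>The inclusion of \<open>I\<close> in the second power of the arrow ideal keeps vertices
  and arrows out of \<open>I\<close>. The inclusion of the power \<open>m\<close> in
  \<open>I\<close> puts the prefix of length \<open>m\<close> of a long path into \<open>I\<close>,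
  and with it the path.\<close>

lemma admissible_bounds:
  fixes I :: "(_ \<Rightarrow>\<^sub>0 'k::field) set"
  assumes "admissible_ideal G I"
  shows "path_ideal G I" "path_elem w \<in> I \<Longrightarrow> 2 \<le> length (arrows w)"
    "\<exists>m. \<forall>p. path_word G p \<longrightarrow> m \<le> length p \<longrightarrow> path_elem (word G p) \<in> I"
proof -
  obtain m where m: "m \<ge> 2" "arrow_ideal_power G m \<subseteq> I" "I \<subseteq> arrow_ideal_power G 2"
    using assms by (auto simp: admissible_ideal_def)
  interpret path_ideal G I using assms fin_digraph_axioms
    by (simp add: admissible_ideal_def path_ideal_def path_ideal_axioms_def)
  show "path_ideal G I" by (rule path_ideal_axioms)
  show "path_elem w \<in> I \<Longrightarrow> 2 \<le> length (arrows w)"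
    using m(3) arrow_ideal_power_subset[of 2] by fastforce
  have "path_elem (word G p) \<in> I" if p: "path_word G p" "m \<le> length p" for p
  proof -
    have "take m p \<noteq> []" using m(1) p by (auto simp: path_word_def)
    moreover have "p = [] @ take m p @ drop m p" by simp
    ultimately have *: "path_word G (take m p)" "subpath G (word G (take m p)) (word G p)"
      using p path_word_factor[of G "[]" "take m p" "drop m p"] subpath_word_iff[of p "take m p"]
      by (simp, metis)
    have "path_elem (word G (take m p)) \<in> I"
      using path_elem_in_arrow_ideal_power[OF *(1)] m(2) p(2) by auto
    then show ?thesis using subpath_in[OF *(2)] by blast
  qed
  then show "\<exists>m. \<forall>p. path_word G p \<longrightarrow> m \<le> length p \<longrightarrow> path_elem (word G p) \<in> I"
    by blast
qed

end

section \<open>The paths \<open>\<omega>\<^sub>a\<close>\<close>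

definition thin_vertex :: "('v, 'a) pre_digraph \<Rightarrow> 'v \<Rightarrow> bool" where
  "thin_vertex Q v \<longleftrightarrow> (\<exists>!b. b \<in> arcs Q \<and> tail Q b = v) \<and> (\<exists>!b. b \<in> arcs Q \<and> head Q b = v)"

text \<open>The condition on interior vertices in the definition of \<open>omega_path\<close>,
  recast as a relation between consecutive arrows. It is a partial injection like \<open>s\<close>,
  but it comes from the quiver alone.\<close>

definition thin_step :: "('v, 'a) pre_digraph \<Rightarrow> 'a \<Rightarrow> 'a \<Rightarrow> bool" where
  "thin_step Q x y \<longleftrightarrow> x \<in> arcs Q \<and> y \<in> arcs Q \<and> head Q x = tail Q y \<and> thin_vertex Q (head Q x)"

definition thin_word :: "('v, 'a) pre_digraph \<Rightarrow> 'a list \<Rightarrow> bool" where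
  "thin_word Q p \<longleftrightarrow> p \<noteq> [] \<and> set p \<subseteq> arcs Q \<and> successively (thin_step Q) p"

lemma thin_step_succ: "thin_step Q x y \<Longrightarrow> z \<in> arcs Q \<Longrightarrow> head Q x = tail Q z \<Longrightarrow> z = y"
  by (auto simp: thin_step_def thin_vertex_def)

lemma thin_step_pred: "thin_step Q x y \<Longrightarrow> z \<in> arcs Q \<Longrightarrow> head Q z = tail Q y \<Longrightarrow> z = x"
  by (auto simp: thin_step_def thin_vertex_def)

lemma thin_word_path_word: "thin_word Q p \<Longrightarrow> path_word Q p"
  by (auto simp: thin_word_def path_word_def thin_step_def elim: successively_mono)

lemma thin_word_iff:
  "thin_word Q p \<longleftrightarrow> path_word Q p \<and>
     (\<forall>j. Suc j < length p \<longrightarrow> thin_vertex Q (head Q (p ! j)))"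
  using nth_mem
  by (fastforce simp: thin_word_def path_word_def thin_step_def successively_conv_nth subset_iff)

lemma successively_factor: "successively s (u @ v @ w) \<Longrightarrow> successively s v"
  by (auto simp: successively_append_iff)

text \<open>If a letter \<open>y\<close> repeats, the stretch from one \<open>y\<close> to the next
  is a shorter closed chain.\<close>

lemma ex_distinct_cycle:
  assumes "C \<noteq> []" "successively s (C @ [hd C])"
  shows "\<exists>D. D \<noteq> [] \<and> distinct D \<and> successively s (D @ [hd D])"
  using assms
proof (induction "length C" arbitrary: C rule: less_induct)
  case less
  show ?case
  proof (cases "distinct C")
    case False
    then obtain xs y ys zs where C: "C = xs @ [y] @ ys @ [y] @ zs" using not_distinct_decomp by blast
    then have "successively s ((y # ys) @ [hd (y # ys)])"
      using less.prems(2) successively_factor[of s xs "(y # ys) @ [y]" "zs @ [hd C]"] by simp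
    then show ?thesis by (rule less.hyps[rotated 2]) (simp_all add: C)
  qed (use less.prems in blast)
qed

lemma oriented_cycle_nth:
  assumes "oriented_cycle Q c" "x \<in> arcs Q" "y \<in> arcs Q" "head Q x = tail Q y"
  obtains i where "i < length c" "x = c ! i" "y = c ! (Suc i mod length c)"
proof -
  have c: "c \<noteq> []" "inj_on (tail Q) (set c)" "arcs Q = set c"
    "\<And>i. i < length c \<Longrightarrow> head Q (c ! i) = tail Q (c ! (Suc i mod length c))"
    using assms(1) by (auto simp: oriented_cycle_def distinct_map)
  obtain i where i: "i < length c" "x = c ! i" using assms(2) c by (auto simp: in_set_conv_nth)
  have "c ! (Suc i mod length c) \<in> set c" using c(1) by simp
  then have "y = c ! (Suc i mod length c)" using c(2,3,4) i assms(3,4) by (metis inj_onD)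
  then show ?thesis using that i by blast
qed

lemma oriented_cycle_path_word:
  assumes "oriented_cycle Q c"
  shows "path_word Q c" "distinct c" "set c = arcs Q" "head Q (last c) = tail Q (hd c)"
proof -
  have c: "c \<noteq> []" "arcs Q = set c" "distinct (map (tail Q) c)"
    "\<And>i. i < length c \<Longrightarrow> head Q (c ! i) = tail Q (c ! (Suc i mod length c))"
    using assms by (auto simp: oriented_cycle_def)
  show "path_word Q c" using c by (auto simp: path_word_def successively_conv_nth)
  show "distinct c" "set c = arcs Q" using c by (auto simp: distinct_map)
  show "head Q (last c) = tail Q (hd c)"
    using c(1) c(4)[of "length c - 1"] by (simp add: last_conv_nth hd_conv_nth)
qed

locale omega_quiver = fin_digraph G for G :: "('v, 'a) pre_digraph" +
  fixes c :: "'a list"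
  assumes connected_G: "Digraph_Component.connected G"
    and cyclic_c: "cyclic_quiver G \<Longrightarrow> oriented_cycle G c"
begin

text \<open>At a vertex of a thin cycle no arrow enters or leaves besides those of the cycle. So the
  vertices of the cycle are closed under arrows in both directions, and connectedness of the quiver
  makes them all of it.\<close>

lemma cyclic_quiver_if_thin_cycle:
  assumes "C \<noteq> []" "successively (thin_step G) (C @ [hd C])"
  shows "cyclic_quiver G"
proof -
  obtain D where D: "D \<noteq> []" "distinct D" "successively (thin_step G) (D @ [hd D])"
    using ex_distinct_cycle[OF assms] by blast
  define next_arc where "next_arc i = D ! (Suc i mod length D)" for i
  have step: "thin_step G (D ! i) (next_arc i)" if "i < length D" for i
  proof (cases "Suc i < length D")
    case True
    moreover have "successively (thin_step G) D" using D(3) by (simp add: successively_append_iff)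
    ultimately show ?thesis by (simp add: successively_conv_nth next_arc_def)
  next
    case False
    then have i: "Suc i = length D" using that by simp
    then have "D ! i = last D" using D(1) last_conv_nth[of D] by (metis diff_Suc_1)
    then show ?thesis using D i by (simp add: successively_append_iff next_arc_def hd_conv_nth)
  qed
  have arcsD: "set D \<subseteq> arcs G"
    using step by (auto simp: in_set_conv_nth thin_step_def)
  have next_in: "next_arc i \<in> set D" for i using D(1) by (simp add: next_arc_def)
  have "\<exists>j<length D. thin_step G (D ! j) (D ! i)" if "i < length D" for i
  proof (cases i)
    case 0
    then show ?thesis using step[of "length D - 1"] D(1)
      by (intro exI[of _ "length D - 1"]) (simp add: next_arc_def)
  next
    case (Suc j)
    then show ?thesis using step[of j] that by (intro exI[of _ j]) (simp add: next_arc_def)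
  qed
  then have pred: "\<exists>z\<in>set D. thin_step G z y" if "y \<in> set D" for y
    using that by (metis in_set_conv_nth)
  have succ: "\<exists>y\<in>set D. thin_step G x y" if "x \<in> set D" for x
    using that step next_in by (metis in_set_conv_nth)
  have tl: "e \<in> set D" if "e \<in> arcs G" "tail G e \<in> tail G ` set D" for e
  proof -
    from that obtain y where y: "y \<in> set D" "tail G e = tail G y" by auto
    obtain z where "thin_step G z y" using pred[OF y(1)] by blast
    then have "e = y" using that(1) y thin_step_succ[of G z y e] thin_step_def by metis
    then show ?thesis using y by simp
  qed
  have hd: "e \<in> set D" if "e \<in> arcs G" "head G e \<in> tail G ` set D" for e
  proof -
    from that obtain y where y: "y \<in> set D" "head G e = tail G y" by auto
    obtain z where "z \<in> set D" "thin_step G z y" using pred[OF y(1)] by blast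
    then show ?thesis using that(1) y thin_step_pred[of G z y e] by simp
  qed
  have "hd D \<in> arcs G" using D(1) arcsD by auto
  have verts: "verts G \<subseteq> tail G ` set D"
  proof (rule connected_arc_closed[OF connected_G])
    show "tail G (hd D) \<in> tail G ` set D" "tail G (hd D) \<in> verts G"
      using D(1) \<open>hd D \<in> arcs G\<close> by auto
    fix e assume e: "e \<in> arcs G"
    show "tail G e \<in> tail G ` set D \<longleftrightarrow> head G e \<in> tail G ` set D"
    proof
      assume "tail G e \<in> tail G ` set D"
      then have "e \<in> set D" using tl e by blast
      then show "head G e \<in> tail G ` set D" using succ by (fastforce simp: thin_step_def)
    next
      assume "head G e \<in> tail G ` set D"
      then show "tail G e \<in> tail G ` set D" using hd e by blast
    qed
  qed
  have "inj_on (tail G) (set D)"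
  proof (rule inj_onI)
    fix x y assume xy: "x \<in> set D" "y \<in> set D" "tail G x = tail G y"
    obtain z where "thin_step G z x" using pred[OF xy(1)] by blast
    then show "x = y" using xy arcsD thin_step_succ[of G z x y] thin_step_def by (metis subsetD)
  qed
  moreover have "arcs G \<subseteq> set D" using tl verts tail_in_verts by blast
  ultimately have "oriented_cycle G D" using D verts arcsD step tail_in_verts
    by (auto simp: oriented_cycle_def distinct_map thin_step_def next_arc_def subset_iff)
  then show ?thesis by (auto simp: cyclic_quiver_def)
qed

text \<open>This is the reason for the separate definition of \<open>\<omega>\<^sub>a\<close> on
  cyclic quivers: there thin words wind around without bound and no longest one exists.\<close>

lemma thin_word_distinct:
  assumes "\<not> cyclic_quiver G" "thin_word G p"
  shows "distinct p"
proof (rule ccontr)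
  assume "\<not> distinct p"
  then obtain xs y ys zs where "p = xs @ [y] @ ys @ [y] @ zs" using not_distinct_decomp by blast
  then have "successively (thin_step G) ((y # ys) @ [hd (y # ys)])"
    using assms(2) successively_factor[of _ xs "(y # ys) @ [y]" zs] by (simp add: thin_word_def)
  then show False using cyclic_quiver_if_thin_cycle assms(1) by blast
qed

text \<open>Words without repetition have at most \<open>card (arcs G)\<close> letters; the
  successor appears because the bound in the locale is strict.\<close>

lemma zero_words_thin:
  assumes "\<not> cyclic_quiver G"
  shows "zero_words (thin_word G) (Suc (card (arcs G)))"
proof
  show "thin_word G v" if "thin_word G (u @ v @ w)" "v \<noteq> []" for u v w
    using that by (auto simp: thin_word_def successively_append_iff)
  show "length p < Suc (card (arcs G))" if "thin_word G p" for p
    using thin_word_distinct[OF assms that] card_mono[of "arcs G" "set p"] that distinct_card[of p]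
    by (simp add: thin_word_def)
  show "y = z" if "thin_word G [x, y]" "thin_word G [x, z]" for x y z
    using that thin_step_succ[of G x z y] by (simp add: thin_word_def) (simp add: thin_step_def)
  show "y = z" if "thin_word G [y, x]" "thin_word G [z, x]" for x y z
    using that thin_step_pred[of G z x y] by (simp add: thin_word_def) (simp add: thin_step_def)
qed (simp add: thin_word_def)

text \<open>
  Thin words are a family of nonzero words without minimal zero words, so the criterion for unique
  maximal words yields the path \<open>\<omega>\<^sub>a\<close>.
\<close>

lemma thin_extension:
  assumes "\<not> cyclic_quiver G" "a \<in> arcs G"
  obtains p where "thin_word G p" "a \<in> set p" "omega_path G c a = word G p"
    "\<And>q. thin_word G q \<Longrightarrow> a \<in> set q \<Longrightarrow> \<exists>u v. p = u @ q @ v"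
proof -
  interpret Z: zero_words "thin_word G" "Suc (card (arcs G))" by (rule zero_words_thin[OF assms(1)])
  \<comment> \<open>Thinness is a condition on consecutive pairs, and every pair of a word with more
    than two letters lies in its \<open>butlast\<close> or its \<open>tl\<close>.\<close>
  have "\<not> Z.orel r" for r
  proof
    assume r: "Z.orel r"
    obtain x y p where "r = x # y # p" using r by (cases r; cases "tl r") (auto simp: Z.orel_def)
    moreover from this have "p \<noteq> []" using r by (auto simp: Z.orel_def)
    ultimately show False using r by (auto simp: Z.orel_def thin_word_def successively_Cons)
  qed
  then have Z.unique_max using Z.unique_max_iff by (auto simp: Z.isolated_orels_def)
  moreover have "thin_word G [a]" using assms(2) by (simp add: thin_word_def)
  ultimately obtain p where p: "Z.max_word p" "a \<in> set p"
    and uniq: "\<And>q. Z.max_word q \<Longrightarrow> a \<in> set q \<Longrightarrow> q = p"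
    unfolding Z.unique_max_def by blast
  have ext: "\<exists>u v. p = u @ q @ v" if q: "thin_word G q" "a \<in> set q" for q
    using Z.ex_max_word[OF q(1)] uniq q(2) by (metis Un_iff set_append)
  have thin_p: "thin_word G p" using p by (simp add: Z.max_word_def)
  let ?P = "\<lambda>w. w \<in> qpaths G \<and> subpath G (arrow_path G a) w \<and>
             (\<forall>j. Suc j < length (arrows w) \<longrightarrow>
                (\<exists>!b. b \<in> arcs G \<and> tail G b = head G (arrows w ! j)) \<and>
                (\<exists>!b. b \<in> arcs G \<and> head G b = head G (arrows w ! j)))"
  have P: "?P w \<longleftrightarrow> (\<exists>q. thin_word G q \<and> a \<in> set q \<and> w = word G q)" for w
  proof
    assume w: "?P w"
    then have "length (arrows (arrow_path G a)) \<le> length (arrows w)" using subpath_length by blast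
    then obtain q where q: "path_word G q" "w = word G q" using w
      by (auto simp: arrow_path_def elim: qpaths_cases)
    then have "a \<in> set q" using w subpath_word_iff[of q "[a]"] by (auto simp: arrow_path_eq_word)
    then show "\<exists>q. thin_word G q \<and> a \<in> set q \<and> w = word G q"
      using w q unfolding thin_word_iff thin_vertex_def by auto
  next
    assume "\<exists>q. thin_word G q \<and> a \<in> set q \<and> w = word G q"
    then obtain q where q: "thin_word G q" "a \<in> set q" "w = word G q" by blast
    then have pw: "path_word G q" by (simp add: thin_word_iff)
    obtain x y where "q = x @ [a] @ y" using q(2) by (auto dest: split_list)
    then have "subpath G (arrow_path G a) w"
      using subpath_word_iff[OF pw, of "[a]"] q(3) by (auto simp: arrow_path_eq_word)
    then show "?P w" using q pw word_in_qpaths[OF pw] unfolding thin_word_iff thin_vertex_def by simp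
  qed
  \<comment> \<open>Every candidate is a factor of \<open>p\<close>, so a candidate at least as long
    as \<open>p\<close> is \<open>p\<close> itself.\<close>
  have "(THE w. is_arg_max (\<lambda>w. length (arrows w)) ?P w) = word G p"
  proof (rule the_equality)
    have "\<not> length p < length q" if "thin_word G q" "a \<in> set q" for q
      using ext[OF that] by auto
    then show "is_arg_max (\<lambda>w. length (arrows w)) ?P (word G p)"
      unfolding is_arg_max_def P using thin_p p(2) arrows_word by metis
    fix w assume w: "is_arg_max (\<lambda>w. length (arrows w)) ?P w"
    then obtain q where q: "thin_word G q" "a \<in> set q" "w = word G q"
      unfolding is_arg_max_def P by blast
    obtain u v where uv: "p = u @ q @ v" using ext[OF q(1,2)] by blast
    have "\<not> length (arrows w) < length (arrows (word G p))"
      using w thin_p p(2) unfolding is_arg_max_def P by blast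
    then show "w = word G p" using q uv by simp
  qed
  then have "omega_path G c a = word G p" using assms(1) by (simp add: omega_path_def)
  then show ?thesis using that thin_p p(2) ext by blast
qed

abbreviation W :: "'a \<Rightarrow> 'a list" where "W a \<equiv> arrows (omega_path G c a)"

lemma omega_path_eq_word:
  assumes "a \<in> arcs G"
  shows "omega_path G c a = word G (W a)" "path_word G (W a)" "a \<in> set (W a)" "distinct (W a)"
proof -
  have "omega_path G c a = word G (W a) \<and> path_word G (W a) \<and> a \<in> set (W a) \<and> distinct (W a)"
  proof (cases "cyclic_quiver G")
    case True
    then have "omega_path G c a = word G c" by (simp add: omega_path_def word_def)
    then show ?thesis using oriented_cycle_path_word[OF cyclic_c[OF True]] assms by simp
  next
    case False
    obtain p where "thin_word G p" "a \<in> set p" "omega_path G c a = word G p"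
      using thin_extension[OF False assms] by metis
    then show ?thesis using thin_word_path_word thin_word_distinct[OF False] by simp
  qed
  then show "omega_path G c a = word G (W a)" "path_word G (W a)" "a \<in> set (W a)" "distinct (W a)"
    by auto
qed

text \<open>On a quiver that is not cyclic, each of the two longest thin words contains the other as
  a factor. Consequently the paths \<open>\<omega>\<^sub>a\<close> partition the arrows.\<close>

lemma omega_path_eqI:
  assumes "a \<in> arcs G" "b \<in> set (W a)"
  shows "omega_path G c b = omega_path G c a"
proof (cases "cyclic_quiver G")
  case True
  then show ?thesis by (simp add: omega_path_def)
next
  case False
  have b: "b \<in> arcs G" using omega_path_eq_word(2)[OF assms(1)] assms(2) by (auto simp: path_word_def)
  obtain p where p: "thin_word G p" "a \<in> set p" "omega_path G c a = word G p"
    "\<And>q. thin_word G q \<Longrightarrow> a \<in> set q \<Longrightarrow> \<exists>u v. p = u @ q @ v"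
    using thin_extension[OF False assms(1)] by metis
  obtain q where q: "thin_word G q" "b \<in> set q" "omega_path G c b = word G q"
    "\<And>p. thin_word G p \<Longrightarrow> b \<in> set p \<Longrightarrow> \<exists>u v. q = u @ p @ v"
    using thin_extension[OF False b] by metis
  have "b \<in> set p" using assms(2) p(3) by simp
  then obtain u v where q_eq: "q = u @ p @ v" using q(4)[OF p(1)] by blast
  then obtain u' v' where "p = u' @ q @ v'" using p(4)[OF q(1)] p(2) by auto
  then have "length q \<le> length p" by simp
  then show ?thesis using q_eq p(3) q(3) by simp
qed

text \<open>If \<open>x\<close> is not last in its path, the vertex after it has a single outgoing
  arrow, which must be \<open>y\<close>; dually if \<open>y\<close> is not first in its path. For a
  cyclic quiver the second alternative is the pair that closes \<open>c\<close>.\<close>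

lemma path_word_omega_cases:
  assumes "path_word G [x, y]"
  shows "(\<exists>u v. W x = u @ [x, y] @ v) \<or> (x = last (W x) \<and> y = hd (W y))"
proof -
  have xy: "x \<in> arcs G" "y \<in> arcs G" "head G x = tail G y" using assms by (auto simp: path_word_def)
  show ?thesis
  proof (cases "cyclic_quiver G")
    case True
    then have W: "W x = c" "W y = c" by (simp_all add: omega_path_def)
    obtain i where i: "i < length c" "x = c ! i" "y = c ! (Suc i mod length c)"
      using oriented_cycle_nth[OF cyclic_c[OF True] xy] .
    show ?thesis
    proof (cases "Suc i < length c")
      case True
      then have "c = take i c @ [x, y] @ drop (Suc (Suc i)) c"
        using i by (simp add: Cons_nth_drop_Suc)
      then show ?thesis using W by metis
    next
      case False
      then have "Suc i = length c" using i by simp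
      moreover from this have "i = length c - 1" "c \<noteq> []" by auto
      ultimately show ?thesis using i W by (simp add: last_conv_nth hd_conv_nth)
    qed
  next
    case False
    obtain p where p: "thin_word G p" "x \<in> set p" "omega_path G c x = word G p"
      using thin_extension[OF False xy(1)] by metis
    obtain q where q: "thin_word G q" "y \<in> set q" "omega_path G c y = word G q"
      using thin_extension[OF False xy(2)] by metis
    have Wp: "W x = p" and Wq: "W y = q" using p(3) q(3) by simp_all
    obtain u v where uv: "p = u @ x # v" using p(2) by (auto dest: split_list)
    show ?thesis
    proof (cases v)
      case (Cons z v')
      then have "thin_step G x z" using p(1) by (auto simp: uv thin_word_def successively_append_iff)
      then have "y = z" using xy thin_step_succ by metis
      then show ?thesis using Wp uv Cons by auto
    next
      case Nil
      obtain u' v' where uv': "q = u' @ y # v'" using q(2) by (auto dest: split_list)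
      show ?thesis
      proof (cases u' rule: rev_cases)
        case Nil
        then show ?thesis using Wp Wq uv uv' \<open>v = []\<close> by simp
      next
        case (snoc u'' z)
        then have "thin_step G z y" using q(1) by (auto simp: uv' thin_word_def successively_append_iff)
        then have "x = z" using xy thin_step_pred by metis
        then have "x \<in> set (W y)" using Wq uv' snoc by simp
        then have "W x = W y" using omega_path_eqI[OF xy(2)] by simp
        then show ?thesis using Wq uv' snoc \<open>x = z\<close> by auto
      qed
    qed
  qed
qed

end

section \<open>Nonzero paths of a special multiserial algebra\<close>

locale multiserial_quiver = omega_quiver G c + path_ideal G I
  for G :: "('v, 'a) pre_digraph" and c :: "'a list" and I :: "(('v, 'a) qpath \<Rightarrow>\<^sub>0 'k::field) set" +
  fixes m :: nat
  assumes length_in_I: "path_elem w \<in> I \<Longrightarrow> 2 \<le> length (arrows w)"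
    and long_in_I: "path_word G p \<Longrightarrow> m \<le> length p \<Longrightarrow> path_elem (word G p) \<in> I"
    and multiserial: "special_multiserial G I"
    and local_mono: "locally_monomial G I c"
begin

definition Z :: "'a list \<Rightarrow> bool" where
  "Z p \<longleftrightarrow> path_word G p \<and> path_elem (word G p) \<notin> I"

text \<open>Words that do not compose have product zero, which lies in \<open>I\<close>, and their
  concatenation is no path. So \<open>Z\<close> absorbs the case distinction on
  composability.\<close>

lemma path_mult_word_in_iff:
  assumes "path_word G p" "path_word G q"
  shows "path_mult G (path_elem (word G p)) (path_elem (word G q)) \<in> I \<longleftrightarrow> \<not> Z (p @ q)"
proof -
  have "p \<noteq> []" "q \<noteq> []" using assms by (auto simp: path_word_def)
  then show ?thesis using assms
    by (auto simp: path_mult_single qtgt_word qcomp_word Z_def path_word_append_iff zero_in)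
qed

lemma Z_arc: "Z [a] \<longleftrightarrow> a \<in> arcs G"
  using length_in_I[of "word G [a]"] by (auto simp: Z_def)

lemma Z_arcs: "Z p \<Longrightarrow> set p \<subseteq> arcs G"
  by (simp add: Z_def path_word_def)

lemma zero_words_Z: "zero_words Z m"
proof
  show "Z v" if "Z (u @ v @ w)" "v \<noteq> []" for u v w
  proof -
    have "path_word G (u @ v @ w)" "path_elem (word G (u @ v @ w)) \<notin> I" using that(1) by (auto simp: Z_def)
    moreover from this have "path_word G v" "subpath G (word G v) (word G (u @ v @ w))"
      using that(2) path_word_factor subpath_word_iff by blast+
    ultimately show ?thesis using subpath_in by (metis Z_def)
  qed
  show "length p < m" if "Z p" for p
    using that long_in_I[of p] by (meson Z_def not_le)
  have mult: "path_elem (arrow_path G a) \<otimes>\<^bsub>path_algebra G\<^esub> path_elem (arrow_path G b) \<notin> I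
      \<longleftrightarrow> Z [a, b]" if "a \<in> arcs G" "b \<in> arcs G" for a b
    using path_mult_word_in_iff[of "[a]" "[b]"] that by (simp add: arrow_path_eq_word)
  show "y = z" if "Z [x, y]" "Z [x, z]" for x y z
  proof -
    have arcs: "x \<in> arcs G" "y \<in> arcs G" "z \<in> arcs G" using that Z_arcs by fastforce+
    then have "\<exists>\<^sub>\<le>\<^sub>1 b. b \<in> arcs G \<and>
        path_elem (arrow_path G x) \<otimes>\<^bsub>path_algebra G\<^esub> path_elem (arrow_path G b) \<notin> I"
      using multiserial unfolding special_multiserial_def by blast
    from Uniq_D[OF this, of y z] show ?thesis using arcs mult that by blast
  qed
  show "y = z" if "Z [y, x]" "Z [z, x]" for x y z
  proof -
    have arcs: "x \<in> arcs G" "y \<in> arcs G" "z \<in> arcs G" using that Z_arcs by fastforce+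
    then have "\<exists>\<^sub>\<le>\<^sub>1 b. b \<in> arcs G \<and>
        path_elem (arrow_path G b) \<otimes>\<^bsub>path_algebra G\<^esub> path_elem (arrow_path G x) \<notin> I"
      using multiserial unfolding special_multiserial_def by blast
    from Uniq_D[OF this, of y z] show ?thesis using arcs mult that by blast
  qed
qed (simp add: Z_def path_word_def)

sublocale zero_words Z m by (rule zero_words_Z)

lemma s_path_word: "s x y \<Longrightarrow> path_word G [x, y]"
  by (simp add: Z_def)

lemma successively_s_path_word:
  assumes "successively s p" "p \<noteq> []" "set p \<subseteq> arcs G"
  shows "path_word G p"
  using assms by (auto simp: path_word_def Z_def elim: successively_mono)

lemma orel_arcs:
  assumes "orel p"
  shows "set p \<subseteq> arcs G"
proof -
  have "Z (butlast p)" "Z (tl p)" "p \<noteq> []" using assms by (auto simp: orel_def)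
  moreover have "set p \<subseteq> set (butlast p) \<union> set (tl p)"
    using assms by (cases p; cases "tl p") (auto simp: orel_def)
  ultimately show ?thesis using Z_arcs by blast
qed

lemma orel_path_word: "orel p \<Longrightarrow> path_word G p"
  using successively_s_path_word[OF orel_successively _ orel_arcs, of p] by (force simp: orel_def)

text \<open>The counterpart of \<open>orel\<close> that also admits length two, as needed to
  describe all of \<open>R_N\<close>. For two letters composability does not follow from the
  remaining conditions, whence the explicit \<open>path_word\<close>.\<close>

definition minimal_zero :: "'a list \<Rightarrow> bool" where
  "minimal_zero q \<longleftrightarrow> path_word G q \<and> \<not> Z q \<and> Z (butlast q) \<and> Z (tl q)"

lemma orel_iff_minimal_zero: "orel q \<longleftrightarrow> minimal_zero q \<and> length q > 2"
  using orel_path_word by (auto simp: orel_def minimal_zero_def)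

text \<open>Factors of nonzero words are nonzero and paths of length below two are never in
  \<open>I\<close>, so minimality need only be tested on the two longest proper factors. The
  subquiver \<open>H\<close> is arbitrary in order to cover both the components and, with
  \<open>H = G\<close>, the \<omega>-relations.\<close>

lemma minimal_paths_iff:
  assumes wf: "wf_digraph H" and [simp]: "tail H = tail G" "head H = head G"
    and sub: "arcs H \<subseteq> arcs G"
  shows "u \<in> minimal_paths H (I \<inter> carrier (path_algebra H)) \<longleftrightarrow>
    (\<exists>q. u = word G q \<and> set q \<subseteq> arcs H \<and> minimal_zero q)"
proof -
  interpret H: wf_digraph H by fact
  have [simp]: "word H = word G" by (intro ext) (simp add: word_def)
  have pw: "path_word H q \<longleftrightarrow> path_word G q \<and> set q \<subseteq> arcs H" for q
    using sub by (auto simp: path_word_def)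
  show ?thesis
  proof
    assume u: "u \<in> minimal_paths H (I \<inter> carrier (path_algebra H))"
    then have uI: "path_elem u \<in> I" "u \<in> qpaths H" by (auto simp: minimal_paths_def)
    then have len: "2 \<le> length (arrows u)" using length_in_I by blast
    then obtain q where q: "path_word H q" "u = word G q"
      using qpaths_cases[OF uI(2)] by (metis \<open>word H = word G\<close> list.size(3) not_numeral_le_zero snd_conv)
    have Z: "Z q'" if "q = x @ q' @ y" "q' \<noteq> []" "q' \<noteq> q" for x q' y
    proof (rule ccontr)
      assume "\<not> Z q'"
      moreover have q': "path_word H q'" using path_word_factor[of H x q' y] q that by simp
      ultimately have "path_elem (word G q') \<in> I \<inter> carrier (path_algebra H)"
        using H.word_in_qpaths[OF q'] pw by (auto simp: Z_def)
      moreover have "subpath H (word G q') u" using H.subpath_word_iff[OF q(1), of q'] that q by auto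
      ultimately have "word G q' = u" using u unfolding minimal_paths_def by blast
      then show False using q that by simp
    qed
    obtain a b q' where ab: "q = a # b # q'" using len q(2) by (cases q; cases "tl q") auto
    have "q = butlast q @ [last q]" "butlast q \<noteq> []" using ab by auto
    moreover from this have "butlast q \<noteq> q" by (metis append_self_conv not_Cons_self2)
    ultimately have "Z (tl q)" "Z (butlast q)"
      using Z[of "[a]" "b # q'" "[]"] Z[of "[]" "butlast q" "[last q]"] ab by simp_all
    then show "\<exists>q. u = word G q \<and> set q \<subseteq> arcs H \<and> minimal_zero q"
      using q uI pw by (auto simp: minimal_zero_def Z_def)
  next
    assume "\<exists>q. u = word G q \<and> set q \<subseteq> arcs H \<and> minimal_zero q"
    then obtain q where q: "u = word G q" "set q \<subseteq> arcs H" "minimal_zero q" by blast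
    then have pq: "path_word H q" "q \<noteq> []" using pw by (auto simp: minimal_zero_def path_word_def)
    have "path_elem u \<in> I" using q by (auto simp: minimal_zero_def Z_def)
    moreover have "v = u" if v: "subpath H v u" "path_elem v \<in> I" for v
    proof -
      have "2 \<le> length (arrows v)" using length_in_I v by blast
      then have "arrows v \<noteq> []" by auto
      then obtain y where y: "v = word G y" "path_word H y" using H.subpath_wordD[OF v(1)] by auto
      then have "y \<noteq> []" by (simp add: path_word_def)
      then obtain x z where q_eq: "q = x @ y @ z" using H.subpath_word_iff[OF pq(1)] v y q by auto
      have "\<not> Z y" using v y by (simp add: Z_def)
      have "x = []"
      proof (cases x)
        case (Cons b x')
        then have "Z (x' @ y @ z)" using q(3) q_eq by (simp add: minimal_zero_def)
        then show ?thesis using Z_factor \<open>y \<noteq> []\<close> \<open>\<not> Z y\<close> by blast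
      qed
      moreover have "z = []"
      proof (cases z rule: rev_cases)
        case (snoc z' b)
        then have "Z (x @ y @ z')" using q(3) q_eq by (simp add: minimal_zero_def butlast_append)
        then show ?thesis using Z_factor \<open>y \<noteq> []\<close> \<open>\<not> Z y\<close> by blast
      qed
      ultimately show ?thesis using q_eq y q by simp
    qed
    ultimately show "u \<in> minimal_paths H (I \<inter> carrier (path_algebra H))"
      using H.word_in_qpaths[OF pq(1)] q(1) by (auto simp: minimal_paths_def)
  qed
qed

lemma omega_relation_iff: "omega_relation G I r \<longleftrightarrow> (\<exists>p. r = word G p \<and> orel p)"
proof -
  have "I \<inter> carrier (path_algebra G) = I" using keys_in by auto
  then have "r \<in> minimal_paths G I \<longleftrightarrow> (\<exists>q. r = word G q \<and> set q \<subseteq> arcs G \<and> minimal_zero q)"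
    using minimal_paths_iff[OF wf_digraph_axioms] by simp
  moreover have "omega_relation G I r \<longleftrightarrow> r \<in> minimal_paths G I \<and> length (arrows r) > 2"
    by (auto simp: omega_relation_def minimal_paths_def)
  ultimately show ?thesis using orel_iff_minimal_zero orel_arcs by auto
qed

section \<open>Maximal paths as cosets of maximal words\<close>

lemma coset_eq_imp_diff_in:
  assumes "I +>\<^bsub>path_algebra G\<^esub> x = I +>\<^bsub>path_algebra G\<^esub> y"
  shows "x - y \<in> I"
proof -
  have coset: "I +>\<^bsub>path_algebra G\<^esub> z = {h + z | h. h \<in> I}" for z
    by (auto simp: a_r_coset_def r_coset_def)
  have "x \<in> I +>\<^bsub>path_algebra G\<^esub> x" unfolding coset using zero_in by force
  then have "x \<in> I +>\<^bsub>path_algebra G\<^esub> y" by (simp only: assms)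
  then have "x \<in> {h + y | h. h \<in> I}" by (simp only: coset)
  then obtain h where "x = h + y" "h \<in> I" by blast
  then show ?thesis by simp
qed

lemma max_word_in_maximal_paths:
  assumes "max_word p"
  shows "I +>\<^bsub>path_algebra G\<^esub> path_elem (word G p) \<in> maximal_paths G I"
proof -
  have p: "path_word G p" "path_elem (word G p) \<notin> I" using assms by (auto simp: max_word_def Z_def)
  have "path_mult G (path_elem (word G [a])) (path_elem (word G p)) \<in> I"
    "path_mult G (path_elem (word G p)) (path_elem (word G [a])) \<in> I" if "a \<in> arcs G" for a
    using path_mult_word_in_iff[of "[a]" p] path_mult_word_in_iff[of p "[a]"] that p assms
    by (auto simp: max_word_def)
  then show ?thesis using p word_in_qpaths[OF p(1)]
    by (simp add: maximal_paths_def arrow_path_eq_word del: split_paired_Ex) blast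
qed

text \<open>The representative \<open>w\<close> through \<open>a\<close> need not be the path
  \<open>n\<close> that witnesses maximality of the coset. Since \<open>w\<close> and
  \<open>n\<close> differ by the element \<open>d\<close> of \<open>I\<close>, nonvanishing and the
  vanishing of products with arrows pass from \<open>n\<close> to \<open>w\<close>.\<close>

lemma maximal_path_representative:
  assumes "M \<in> maximal_paths G I" "w \<in> qpaths G" "I +>\<^bsub>path_algebra G\<^esub> path_elem w = M"
    "subpath G (arrow_path G a) w" "a \<in> arcs G"
  obtains p where "w = word G p" "max_word p" "a \<in> set p"
proof -
  obtain n where n: "M = I +>\<^bsub>path_algebra G\<^esub> path_elem n" "n \<in> qpaths G" "path_elem n \<notin> I"
    "\<And>a. a \<in> arcs G \<Longrightarrow> path_mult G (path_elem (word G [a])) (path_elem n) \<in> I"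
    "\<And>a. a \<in> arcs G \<Longrightarrow> path_mult G (path_elem n) (path_elem (word G [a])) \<in> I"
    using assms(1) by (auto simp: maximal_paths_def arrow_path_eq_word)
  define d :: "_ \<Rightarrow>\<^sub>0 'k" where "d = path_elem w - path_elem n"
  have d: "d \<in> I" using coset_eq_imp_diff_in assms(3) n(1) by (simp add: d_def)
  have w_eq: "path_elem w = d + path_elem n" by (simp add: d_def)
  have "length (arrows (arrow_path G a)) \<le> length (arrows w)" using subpath_length assms(4) by blast
  then have "arrows w \<noteq> []" by (auto simp: arrow_path_def)
  then obtain p where p: "w = word G p" "path_word G p"
    using qpaths_cases[OF assms(2)] by (metis snd_conv)
  have "path_elem w \<notin> I"
  proof
    assume "path_elem w \<in> I"
    then have "path_elem w - d \<in> I" using d diff_in by blast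
    then show False using n(3) by (simp add: w_eq)
  qed
  then have "Z p" using p by (simp add: Z_def)
  have "\<not> Z (b # p)" "\<not> Z (p @ [b])" for b
  proof -
    have "\<not> Z (b # p) \<and> \<not> Z (p @ [b])"
    proof (cases "b \<in> arcs G")
      case True
      then have keys: "Poly_Mapping.keys (path_elem (word G [b]) :: _ \<Rightarrow>\<^sub>0 'k) \<subseteq> qpaths G"
        by (auto intro: word_in_qpaths)
      have "path_mult G (path_elem (word G [b])) (path_elem w) \<in> I"
        "path_mult G (path_elem w) (path_elem (word G [b])) \<in> I"
        unfolding w_eq path_mult_add_left path_mult_add_right
        using n(4,5)[OF True] mult_left_in[OF d keys] mult_right_in[OF d keys] add_in by blast+
      then show ?thesis
        using path_mult_word_in_iff[of "[b]" p] path_mult_word_in_iff[of p "[b]"] True p by simp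
    next
      case False
      then show ?thesis using Z_arcs[of "b # p"] Z_arcs[of "p @ [b]"] by auto
    qed
    then show "\<not> Z (b # p)" "\<not> Z (p @ [b])" by auto
  qed
  then have "max_word p" using \<open>Z p\<close> by (simp add: max_word_def)
  moreover have "a \<in> set p" using assms(4) p subpath_word_iff[OF p(2), of "[a]"]
    by (auto simp: arrow_path_eq_word)
  ultimately show ?thesis using that p by blast
qed

end

section \<open>Components of the ramifications graph\<close>

text \<open>Adjacency in \<open>p\<close> taken as the relation itself. Facts that depend on where a
  pair sits in \<open>p\<close> thereby become available to monotonicity and closure
  arguments.\<close>

lemma successively_consecutive: "successively (\<lambda>x z. \<exists>u v. p = u @ [x, z] @ v) p"
proof -
  have "p = take i p @ [p ! i, p ! Suc i] @ drop (Suc (Suc i)) p" if "Suc i < length p" for i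
    using that by (simp add: Cons_nth_drop_Suc)
  then show ?thesis unfolding successively_conv_nth by blast
qed

lemma successively_concat:
  assumes "\<And>xs. xs \<in> set xss \<Longrightarrow> xs \<noteq> [] \<and> successively P xs"
    and "successively (\<lambda>xs ys. P (last xs) (hd ys)) xss"
  shows "successively P (concat xss)"
  using assms
proof (induction xss)
  case (Cons xs xss)
  show ?case
  proof (cases xss)
    case (Cons ys yss)
    then show ?thesis using Cons.prems Cons.IH by (auto simp: successively_append_iff)
  qed (use Cons.prems in simp)
qed simp

text \<open>The square \<open>V @ V\<close> already shows every pair that is adjacent in some power:
  those inside \<open>V\<close> and the closing pair.\<close>

lemma successively_concat_replicate:
  assumes "successively P (V @ V)"
  shows "successively P (concat (replicate n V))"
proof (cases "V = []")
  case False
  have "successively P V" "P (last V) (hd V)"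
    using assms False by (auto simp: successively_append_iff)
  then have "successively (\<lambda>xs ys. P (last xs) (hd ys)) (replicate n V)"
    by (auto simp: successively_conv_nth)
  then show ?thesis using \<open>successively P V\<close> False by (intro successively_concat) auto
qed (simp add: concat_replicate_trivial)

lemma wf_digraph_subquiver: "wf_digraph (subquiver Q c N)"
  by unfold_locales (auto simp: subquiver_def Let_def)

lemma subquiver_simps [simp]:
  "arcs (subquiver Q c N) = {a \<in> arcs Q. omega_path Q c a \<in> verts N}"
  "tail (subquiver Q c N) = tail Q" "head (subquiver Q c N) = head Q"
  by (auto simp: subquiver_def Let_def)

lemma ex1_image_iff:
  assumes "\<And>x y. Q x \<Longrightarrow> Q y \<Longrightarrow> f x = f y \<Longrightarrow> x = y"
  shows "(\<exists>!z. \<exists>x. Q x \<and> z = f x) \<longleftrightarrow> (\<exists>!x. Q x)"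
  using assms by metis

context multiserial_quiver
begin

abbreviation H :: "('v, 'a) ram_graph" where "H \<equiv> ramifications_graph G I c"

lemma H_simps [simp]: "verts H = omega_path G c ` arcs G" "tail H = fst" "head H = snd"
  by (auto simp: ramifications_graph_def)

text \<open>A nonzero product of the two arrows already forces the end of one path to be the start
  of the other, so \<open>s\<close> alone expresses the vertex condition as well.\<close>

lemma in_arcs_H_iff:
  "(x, y) \<in> arcs H \<longleftrightarrow> x \<in> verts H \<and> y \<in> verts H \<and> x \<noteq> y \<and> s (last (arrows x)) (hd (arrows y))"
proof (cases "x \<in> verts H \<and> y \<in> verts H")
  case True
  then obtain a b where ab: "a \<in> arcs G" "b \<in> arcs G" "x = omega_path G c a" "y = omega_path G c b"
    by auto
  have x: "x = word G (arrows x)" "path_word G (arrows x)" and y: "y = word G (arrows y)" "path_word G (arrows y)"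
    using omega_path_eq_word[OF ab(1)] omega_path_eq_word[OF ab(2)] ab by auto
  then have arcs: "last (arrows x) \<in> arcs G" "hd (arrows y) \<in> arcs G" "arrows x \<noteq> []"
    by (auto simp: path_word_def)
  have "qtgt G x = qsrc y" if "s (last (arrows x)) (hd (arrows y))"
  proof -
    have "head G (last (arrows x)) = tail G (hd (arrows y))" using s_path_word[OF that] by (simp add: path_word_def)
    moreover have "qsrc y = tail G (hd (arrows y))" using y(1) by (metis qsrc_word)
    ultimately show ?thesis using arcs(3) by (simp add: qtgt_simps)
  qed
  moreover have "path_mult G (path_elem (word G [last (arrows x)])) (path_elem (word G [hd (arrows y)])) \<notin> I
      \<longleftrightarrow> s (last (arrows x)) (hd (arrows y))"
    using path_mult_word_in_iff[of "[last (arrows x)]" "[hd (arrows y)]"] arcs by simp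
  ultimately show ?thesis using True by (auto simp: ramifications_graph_def arrow_path_eq_word)
qed (auto simp: ramifications_graph_def)

lemma wf_H: "wf_digraph H"
  by unfold_locales (auto simp: ramifications_graph_def)

lemma verts_HD:
  assumes "x \<in> verts H"
  shows "x = word G (arrows x)" "path_word G (arrows x)" "distinct (arrows x)"
    "b \<in> set (arrows x) \<Longrightarrow> b \<in> arcs G" "b \<in> set (arrows x) \<Longrightarrow> omega_path G c b = x"
proof -
  obtain a where a: "a \<in> arcs G" "x = omega_path G c a" using assms by auto
  show "x = word G (arrows x)" "path_word G (arrows x)" "distinct (arrows x)"
    using omega_path_eq_word[OF a(1)] a(2) by auto
  then show "b \<in> set (arrows x) \<Longrightarrow> b \<in> arcs G" by (auto simp: path_word_def)
  show "b \<in> set (arrows x) \<Longrightarrow> omega_path G c b = x" using omega_path_eqI[OF a(1)] a(2) by simp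
qed

definition comp :: "'a \<Rightarrow> ('v, 'a) ram_graph" where
  "comp a = weak_component H (omega_path G c a)"

lemma comp_in_components: "a \<in> arcs G \<Longrightarrow> comp a \<in> components G I c"
  using wf_digraph.max_subgraph_weak_component[OF wf_H] by (simp add: components_def comp_def)

lemma component_eq_comp:
  assumes "N \<in> components G I c" "omega_path G c a \<in> verts N"
  shows "N = comp a"
  using assms wf_digraph.max_subgraph_eq_weak_component[OF wf_H] by (auto simp: components_def comp_def)

abbreviation A :: "('v, 'a) ram_graph \<Rightarrow> 'a set" where "A N \<equiv> arcs (subquiver G c N)"

lemma component_props:
  assumes "N \<in> components G I c"
  shows "verts N \<subseteq> verts H" "arcs N = {e \<in> arcs H. fst e \<in> verts N}" "tail N = fst" "head N = snd"
    "wf_digraph N" "Digraph_Component.connected N"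
    "e \<in> arcs H \<Longrightarrow> fst e \<in> verts N \<longleftrightarrow> snd e \<in> verts N"
proof -
  interpret H: wf_digraph H by (rule wf_H)
  have max: "H.max_subgraph Digraph_Component.connected N" using assms by (simp add: components_def)
  then have sub: "subgraph N H" and conn: "Digraph_Component.connected N"
    by (auto simp: H.max_subgraph_def)
  obtain x where "x \<in> verts N" using conn by (auto simp: connected_conv)
  then have N: "N = weak_component H x" using H.max_subgraph_eq_weak_component max by blast
  show "verts N \<subseteq> verts H" "wf_digraph N" "Digraph_Component.connected N"
    using sub conn by (auto simp: subgraph_def)
  show "tail N = fst" "head N = snd" by (simp_all add: N)
  show "arcs N = {e \<in> arcs H. fst e \<in> verts N}" using H.arcs_weak_component[of x] by (simp add: N)
  show "e \<in> arcs H \<Longrightarrow> fst e \<in> verts N \<longleftrightarrow> snd e \<in> verts N"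
    using H.weak_component_closed[of e x] by (simp add: N)
qed

text \<open>A nonzero pair either sits inside one path \<open>\<omega>\<^sub>a\<close> or joins the
  end of one to the start of another; in the latter case the two paths coincide or are linked by an
  edge of the graph.\<close>

lemma component_s_closed:
  assumes N: "N \<in> components G I c" and s: "s x y"
  shows "x \<in> A N \<longleftrightarrow> y \<in> A N"
proof -
  have arcs: "x \<in> arcs G" "y \<in> arcs G" using s Z_arcs by fastforce+
  have "omega_path G c x \<in> verts N \<longleftrightarrow> omega_path G c y \<in> verts N"
    using path_word_omega_cases[OF s_path_word[OF s]]
  proof
    assume "\<exists>u v. W x = u @ [x, y] @ v"
    then have "y \<in> set (W x)" by force
    then show ?thesis using omega_path_eqI[OF arcs(1)] by simp
  next
    assume *: "x = last (W x) \<and> y = hd (W y)"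
    show ?thesis
    proof (cases "omega_path G c x = omega_path G c y")
      case False
      then have "(omega_path G c x, omega_path G c y) \<in> arcs H"
        using * s arcs by (simp add: in_arcs_H_iff)
      then show ?thesis using component_props(7)[OF N] by fastforce
    qed simp
  qed
  then show ?thesis using arcs by simp
qed

lemma successively_in_component:
  assumes "N \<in> components G I c" "successively s p" "x \<in> set p" "x \<in> A N"
  shows "set p \<subseteq> A N"
  by (rule successively_set_subset[OF assms(2-4)]) (use component_s_closed[OF assms(1)] in blast)+

lemma in_A_comp: "a \<in> arcs G \<Longrightarrow> a \<in> A (comp a)"
  using wf_digraph.in_verts_weak_component[OF wf_H] by (simp add: comp_def)

lemma A_eq_comp: "N \<in> components G I c \<Longrightarrow> a \<in> A N \<Longrightarrow> N = comp a"
  using component_eq_comp by simp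

lemma path_word_subquiver: "path_word (subquiver G c N) p \<longleftrightarrow> path_word G p \<and> set p \<subseteq> A N"
  by (auto simp: path_word_def)

lemma word_subquiver: "word (subquiver G c N) = word G"
  by (intro ext) (simp add: word_def)

lemma word_in_subquiver_iff:
  "path_word G p \<Longrightarrow> word G p \<in> qpaths (subquiver G c N) \<longleftrightarrow> set p \<subseteq> A N"
  using wf_digraph.word_in_qpaths_iff[OF wf_digraph_subquiver, of p G c N] 
  by (auto simp: path_word_subquiver word_subquiver path_word_def simp del: subquiver_simps(1))

text \<open>A chain of \<open>s\<close> never leaves a component, and a component is determined by
  any of its arrows. So the component of the first arrow is the only candidate.\<close>

lemma relation_component_eq:
  assumes "orel p"
  shows "relation_component G I c (word G p) \<in> components G I c"
    "set p \<subseteq> A (relation_component G I c (word G p))"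
proof -
  have p: "path_word G p" "p \<noteq> []" "successively s p" "set p \<subseteq> arcs G"
    using orel_path_word orel_arcs orel_successively assms by (auto simp: path_word_def)
  let ?N = "comp (hd p)"
  have hd: "hd p \<in> arcs G" using p by auto
  have N: "?N \<in> components G I c" "set p \<subseteq> A ?N"
    using comp_in_components[OF hd]
      successively_in_component[OF comp_in_components[OF hd] p(3) hd_in_set[OF p(2)] in_A_comp[OF hd]]
    by blast+
  have "relation_component G I c (word G p) = ?N"
    unfolding relation_component_def
  proof (rule the_equality)
    show "?N \<in> components G I c \<and> word G p \<in> qpaths (subquiver G c ?N)"
      using N word_in_subquiver_iff[OF p(1)] by blast
    fix N assume "N \<in> components G I c \<and> word G p \<in> qpaths (subquiver G c N)"
    then have "N \<in> components G I c" "hd p \<in> A N"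
      using word_in_subquiver_iff[OF p(1)] hd_in_set[OF p(2)] by blast+
    then show "N = ?N" by (rule A_eq_comp)
  qed
  then show "relation_component G I c (word G p) \<in> components G I c"
    "set p \<subseteq> A (relation_component G I c (word G p))" using N by auto
qed

lemma fin_digraph_subquiver: "fin_digraph (subquiver G c N)"
proof -
  interpret S: wf_digraph "subquiver G c N" by (rule wf_digraph_subquiver)
  show ?thesis by unfold_locales (auto simp: subquiver_def Let_def)
qed

lemma zero_relations_iff:
  assumes "N \<in> components G I c"
  shows "u \<in> zero_relations G I c N \<longleftrightarrow> (\<exists>q. u = word G q \<and> set q \<subseteq> A N \<and> minimal_zero q)"
proof -
  interpret S: fin_digraph "subquiver G c N" by (rule fin_digraph_subquiver)
  obtain R where R: "generated_by_paths (subquiver G c N) (local_ideal G I c N) R"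
    using local_mono assms by (auto simp: locally_monomial_def)
  have "zero_relations G I c N = minimal_paths (subquiver G c N) (local_ideal G I c N)"
    unfolding zero_relations_def by (rule S.the_minimal_generators[OF R])
  then show ?thesis
    unfolding local_ideal_def using minimal_paths_iff[OF wf_digraph_subquiver, of G c N u] by auto
qed

text \<open>The common arrow places both words in one component. Equal cosets would put their
  difference into its local ideal, and monomiality would then put \<open>p\<close> there. Without a
  common arrow the conclusion can fail, as for the two sides of a commutative square.\<close>

lemma coset_max_word_inject:
  assumes "max_word p" "max_word q" "a \<in> set p" "a \<in> set q"
    and eq: "I +>\<^bsub>path_algebra G\<^esub> path_elem (word G p) = I +>\<^bsub>path_algebra G\<^esub> path_elem (word G q)"
  shows "p = q"
proof (rule ccontr)
  assume "p \<noteq> q"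
  have Zpq: "Z p" "Z q" using assms by (auto simp: max_word_def)
  then have pq: "path_word G p" "path_word G q" by (auto simp: Z_def)
  have a: "a \<in> arcs G" using Z_arcs[OF Zpq(1)] assms(3) by blast
  let ?N = "comp a"
  interpret S: fin_digraph "subquiver G c ?N" by (rule fin_digraph_subquiver)
  have "set p \<subseteq> A ?N" "set q \<subseteq> A ?N"
    using successively_in_component[OF comp_in_components[OF a] Z_successively _ in_A_comp[OF a]]
      Zpq assms(3,4) by blast+
  then have sub: "word G p \<in> qpaths (subquiver G c ?N)" "word G q \<in> qpaths (subquiver G c ?N)"
    using word_in_subquiver_iff pq by blast+
  define d :: "_ \<Rightarrow>\<^sub>0 'k" where "d = path_elem (word G p) - path_elem (word G q)"
  have "Poly_Mapping.keys d \<subseteq> {word G p, word G q}"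
    by (auto simp: d_def in_keys_iff lookup_minus lookup_single when_def split: if_splits)
  then have "d \<in> local_ideal G I c ?N"
    using coset_eq_imp_diff_in[OF eq] sub by (auto simp: local_ideal_def d_def)
  moreover have "word G p \<in> Poly_Mapping.keys d"
    using \<open>p \<noteq> q\<close> by (simp add: d_def in_keys_iff lookup_minus lookup_single when_def)
  moreover obtain R where "generated_by_paths (subquiver G c ?N) (local_ideal G I c ?N) R"
    using local_mono comp_in_components[OF a] by (auto simp: locally_monomial_def)
  ultimately have "path_elem (word G p) \<in> local_ideal G I c ?N"
    using S.generated_by_paths_keys by blast
  then show False using Zpq(1) by (simp add: local_ideal_def Z_def)
qed

text \<open>The maximal paths with a representative through \<open>a\<close> are exactly the cosets
  of maximal words through \<open>a\<close>, and on these words passing to cosets is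
  injective.\<close>

lemma UMP_iff_unique_max: "UMP_algebra G I \<longleftrightarrow> unique_max"
proof -
  have "(\<exists>!M. M \<in> maximal_paths G I \<and>
        (\<exists>w\<in>qpaths G. I +>\<^bsub>path_algebra G\<^esub> path_elem w = M \<and> subpath G (arrow_path G a) w))
    \<longleftrightarrow> (\<exists>!w. max_word w \<and> a \<in> set w)" if a: "a \<in> arcs G" for a
  proof -
    let ?coset = "\<lambda>p. I +>\<^bsub>path_algebra G\<^esub> path_elem (word G p)"
    let ?P = "\<lambda>M. M \<in> maximal_paths G I \<and>
        (\<exists>w\<in>qpaths G. I +>\<^bsub>path_algebra G\<^esub> path_elem w = M \<and> subpath G (arrow_path G a) w)"
    have P: "?P M \<longleftrightarrow> (\<exists>p. max_word p \<and> a \<in> set p \<and> M = ?coset p)" for M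
    proof
      assume M: "?P M"
      then obtain w where "w \<in> qpaths G" "I +>\<^bsub>path_algebra G\<^esub> path_elem w = M"
        "subpath G (arrow_path G a) w" by blast
      then show "\<exists>p. max_word p \<and> a \<in> set p \<and> M = ?coset p"
        using maximal_path_representative[of M w a] M a by metis
    next
      assume "\<exists>p. max_word p \<and> a \<in> set p \<and> M = ?coset p"
      then obtain p where p: "max_word p" "a \<in> set p" "M = ?coset p" by blast
      then have pw: "path_word G p" by (simp add: max_word_def Z_def)
      obtain u v where "p = u @ [a] @ v" using p(2) by (auto dest: split_list)
      then have "subpath G (arrow_path G a) (word G p)"
        using subpath_word_iff[OF pw, of "[a]"] by (auto simp: arrow_path_eq_word)
      then show "?P M" using max_word_in_maximal_paths[OF p(1)] word_in_qpaths[OF pw] p(3) by blast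
    qed
    have "(\<exists>!M. \<exists>p. (max_word p \<and> a \<in> set p) \<and> M = ?coset p) \<longleftrightarrow> (\<exists>!p. max_word p \<and> a \<in> set p)"
      by (rule ex1_image_iff) (use coset_max_word_inject in blast)
    then show ?thesis unfolding P conj_assoc .
  qed
  then show ?thesis unfolding UMP_algebra_def unique_max_def Z_arc by (simp add: Ball_def)
qed

text \<open>Steps from one \<open>\<omega>\<^sub>a\<close> to the next are nonzero, being edges of
  the graph, but steps inside may be zero. Hence the clause on a general \<open>P\<close>: the inner
  steps are left to the caller. It is applied to composability here, and to \<open>s\<close> once an
  orbit is known to contain the component.\<close>

lemma component_path:
  assumes N: "N \<in> components G I c" and om: "omega_choice G I c om"
  obtains V where "om N = word G V" "set V = A N" "distinct V"
    "\<And>P. (\<And>x z. x \<in> A N \<Longrightarrow> s x z \<Longrightarrow> P x z)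
       \<Longrightarrow> (\<And>x. x \<in> verts N \<Longrightarrow> successively P (arrows x)) \<Longrightarrow> successively P V"
    "path_word G V"
proof -
  note props = component_props[OF N]
  have fin: "finite (verts N)" using props(1) by (rule finite_subset) simp
  have arcsN: "x \<in> verts H" "y \<in> verts H" "s (last (arrows x)) (hd (arrows y))" "x \<in> verts N" "y \<in> verts N"
    if "(x, y) \<in> arcs N" for x y
    using that props(2) props(7)[of "(x, y)"] in_arcs_H_iff[of x y] by auto
  have hd_last: "omega_path G c (hd (arrows x)) = x" "omega_path G c (last (arrows x)) = x"
    if "x \<in> verts H" for x
    using verts_HD[OF that] by (auto simp: path_word_def)
  have "\<exists>ws. component_chain N ws \<or> component_cycle N ws"
  proof (rule chain_or_cycle[OF props(5,6) fin props(3,4)])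
    show "y = z" if "(x, y) \<in> arcs N" "(x, z) \<in> arcs N" for x y z
      using arcsN[OF that(1)] arcsN[OF that(2)] Z_right_unique hd_last by metis
    show "y = z" if "(y, x) \<in> arcs N" "(z, x) \<in> arcs N" for x y z
      using arcsN[OF that(1)] arcsN[OF that(2)] Z_left_unique hd_last by metis
  qed
  then have "component_paths N \<noteq> {}" unfolding component_paths_def by blast
  then have "om N \<in> component_paths N" using om N by (auto simp: omega_choice_def)
  then obtain ws where ws: "om N = concat_paths ws" "component_chain N ws \<or> component_cycle N ws"
    by (auto simp: component_paths_def)
  then have ws': "ws \<noteq> []" "distinct ws" "verts N = set ws"
    by (auto simp: component_chain_def component_cycle_def)
  have edge: "(ws ! i, ws ! Suc i) \<in> arcs N" if "Suc i < length ws" for i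
    using ws(2)
  proof
    assume "component_cycle N ws"
    then have "(ws ! i, ws ! (Suc i mod length ws)) \<in> arcs N"
      using that by (auto simp: component_cycle_def)
    then show ?thesis using that by simp
  qed (use that in \<open>auto simp: component_chain_def\<close>)
  let ?V = "concat (map arrows ws)"
  have inH: "x \<in> verts H" if "x \<in> set ws" for x using that ws'(3) props(1) by blast
  have ne: "arrows x \<noteq> []" if "x \<in> set ws" for x
    using verts_HD(2)[OF inH[OF that]] by (simp add: path_word_def)
  have "om N = word G ?V"
  proof -
    obtain x xs where x: "ws = x # xs" using ws'(1) by (cases ws) auto
    then have "qsrc x = tail G (hd (arrows x))" "arrows x \<noteq> []"
      using verts_HD(1)[OF inH, of x] ne by (auto, metis qsrc_word)
    then show ?thesis by (simp add: ws(1) concat_paths_def word_def x)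
  qed
  moreover have "set ?V = A N"
  proof -
    have "b \<in> A N" if "b \<in> set (arrows x)" "x \<in> set ws" for b x
      using verts_HD(4,5)[OF inH[OF that(2)] that(1)] that ws'(3) by simp
    moreover have "\<exists>x\<in>set ws. b \<in> set (arrows x)" if "b \<in> A N" for b
      using that omega_path_eq_word(3)[of b] ws'(3) by auto
    ultimately show ?thesis by auto
  qed
  moreover have "distinct ?V"
  proof (rule distinct_concat)
    show "distinct (map arrows ws)"
      unfolding distinct_map using ws'(2) verts_HD(1)[OF inH] by (metis inj_onI)
    show "distinct p" if "p \<in> set (map arrows ws)" for p using that verts_HD(3)[OF inH] by auto
    show "set p \<inter> set q = {}" if "p \<in> set (map arrows ws)" "q \<in> set (map arrows ws)" "p \<noteq> q" for p q
    proof -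
      from that obtain x y where xy: "x \<in> set ws" "y \<in> set ws" "p = arrows x" "q = arrows y" by auto
      have "x = y" if "b \<in> set p" "b \<in> set q" for b
        using verts_HD(5)[OF inH[OF xy(1)]] verts_HD(5)[OF inH[OF xy(2)]] that xy by blast
      then show ?thesis using that(3) xy by blast
    qed
  qed
  moreover have succ: "successively P ?V"
    if P_step: "\<And>x z. x \<in> A N \<Longrightarrow> s x z \<Longrightarrow> P x z"
      and P_in: "\<And>x. x \<in> verts N \<Longrightarrow> successively P (arrows x)" for P
  proof (rule successively_concat)
    show "p \<noteq> [] \<and> successively P p" if "p \<in> set (map arrows ws)" for p
      using that ne P_in ws'(3) by auto
    have "P (last (arrows (ws ! i))) (hd (arrows (ws ! Suc i)))" if i: "Suc i < length ws" for i
    proof -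
      have e: "(ws ! i, ws ! Suc i) \<in> arcs N" by (rule edge[OF i])
      have "ws ! i \<in> set ws" using i by simp
      moreover from this have "last (arrows (ws ! i)) \<in> set (arrows (ws ! i))" using ne by simp
      ultimately have "last (arrows (ws ! i)) \<in> set ?V" by auto
      then have "last (arrows (ws ! i)) \<in> A N" using \<open>set ?V = A N\<close> by blast
      then show ?thesis using P_step arcsN(3)[OF e] by blast
    qed
    then show "successively (\<lambda>xs ys. P (last xs) (hd ys)) (map arrows ws)"
      by (simp add: successively_map successively_conv_nth)
  qed
  moreover have "path_word G ?V"
  proof -
    have "?V \<noteq> []" using ws'(1) ne by (cases ws) auto
    moreover have "set ?V \<subseteq> arcs G" using \<open>set ?V = A N\<close> by auto
    moreover have "successively (\<lambda>x y. head G x = tail G y) ?V"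
    proof (rule succ)
      show "head G x = tail G z" if "s x z" for x z using s_path_word[OF that] by (simp add: path_word_def)
      show "successively (\<lambda>x y. head G x = tail G y) (arrows x)" if "x \<in> verts N" for x
        using verts_HD(2)[of x] that props(1) by (auto simp: path_word_def)
    qed
    ultimately show ?thesis by (simp add: path_word_def)
  qed
  ultimately show ?thesis by (rule that)
qed

section \<open>Powers of \<open>\<omega>(N)\<close>\<close>

lemma path_power_word:
  assumes "V \<noteq> []" "n \<ge> 1"
  shows "path_power (word G V) n = word G (concat (replicate n V))"
proof -
  obtain k where "n = Suc k" using assms(2) by (cases n) auto
  then show ?thesis using assms(1) by (simp add: path_power_def concat_paths_def word_def)
qed

lemma path_word_power:
  assumes "path_word G V" "head G (last V) = tail G (hd V)" "n \<ge> 1"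
  shows "path_word G (concat (replicate n V))"
proof -
  have "path_word G (V @ V)" using assms(1,2) path_word_append_iff[of V V G] by (simp add: path_word_def)
  then have "successively (\<lambda>x y. head G x = tail G y) (concat (replicate n V))"
    by (intro successively_concat_replicate) (simp add: path_word_def)
  then show ?thesis using assms(1,3) by (auto simp: path_word_def)
qed

lemma factor_of_power:
  assumes V: "successively s (V @ V)" and p: "successively s p" "p \<noteq> []" "hd p \<in> set V"
  shows "\<exists>n\<ge>1. \<exists>u w. concat (replicate n V) = u @ p @ w"
proof -
  obtain u v where uv: "V = u @ hd p # v" using p(3) by (auto dest: split_list)
  \<comment> \<open>As \<open>V\<close> is nonempty, \<open>length p\<close> copies of it have at
    least \<open>length p\<close> letters. One further copy in front provides the occurrence of
    \<open>hd p\<close> at which the comparison starts.\<close>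
  let ?V = "concat (replicate (length p) V)"
  have "length p \<le> length p * length V" using uv by (cases "length V") auto
  moreover have "length ((hd p # v) @ ?V) = Suc (length v) + length p * length V"
    by (simp add: length_concat sum_list_replicate)
  ultimately have len: "length p \<le> length ((hd p # v) @ ?V)" by linarith
  have V_eq: "concat (replicate (Suc (length p)) V) = u @ (hd p # v) @ ?V" using uv by simp
  have "successively s (u @ (hd p # v) @ ?V)"
    using successively_concat_replicate[OF V, of "Suc (length p)"] unfolding V_eq .
  then have "successively s ((hd p # v) @ ?V)" unfolding successively_append_iff[of s u] by simp
  then have "(hd p # v) @ ?V = p @ drop (length p) ((hd p # v) @ ?V)"
    using len p by (intro successively_right_unique[OF right_unique_s p(1)]) simp_all
  then have "concat (replicate (Suc (length p)) V) = u @ p @ drop (length p) ((hd p # v) @ ?V)"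
    using V_eq by metis
  then show ?thesis by (intro exI[of _ "Suc (length p)"]) auto
qed

lemma subpath_power_iff:
  assumes "path_word G V" "head G (last V) = tail G (hd V)" "q \<noteq> []"
  shows "(\<exists>n\<ge>1. subpath G (word G q) (path_power (word G V) n)) \<longleftrightarrow>
    (\<exists>n\<ge>1. \<exists>u w. concat (replicate n V) = u @ q @ w)"
proof -
  have "V \<noteq> []" using assms(1) by (simp add: path_word_def)
  have "subpath G (word G q) (path_power (word G V) n) \<longleftrightarrow> (\<exists>u w. concat (replicate n V) = u @ q @ w)"
    if "n \<ge> 1" for n
    unfolding path_power_word[OF \<open>V \<noteq> []\<close> that]
    by (rule subpath_word_iff[OF path_word_power[OF assms(1,2) that] assms(3)])
  then show ?thesis by blast
qed

text \<open>Let \<open>x\<close>, \<open>z\<close> be adjacent in \<open>W a\<close> with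
  \<open>x\<close> in \<open>C\<close>, and let \<open>y\<close> be the successor of
  \<open>x\<close>. Were \<open>x\<close> last in its path, it would occur twice in
  \<open>W a\<close>; so \<open>y\<close> follows \<open>x\<close> in that path and equals
  \<open>z\<close>. Thus \<open>C\<close> propagates along \<open>W a\<close>, and every inner pair
  of \<open>W a\<close> is nonzero.\<close>

lemma omega_word_subset_closed:
  assumes C: "\<And>x. x \<in> C \<Longrightarrow> \<exists>y\<in>C. s x y" "\<And>x. x \<in> C \<Longrightarrow> \<exists>y\<in>C. s y x"
    and a: "a \<in> C"
  shows "set (W a) \<subseteq> C" "successively s (W a)"
proof -
  have arcs: "x \<in> arcs G" if "x \<in> C" for x using C(1)[OF that] Z_arcs by fastforce
  let ?R = "\<lambda>x z. \<exists>u v. W a = u @ [x, z] @ v"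
  have dist: "distinct (W a)" by (rule omega_path_eq_word(4)[OF arcs[OF a]])
  have W_eq: "W x = W a" if "x \<in> set (W a)" for x using omega_path_eqI[OF arcs[OF a] that] by simp
  have succ: "y = z" if "?R x z" "s x y" for x y z
  proof -
    obtain u v where uv: "W a = u @ [x, z] @ v" using \<open>?R x z\<close> by blast
    have "x \<in> set (W a)" by (simp add: uv)
    then have Wx: "W x = u @ [x, z] @ v" using W_eq uv by simp
    show "y = z"
      using path_word_omega_cases[OF s_path_word[OF \<open>s x y\<close>]]
    proof
      assume "\<exists>u v. W x = u @ [x, y] @ v"
      then obtain u' v' where "u @ x # z # v = u' @ x # y # v'" using Wx by auto
      moreover have "distinct (u @ x # z # v)" using dist uv by simp
      ultimately have "z # v = y # v'"
        by (subst (asm) append_Cons_eq_iff) auto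
      then show ?thesis by simp
    next
      assume "x = last (W x) \<and> y = hd (W y)"
      then have "x = last (z # v)" using Wx by auto
      then have "x \<in> set (z # v)" by (metis last_in_set list.discI)
      then show ?thesis using dist uv by auto
    qed
  qed
  have pred: "x = y" if "?R x z" "s y z" for x y z
  proof -
    obtain u v where uv: "W a = u @ [x, z] @ v" using \<open>?R x z\<close> by blast
    have "z \<in> set (W a)" by (simp add: uv)
    then have Wz: "W z = u @ [x, z] @ v" using W_eq uv by simp
    show "x = y"
      using path_word_omega_cases[OF s_path_word[OF \<open>s y z\<close>]]
    proof
      assume "\<exists>u v. W y = u @ [y, z] @ v"
      then obtain u' v' where Wy: "W y = u' @ [y, z] @ v'" by blast
      moreover have "y \<in> arcs G" using Z_arcs[OF \<open>s y z\<close>] by simp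
      ultimately have "W z = W y" using omega_path_eqI[of y z] by simp
      then have "(u @ [x]) @ z # v = (u' @ [y]) @ z # v'" using Wz Wy by simp
      moreover have "distinct ((u @ [x]) @ z # v)" using dist uv by simp
      ultimately have "u @ [x] = u' @ [y]" by (subst (asm) append_Cons_eq_iff) auto
      then show ?thesis by simp
    next
      assume "y = last (W y) \<and> z = hd (W z)"
      then have "z = hd (u @ [x])" using Wz by (cases u) auto
      then have "z \<in> set (u @ [x])" by (metis hd_in_set snoc_eq_iff_butlast)
      then show ?thesis using dist uv by auto
    qed
  qed
  show sub: "set (W a) \<subseteq> C"
  proof (rule successively_set_subset[OF successively_consecutive _ a])
    show "a \<in> set (W a)" by (rule omega_path_eq_word(3)[OF arcs[OF a]])
    show "z \<in> C" if "x \<in> C" "?R x z" for x z using C(1)[OF that(1)] succ[OF that(2)] by blast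
    show "x \<in> C" if "z \<in> C" "?R x z" for x z using C(2)[OF that(1)] pred[OF that(2)] by blast
  qed
  show "successively s (W a)"
  proof (rule successively_mono[OF successively_consecutive])
    fix x z assume "x \<in> set (W a)" and R: "?R x z"
    then obtain y where "s x y" using C(1) sub by blast
    then show "s x z" using succ[OF R] by blast
  qed
qed

text \<open>The closed set \<open>C\<close> swallows the whole component, so \<omega>(N) becomes a
  closed chain of \<open>s\<close> and every relation occurring in its powers is again a minimal
  zero word inside \<open>C\<close>.\<close>

lemma isolated_orels_imp_unique_relation:
  assumes isolated_orels and om: "omega_choice G I c om" and p: "orel p"
  defines "N \<equiv> relation_component G I c (word G p)"
  shows "cyclic_path G (om N) \<and>
    zero_relations G I c N \<inter> {u. \<exists>n\<ge>1. subpath G u (path_power (om N) n)} = {word G p}"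
proof -
  have N: "N \<in> components G I c" "set p \<subseteq> A N"
    unfolding N_def by (rule relation_component_eq[OF p])+
  have p_ne: "p \<noteq> []" "length p > 2" using p by (auto simp: orel_def)
  obtain C where C: "\<And>x. x \<in> C \<Longrightarrow> \<exists>y\<in>C. s x y" "\<And>x. x \<in> C \<Longrightarrow> \<exists>y\<in>C. s y x"
    "set p \<subseteq> C" "\<And>r. orel r \<Longrightarrow> set r \<subseteq> C \<Longrightarrow> r = p"
    using assms(1) p unfolding isolated_orels_def by metis
  have closed: "x \<in> C \<longleftrightarrow> y \<in> C" if "s x y" for x y
    using C(1)[of x] C(2)[of y] Z_right_unique[OF that] Z_left_unique[OF that] by blast
  note props = component_props[OF N(1)]
  have omega_in: "set (arrows x) \<subseteq> C" if "x \<in> verts H" "b \<in> set (arrows x)" "b \<in> C" for x b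
    using omega_word_subset_closed(1)[OF C(1,2) that(3)] verts_HD(5)[OF that(1,2)] by simp
  have ends: "hd (arrows x) \<in> set (arrows x)" "last (arrows x) \<in> set (arrows x)" if "x \<in> verts H" for x
    using verts_HD(2)[OF that] by (auto simp: path_word_def)
  have hdp: "hd p \<in> arcs G" "omega_path G c (hd p) \<in> verts N" "hd p \<in> C"
    using subsetD[OF N(2) hd_in_set[OF p_ne(1)]] subsetD[OF C(3) hd_in_set[OF p_ne(1)]] by simp_all
  \<comment> \<open>A path \<open>\<omega>\<^sub>a\<close> that meets \<open>C\<close> lies in
    \<open>C\<close>, and edges of \<open>N\<close> are steps of \<open>s\<close>. So the paths
    contained in \<open>C\<close> form a closed set of vertices of the connected graph
    \<open>N\<close>.\<close>
  have verts_C: "verts N \<subseteq> {x. set (arrows x) \<subseteq> C}"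
  proof (rule connected_arc_closed[OF props(6) _ hdp(2)])
    show "omega_path G c (hd p) \<in> {x. set (arrows x) \<subseteq> C}"
      using omega_word_subset_closed(1)[OF C(1,2) hdp(3)] by simp
    fix e assume "e \<in> arcs N"
    moreover obtain x y where [simp]: "e = (x, y)" by (cases e)
    ultimately have xy: "x \<in> verts H" "y \<in> verts H" "s (last (arrows x)) (hd (arrows y))"
      using props(2) in_arcs_H_iff[of x y] by auto
    have "set (arrows x) \<subseteq> C \<longleftrightarrow> set (arrows y) \<subseteq> C"
      using closed[OF xy(3)] omega_in[OF xy(1)] omega_in[OF xy(2)] ends[OF xy(1)] ends[OF xy(2)]
      by blast
    then show "tail N e \<in> {x. set (arrows x) \<subseteq> C} \<longleftrightarrow> head N e \<in> {x. set (arrows x) \<subseteq> C}"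
      by (simp add: props(3,4))
  qed
  have A_C: "A N \<subseteq> C" using verts_C omega_path_eq_word(3) by auto
  obtain V where V: "om N = word G V" "set V = A N" "distinct V" "path_word G V"
    and V_succ: "\<And>P. (\<And>x z. x \<in> A N \<Longrightarrow> s x z \<Longrightarrow> P x z)
       \<Longrightarrow> (\<And>x. x \<in> verts N \<Longrightarrow> successively P (arrows x)) \<Longrightarrow> successively P V"
    using component_path[OF N(1) om] by metis
  have sV: "successively s V"
  proof (rule V_succ)
    fix x assume x: "x \<in> verts N"
    then have "x \<in> verts H" using props(1) by blast
    then obtain b where b: "b \<in> arcs G" "x = omega_path G c b" by auto
    then have "b \<in> C" using omega_path_eq_word(3)[OF b(1)] verts_C x by blast
    then show "successively s (arrows x)" using omega_word_subset_closed(2)[OF C(1,2)] b by blast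
  qed
  have V_ne: "V \<noteq> []" using V(4) by (simp add: path_word_def)
  \<comment> \<open>The successor of \<open>last V\<close> exists in \<open>C\<close> and stays in
    the component, hence in \<open>V\<close>. Anywhere but at the front, its predecessor in
    \<open>V\<close> would be a second occurrence of \<open>last V\<close>.\<close>
  have cyc: "s (last V) (hd V)"
  proof -
    have last: "last V \<in> A N" using V_ne V(2) last_in_set by blast
    then obtain y where y: "s (last V) y" using C(1) A_C by blast
    then have "y \<in> set V" using component_s_closed[OF N(1) y] last V(2) by blast
    then obtain u v where uv: "V = u @ y # v" by (auto dest: split_list)
    have "u = []"
    proof (cases u rule: rev_cases)
      case (snoc u' z)
      then have "s z y" using sV by (auto simp: uv successively_append_iff)
      then have "z = last V" using y Z_left_unique by blast
      moreover have "last V \<in> set (y # v)" using uv by simp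
      ultimately show ?thesis using V(3) snoc by (simp add: uv split: if_splits)
    qed
    then show ?thesis using y uv by simp
  qed
  then have cycV: "successively s (V @ V)" using sV by (simp add: successively_append_iff)
  have ht: "head G (last V) = tail G (hd V)" using s_path_word[OF cyc] by (simp add: path_word_def)
  then have "cyclic_path G (om N)" using V_ne by (simp add: V(1) cyclic_path_def qtgt_word)
  moreover have "zero_relations G I c N \<inter> {u. \<exists>n\<ge>1. subpath G u (path_power (om N) n)} = {word G p}"
  proof (intro equalityI subsetI)
    fix u assume "u \<in> zero_relations G I c N \<inter> {u. \<exists>n\<ge>1. subpath G u (path_power (om N) n)}"
    then obtain q where q: "u = word G q" "set q \<subseteq> A N" "minimal_zero q"
      and pow: "\<exists>n\<ge>1. subpath G (word G q) (path_power (word G V) n)"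
      unfolding Int_iff zero_relations_iff[OF N(1)] V(1) by blast
    have q_ne: "q \<noteq> []" using q(3) by (auto simp: minimal_zero_def path_word_def)
    obtain n x y where "concat (replicate n V) = x @ q @ y"
      using pow unfolding subpath_power_iff[OF V(4) ht q_ne] by blast
    then have sq: "successively s q"
      using successively_concat_replicate[OF cycV, of n] successively_factor[of s x q y] by simp
    \<comment> \<open>Relations of length two do not occur here: the pair would be adjacent in a
      chain of \<open>s\<close> and hence nonzero.\<close>
    have "length q > 2"
    proof (rule ccontr)
      assume "\<not> length q > 2"
      moreover have "tl q \<noteq> []" using q(3) Z_nonempty by (auto simp: minimal_zero_def)
      ultimately obtain a b where "q = [a, b]" by (cases q; cases "tl q"; cases "tl (tl q)") auto
      then show False using sq q(3) by (simp add: minimal_zero_def)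
    qed
    then have "orel q" using q(3) orel_iff_minimal_zero by blast
    then have "q = p" using C(4) q(2) A_C by blast
    then show "u \<in> {word G p}" using q(1) by simp
  next
    fix u assume "u \<in> {word G p}"
    moreover have "word G p \<in> zero_relations G I c N"
      using zero_relations_iff[OF N(1)] N(2) p orel_iff_minimal_zero by blast
    moreover have "hd p \<in> set V" using N(2) V(2) hd_in_set[OF p_ne(1)] by blast
    then have "\<exists>n\<ge>1. subpath G (word G p) (path_power (om N) n)"
      unfolding V(1) subpath_power_iff[OF V(4) ht p_ne(1)]
      by (rule factor_of_power[OF cycV orel_successively[OF p] p_ne(1)])
    ultimately show "u \<in> zero_relations G I c N \<inter> {u. \<exists>n\<ge>1. subpath G u (path_power (om N) n)}"
      by simp
  qed
  ultimately show ?thesis by blast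
qed

text \<open>The closed set required for \<open>p\<close> is the set of arrows of \<omega>(N). The
  uniqueness clause is used twice: against zero pairs, and against further minimal zero
  words.\<close>

lemma unique_relation_imp_isolated_orels:
  assumes om: "omega_choice G I c om"
    and uniq: "\<And>r N. omega_relation G I r \<Longrightarrow> N = relation_component G I c r \<Longrightarrow>
      cyclic_path G (om N) \<and>
      zero_relations G I c N \<inter> {u. \<exists>n\<ge>1. subpath G u (path_power (om N) n)} = {r}"
  shows isolated_orels
  unfolding isolated_orels_def
proof (intro allI impI)
  fix p assume p: "orel p"
  define N where "N = relation_component G I c (word G p)"
  have N: "N \<in> components G I c" "set p \<subseteq> A N"
    unfolding N_def by (rule relation_component_eq[OF p])+
  obtain V where V: "om N = word G V" "set V = A N" "path_word G V"
    using component_path[OF N(1) om] by metis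
  have V_ne: "V \<noteq> []" using V(3) by (simp add: path_word_def)
  have uniq_p: "cyclic_path G (om N)"
    "zero_relations G I c N \<inter> {u. \<exists>n\<ge>1. subpath G u (path_power (om N) n)} = {word G p}"
    using uniq[of "word G p" N] p omega_relation_iff by (auto simp: N_def)
  have ht: "head G (last V) = tail G (hd V)"
    using uniq_p(1) V_ne by (simp add: V(1) cyclic_path_def qtgt_word)
  have relation: "q = p"
    if "minimal_zero q" "set q \<subseteq> A N" "\<exists>n\<ge>1. \<exists>u w. concat (replicate n V) = u @ q @ w" for q
  proof -
    have "q \<noteq> []" using that(1) by (auto simp: minimal_zero_def path_word_def)
    then have "\<exists>n\<ge>1. subpath G (word G q) (path_power (om N) n)"
      using that(3) subpath_power_iff[OF V(3) ht] V(1) by simp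
    then have "word G q \<in> zero_relations G I c N \<inter> {u. \<exists>n\<ge>1. subpath G u (path_power (om N) n)}"
      using zero_relations_iff[OF N(1)] that(1,2) by blast
    then have "word G q = word G p" unfolding uniq_p(2) by (rule singletonD)
    then show ?thesis by simp
  qed
  have cycV: "successively s (V @ V)"
  proof (rule successively_mono[OF successively_consecutive])
    fix x z assume "x \<in> set (V @ V)" "\<exists>u v. V @ V = u @ [x, z] @ v"
    then obtain u v where uv: "V @ V = u @ [x, z] @ v" by blast
    have pw: "path_word G (V @ V)" using V(3) V_ne ht by (simp add: path_word_append_iff)
    \<comment> \<open>A zero pair in \<open>V @ V\<close> would itself be a relation in the second
      power of \<omega>(N), hence equal to \<open>p\<close>, which has more than two
      letters.\<close>
    show "s x z"
    proof (rule ccontr)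
      assume nz: "\<not> s x z"
      have "path_word G [x, z]" using pw path_word_factor[of G u "[x, z]" v] uv by simp
      moreover from this have "x \<in> arcs G" "z \<in> arcs G" by (auto simp: path_word_def)
      ultimately have "minimal_zero [x, z]" using nz by (simp add: minimal_zero_def Z_arc)
      moreover have "set [x, z] \<subseteq> set (V @ V)" unfolding uv by auto
      then have "set [x, z] \<subseteq> A N" using V(2) by simp
      moreover have "concat (replicate 2 V) = u @ [x, z] @ v" using uv by (simp add: numeral_2_eq_2)
      then have "\<exists>n\<ge>1. \<exists>u w. concat (replicate n V) = u @ [x, z] @ w"
        by (intro exI[of _ "2 :: nat"]) auto
      ultimately have "[x, z] = p" by (rule relation)
      then show False using p by (auto simp: orel_def)
    qed
  qed
  \<comment> \<open>In \<open>V @ V\<close> the first copy of a letter always has a right neighbour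
    and the second copy a left neighbour; this covers the last and the first letter of
    \<open>V\<close>.\<close>
  have next_prev: "(\<exists>y\<in>set V. s x y) \<and> (\<exists>y\<in>set V. s y x)" if "x \<in> set V" for x
  proof -
    from that obtain u v where uv: "V = u @ x # v" by (auto dest: split_list)
    have "V @ V = u @ [x] @ (v @ V)" "V @ V = (V @ u) @ [x] @ v" using uv by simp_all
    then have "successively s (u @ [x] @ (v @ V))" "successively s ((V @ u) @ [x] @ v)"
      using cycV by metis+
    then have "s x (hd (v @ V))" "s (last (V @ u)) x"
      using V_ne unfolding successively_append_iff by auto
    moreover have "set (v @ V) = set V" "set (V @ u) = set V" using arg_cong[OF uv, of set] by auto
    then have "hd (v @ V) \<in> set V" "last (V @ u) \<in> set V"
      using V_ne hd_in_set[of "v @ V"] last_in_set[of "V @ u"] by simp_all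
    ultimately show ?thesis by blast
  qed
  \<comment> \<open>Any minimal zero word on these letters is a chain of \<open>s\<close>, so by
    determinism it occurs in a power of \<open>V\<close> and the uniqueness clause applies to
    it.\<close>
  have "r = p" if "orel r" "set r \<subseteq> set V" for r
  proof (rule relation)
    show "minimal_zero r" using that(1) orel_iff_minimal_zero by blast
    show "set r \<subseteq> A N" using that(2) V(2) by simp
    have "r \<noteq> []" using that(1) by (auto simp: orel_def)
    then show "\<exists>n\<ge>1. \<exists>u w. concat (replicate n V) = u @ r @ w"
      using that(2) by (intro factor_of_power[OF cycV orel_successively[OF that(1)]]) auto
  qed
  then show "\<exists>C. (\<forall>x\<in>C. (\<exists>y\<in>C. s x y) \<and> (\<exists>y\<in>C. s y x)) \<and> set p \<subseteq> C \<and>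
          (\<forall>r'. orel r' \<and> set r' \<subseteq> C \<longrightarrow> r' = p)"
    using next_prev N(2) V(2) by (intro exI[of _ "set V"]) blast
qed

theorem UMP_iff_unique_relations:
  assumes om: "omega_choice G I c om"
  shows "UMP_algebra G I \<longleftrightarrow>
    (\<forall>r. omega_relation G I r \<longrightarrow>
       (let N = relation_component G I c r in
          cyclic_path G (om N) \<and>
          zero_relations G I c N \<inter> {u. \<exists>p\<ge>1. subpath G u (path_power (om N) p)} = {r}))"
    (is "_ \<longleftrightarrow> ?R")
proof -
  have "isolated_orels \<longleftrightarrow> ?R"
  proof
    assume iso: isolated_orels
    show ?R
    proof (intro allI impI)
      fix r assume "omega_relation G I r"
      then obtain p where "r = word G p" "orel p" unfolding omega_relation_iff by (elim exE conjE)
      then show "let N = relation_component G I c r in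
          cyclic_path G (om N) \<and>
          zero_relations G I c N \<inter> {u. \<exists>p\<ge>1. subpath G u (path_power (om N) p)} = {r}"
        unfolding Let_def using isolated_orels_imp_unique_relation[OF iso om, of p] by simp
    qed
  next
    assume R: ?R
    show isolated_orels
    proof (rule unique_relation_imp_isolated_orels[OF om])
      fix r N assume r: "omega_relation G I r" and N: "N = relation_component G I c r"
      show "cyclic_path G (om N) \<and>
          zero_relations G I c N \<inter> {u. \<exists>p\<ge>1. subpath G u (path_power (om N) p)} = {r}"
        using R[rule_format, OF r] unfolding Let_def N .
    qed
  qed
  then show ?thesis unfolding UMP_iff_unique_max unique_max_iff .
qed

end

theorem theorem1p1:
  fixes Q :: "('v, 'a) pre_digraph"
    and I :: "(('v, 'a) qpath \<Rightarrow>\<^sub>0 'k::alg_closed_field) set"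
    and c :: "'a list"
    and om :: "('v, 'a) ram_graph \<Rightarrow> ('v, 'a) qpath"
  assumes "fin_digraph Q" and "Digraph_Component.connected Q"
    and "admissible_ideal Q I"
    and "cyclic_quiver Q \<Longrightarrow> oriented_cycle Q c"
    and "omega_choice Q I c om"
    and "special_multiserial Q I"
    and "locally_monomial Q I c"
  shows "UMP_algebra Q I \<longleftrightarrow>
    (\<forall>r. omega_relation Q I r \<longrightarrow>
       (let N = relation_component Q I c r in
          cyclic_path Q (om N) \<and>
          zero_relations Q I c N \<inter> {u. \<exists>p\<ge>1. subpath Q u (path_power (om N) p)} = {r}))"
proof -
  interpret Q: fin_digraph Q by fact
  obtain m where m: "\<forall>p. path_word Q p \<longrightarrow> m \<le> length p \<longrightarrow> path_elem (word Q p) \<in> I"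
    using Q.admissible_bounds(3)[OF assms(3)] by (elim exE)
  interpret I: path_ideal Q I by (rule Q.admissible_bounds(1)[OF assms(3)])
  interpret multiserial_quiver Q c I m
  proof unfold_locales
    show "2 \<le> length (arrows w)" if "path_elem w \<in> I" for w
      using Q.admissible_bounds(2)[OF assms(3) that] .
    show "path_elem (word Q p) \<in> I" if "path_word Q p" "m \<le> length p" for p
      using m that by simp
  qed (use assms in auto)
  show ?thesis by (rule UMP_iff_unique_relations[OF assms(5)])
qed

end
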